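(* Let $K$ be an origin-symmetric star body in $\mathbb{R}^n$. The space $(\mathbb{R}^n,\|\cdot\|_K)$ embeds in $L_0$ if and only if the Fourier transform of $\ln\|x\|_K$ (in the sense of distributions) is a negative distribution outside of the origin in $\mathbb{R}^n$.
   Context: An origin-symmetric star body in $\mathbb{R}^n$ is a compact set $K$, symmetric about the origin, such that every straight line through the origin crosses the boundary of $K$ at exactly two points, the boundary is continuous (i.e. the radial function $x\mapsto\|x\|_K^{-1}$ is continuous on $S^{n-1}$), and the origin is an interior point of $K$. Its Minkowski functional is $\|x\|_K=\min\{a\ge 0: x\in aK\}$. The space $(\mathbb{R}^n,\|\cdot\|_K)$ embeds in $L_0$ if there exist a finite Borel (non-negative) measure $\mu$ on $S^{n-1}$ and a constant $C\in\mathbb{R}$ such that for every $x\in\mathbb{R}^n$, $\ln\|x\|_K=\int_{S^{n-1}}\ln|(x,\xi)|\,d\mu(\xi)+C$. The Fourier transform of a tempered distribution $f$ is defined by $\langle\hat f,\phi\rangle=\langle f,\hat\phi\rangle$ for every Schwartz test function $\phi$, where $\hat\phi(\xi)=\int_{\mathbb{R}^n}\phi(x)e^{-i(x,\xi)}dx$. A distribution is negative outside of the origin if it assumes non-positive values on all non-negative test functions with compact support in $\mathbb{R}^n\setminus\{0\}$. *)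

theory Defs
  imports "HOL-Analysis.Analysis"
begin

section \<open>Star bodies\<close>

text \<open>
  For an origin-symmetric star body the set below is closed and nonempty, so its least element
  exists; for an arbitrary set \<open>K\<close> the value is unspecified.
\<close>

definition minkowski_functional :: "'a::euclidean_space set \<Rightarrow> 'a \<Rightarrow> real" where
  "minkowski_functional K x = (LEAST a. 0 \<le> a \<and> x \<in> (\<lambda>y. a *\<^sub>R y) ` K)"

definition symmetric_star_body :: "'a::euclidean_space set \<Rightarrow> bool" where
  "symmetric_star_body K \<longleftrightarrow>
     compact K \<and>
     (\<forall>x\<in>K. - x \<in> K) \<and>
     (\<forall>u. u \<noteq> 0 \<longrightarrow> card (span {u} \<inter> frontier K) = 2) \<and>
     continuous_on (sphere 0 1) (\<lambda>x. inverse (minkowski_functional K x)) \<and>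
     0 \<in> interior K"

section \<open>Embedding in \<open>L\<^sub>0\<close>\<close>

text \<open>
  The identity defining the embedding is required at every \<open>x\<close>, including \<open>x = 0\<close>, and
  its integrand is \<open>-\<infinity>\<close> on the hyperplane orthogonal to \<open>x\<close>. The logarithm and the
  integral therefore take extended real values; the library's real logarithm has
  \<open>ln 0 = 0\<close>, and its Bochner integral is \<open>0\<close> for non-integrable functions.
\<close>

definition ext_ln :: "real \<Rightarrow> ereal" where
  "ext_ln t = (if t = 0 then -\<infinity> else ereal (ln t))"

text \<open>
  The conversion \<^const>\<open>e2ennreal\<close> sends negative numbers to \<open>0\<close>, so this is the integral
  of the positive part minus the integral of the negative part. Below, the integrand is bounded
  above and the measure is finite, so \<open>\<infinity> - \<infinity>\<close> does not occur.
\<close>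

definition ext_integral :: "'a measure \<Rightarrow> ('a \<Rightarrow> ereal) \<Rightarrow> ereal" where
  "ext_integral M f =
     enn2ereal (\<integral>\<^sup>+ x. e2ennreal (f x) \<partial>M) - enn2ereal (\<integral>\<^sup>+ x. e2ennreal (- f x) \<partial>M)"

definition embeds_in_L0 :: "'a::euclidean_space set \<Rightarrow> bool" where
  "embeds_in_L0 K \<longleftrightarrow>
     (\<exists>(\<mu> :: 'a measure) (C :: real).
        sets \<mu> = sets (restrict_space borel (sphere 0 1)) \<and> finite_measure \<mu> \<and>
        (\<forall>x. ext_ln (minkowski_functional K x) =
               ext_integral \<mu> (\<lambda>\<xi>. ext_ln \<bar>x \<bullet> \<xi>\<bar>) + ereal C))"

section \<open>Schwartz functions and the Fourier transform of distributions\<close>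

fun iter_deriv :: "'a::euclidean_space list \<Rightarrow> ('a \<Rightarrow> complex) \<Rightarrow> 'a \<Rightarrow> complex" where
  "iter_deriv [] f = f"
| "iter_deriv (b # bs) f = (\<lambda>x. frechet_derivative (iter_deriv bs f) (at x) b)"

text \<open>
  Differentiability of all iterated partial derivatives makes them all continuous, so the first
  conjunct says that \<open>f\<close> is of class \<open>C\<^sup>\<infinity>\<close>.
\<close>

definition schwartz :: "('a::euclidean_space \<Rightarrow> complex) \<Rightarrow> bool" where
  "schwartz f \<longleftrightarrow>
     (\<forall>bs\<in>lists Basis. \<forall>x. iter_deriv bs f differentiable (at x)) \<and>
     (\<forall>k::nat. \<forall>bs\<in>lists Basis. bounded (range (\<lambda>x. norm x ^ k *\<^sub>R iter_deriv bs f x)))"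

definition fourier :: "('a::euclidean_space \<Rightarrow> complex) \<Rightarrow> 'a \<Rightarrow> complex" where
  "fourier \<phi> \<xi> = (LINT x|lborel. \<phi> x * exp (- \<i> * complex_of_real (x \<bullet> \<xi>)))"

text \<open>
  A distribution is represented by its action on functions, of which only the values at Schwartz
  functions matter. A locally integrable function of moderate growth acts by integration; its
  values on a null set, such as the point where \<open>ln \<parallel>x\<parallel>\<close> is infinite, are irrelevant.
\<close>

definition regular_distr :: "('a::euclidean_space \<Rightarrow> real) \<Rightarrow> ('a \<Rightarrow> complex) \<Rightarrow> complex" where
  "regular_distr f \<phi> = (LINT x|lborel. complex_of_real (f x) * \<phi> x)"

definition fourier_distr ::
  "(('a::euclidean_space \<Rightarrow> complex) \<Rightarrow> complex) \<Rightarrow> ('a \<Rightarrow> complex) \<Rightarrow> complex" where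
  "fourier_distr T \<phi> = T (fourier \<phi>)"

definition negative_outside_origin ::
  "(('a::euclidean_space \<Rightarrow> complex) \<Rightarrow> complex) \<Rightarrow> bool" where
  "negative_outside_origin T \<longleftrightarrow>
     (\<forall>\<phi>. schwartz \<phi> \<and> (\<forall>x. \<phi> x \<in> \<real>\<^sub>\<ge>\<^sub>0) \<and>
          compact (closure {x. \<phi> x \<noteq> 0}) \<and> 0 \<notin> closure {x. \<phi> x \<noteq> 0}
        \<longrightarrow> T \<phi> \<in> \<real>\<^sub>\<le>\<^sub>0)"

end

theory Submission
  imports Defs "HOL-Probability.Probability" "HOL-Real_Asymp.Real_Asymp"
begin

text \<open>
  Let \<open>N\<close> be the Minkowski functional of \<open>K\<close> and \<open>f = ln N\<close>. The function \<open>f\<close> is even, is continuous away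
  from \<open>0\<close>, differs from \<open>ln (norm x)\<close> by a bounded amount, and satisfies \<open>f (c x) = ln c + f x\<close> for
  \<open>c > 0\<close> (\<open>homogeneous_log_minkowski\<close>).

  From the integral representation to the sign of the Fourier transform. Frullani's formula
  \<open>ln \<bar>a\<bar> = \<integral> (exp (- e\<^bsup>2v\<^esup> / 2) - exp (- e\<^bsup>2v\<^esup> a\<^sup>2 / 2)) dv\<close> writes a logarithm as a mixture of Gaussians
  in \<open>a\<close>, and a Gaussian in \<open>a\<close> is an average of characters. Suppose
  \<open>f x = \<integral> ln \<bar>(x, \<xi>)\<bar> d\<mu> + C\<close>, and let \<open>\<phi> \<ge> 0\<close> be a test function with \<open>\<phi> 0 = 0\<close>. By Fourier
  inversion the constant terms pair with the transform of \<open>\<phi>\<close> to a multiple of \<open>\<phi> 0 = 0\<close>, and the Gaussian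
  in \<open>(x, \<xi>)\<close> pairs to an average of \<open>(2\<pi>)\<^sup>n \<phi>\<close> along the line through \<open>\<xi>\<close>. The Gaussians enter with
  a minus sign, so the total is not positive (\<open>fourier_nonpos_of_log_integral\<close>).

  From the sign to the representation. If the transform of \<open>f\<close> is negative off the origin, then minus it is
  a measure there, and the rule \<open>f (c x) = ln c + f x\<close> makes this measure homogeneous of degree
  \<open>- n\<close>: in polar coordinates it is \<open>dr / r\<close> times a measure \<open>\<mu>\<close> on the sphere. The proof obtains
  \<open>\<mu>\<close> by approximation. Multiply \<open>f\<close> by \<open>b (\<delta> x)\<close>, where \<open>b\<close> is the transform of a smooth bump. Minus the
  transform of the product is a function, and it is nonnegative outside the ball of radius \<open>\<delta>\<close>, because its
  value at \<open>y\<close> tests the distribution against a bump around \<open>y\<close> (\<open>spectrum_nonneg\<close>).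
  Integrated against Gaussian waves, these functions recover the Gaussian averages of \<open>f\<close> as
  \<open>\<delta> \<rightarrow> 0\<close> (\<open>spectrum_gauss_limit\<close>), and combinations of waves that vanish to second order at the
  origin do not feel the excluded ball (\<open>spectral_measure_limit\<close>). Weighted by a cutoff and projected to
  the sphere they have convergent mass, and \<open>weak_compactness\<close> provides \<open>\<mu>\<close>.
  Homogeneity enters when a test function is averaged over its dilations. On the side of the measures
  the average replaces the test function by a function of the direction only; on the side of \<open>f\<close> it
  is a Frullani integral. Comparing the two gives a universal function \<open>k\<close> with
  \<open>E f (x + Z) - E f Z = \<integral> k ((x, \<xi>)) d\<mu>\<close> for a standard Gaussian \<open>Z\<close> (\<open>spectral_representation\<close>).

  Identifying the kernel and removing the average. The logarithm \<open>ln \<bar>u\<bar>\<close> on the line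
  satisfies the same hypotheses by the first half, and there the sphere is \<open>{-1, 1}\<close>; hence
  \<open>k a = E ln \<bar>a + Z\<bar> - E ln \<bar>Z\<bar>\<close> (\<open>log_kernel_eq_increment\<close>). So the Gaussian averages of \<open>f\<close> and of
  \<open>\<integral> ln \<bar>(x, \<xi>)\<bar> d\<mu>\<close> differ by a constant at every scale. Letting the variance tend to \<open>0\<close>, with Fatou's
  lemma for the integrability of \<open>ln \<bar>(x, \<xi>)\<bar>\<close>, gives the identity at every \<open>x \<noteq> 0\<close>
  (\<open>log_integral_representation\<close>).
\<close>

section \<open>Weak compactness of measures on a compact set\<close>

text \<open>
  Helly's selection theorem is about the line. It is carried to a compact set in a Euclidean
  space by a continuous map from the line onto the set that has a Borel right inverse: Schoenberg's
  space-filling curve. The wave below is continuous, has period \<open>2\<close>, equals \<open>0\<close> on \<open>[0, 1/3]\<close> and \<open>1\<close> on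
  \<open>[2/3, 1]\<close>; it therefore reads off ternary digits from a point of the Cantor set.
\<close>
definition plateau_wave :: "real \<Rightarrow> real" where
  "plateau_wave t = max 0 (min 1 (1/2 - cos (pi * t)))"

lemma plateau_wave_bounds: "0 \<le> plateau_wave t" "plateau_wave t \<le> 1"
  by (auto simp: plateau_wave_def)

lemma continuous_on_plateau_wave [continuous_intros]:
  fixes f :: "real \<Rightarrow> real"
  shows "continuous_on A f \<Longrightarrow> continuous_on A (\<lambda>t. plateau_wave (f t))"
  unfolding plateau_wave_def
  by (intro continuous_on_max continuous_on_min continuous_intros continuous_on_cos)

lemma plateau_wave_even_integer: "plateau_wave (2 * of_int k + u) = plateau_wave u"
proof -
  have "cos (pi * (2 * of_int k + u)) = cos (pi * u + 2 * pi * of_int k)"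
    by (simp add: algebra_simps)
  also have "\<dots> = cos (pi * u)"
    by (simp add: cos_add)
  finally show ?thesis by (simp add: plateau_wave_def)
qed

lemma plateau_wave_low: assumes "0 \<le> u" "u \<le> 1/3" shows "plateau_wave u = 0"
proof -
  have "cos (pi/3) \<le> cos (pi * u)"
    using assms by (intro cos_monotone_0_pi_le) auto
  then show ?thesis by (simp add: plateau_wave_def cos_60)
qed

lemma plateau_wave_high: assumes "2/3 \<le> u" "u \<le> 1" shows "plateau_wave u = 1"
proof -
  have "cos (pi * u) \<le> cos (pi - pi/3)"
    using assms by (intro cos_monotone_0_pi_le) auto
  also have "\<dots> = - 1/2" by (simp only: cos_diff cos_60 cos_pi sin_pi)
  finally show ?thesis by (simp add: plateau_wave_def)
qed

text \<open>The point of the Cantor set whose ternary digits are \<open>2 * d j\<close>.\<close>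
definition cantor_point :: "(nat \<Rightarrow> real) \<Rightarrow> real" where
  "cantor_point d = (\<Sum>j. 2 * d j / 3 ^ Suc j)"

lemma cantor_series:
  fixes d :: "nat \<Rightarrow> real"
  assumes "\<And>j. d j \<in> {0, 1}"
  shows "summable (\<lambda>j. 2 * d j / 3 ^ Suc j)" and "0 \<le> cantor_point d" and "cantor_point d \<le> 1"
proof -
  have le: "2 * d j / 3 ^ Suc j \<le> 2/3 * (1/3) ^ j" and nn: "0 \<le> 2 * d j / 3 ^ Suc j" for j
    using assms[of j] by (auto simp: field_simps)
  have geo: "(\<lambda>j. 2/3 * (1/3::real) ^ j) sums 1"
    using sums_mult[OF geometric_sums[of "1/3::real"], of "2/3"] by simp
  show s: "summable (\<lambda>j. 2 * d j / 3 ^ Suc j)"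
    by (rule summable_comparison_test'[OF sums_summable[OF geo], of 0])
       (use le nn in \<open>simp only: real_norm_def abs_of_nonneg\<close>)
  show "0 \<le> cantor_point d"
    unfolding cantor_point_def by (rule suminf_nonneg[OF s nn])
  show "cantor_point d \<le> 1"
    unfolding cantor_point_def using suminf_le[OF le s sums_summable[OF geo]] sums_unique[OF geo]
    by simp
qed

text \<open>
  Multiplication by \<open>3 ^ m\<close> moves the digits before position \<open>m\<close> into an even integer, which the wave
  ignores. What remains is \<open>2 * d m / 3\<close> plus a tail in \<open>[0, 1/3]\<close>, so it lies on one of the two plateaus.
\<close>
lemma plateau_wave_cantor_point:
  fixes d :: "nat \<Rightarrow> real"
  assumes d: "\<And>j. d j \<in> {0, 1}"
  shows "plateau_wave (3 ^ m * cantor_point d) = d m"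
proof -
  let ?tail = "cantor_point (\<lambda>j. d (j + Suc m))"
  have "cantor_point d = (\<Sum>j. 2 * d (j + Suc m) / 3 ^ Suc (j + Suc m)) + (\<Sum>j<Suc m. 2 * d j / 3 ^ Suc j)"
    unfolding cantor_point_def
    by (rule suminf_split_initial_segment[OF cantor_series(1)[OF d]])
  also have "(\<Sum>j. 2 * d (j + Suc m) / 3 ^ Suc (j + Suc m)) = ?tail / 3 ^ Suc m"
    unfolding cantor_point_def
    by (subst suminf_divide[symmetric, OF cantor_series(1)[OF d]]) (simp add: power_add mult_ac)
  finally have e: "3 ^ m * cantor_point d
      = 2 * (\<Sum>j<m. d j * 3 ^ m / 3 ^ Suc j) + (2 * d m / 3 + ?tail / 3)"
    by (simp add: field_simps sum_distrib_left sum_divide_distrib)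
  have "(\<Sum>j<m. d j * 3 ^ m / 3 ^ Suc j) \<in> \<int>"
  proof (rule Ints_sum)
    fix j assume "j \<in> {..<m}"
    then have "3 ^ m = (3::real) ^ (m - Suc j) * 3 ^ Suc j"
      using \<open>j \<in> {..<m}\<close> by (metis le_add_diff_inverse2 lessThan_iff power_add Suc_leI)
    then have "d j * 3 ^ m / 3 ^ Suc j = d j * 3 ^ (m - Suc j)"
      by simp
    moreover have "d j \<in> \<int>" using d[of j] by auto
    ultimately show "d j * 3 ^ m / 3 ^ Suc j \<in> \<int>" by simp
  qed
  then obtain k where k: "(\<Sum>j<m. d j * 3 ^ m / 3 ^ Suc j) = of_int k"
    by (rule Ints_cases)
  have t: "0 \<le> ?tail" "?tail \<le> 1" using cantor_series[of "\<lambda>j. d (j + Suc m)"] d by auto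
  show ?thesis
    unfolding e k plateau_wave_even_integer
    using d[of m] t by (auto intro!: plateau_wave_low plateau_wave_high)
qed

definition binary_digit :: "real \<Rightarrow> nat \<Rightarrow> real" where
  "binary_digit a k = of_int (\<lfloor>2 ^ Suc k * a\<rfloor> mod 2)"

lemma binary_digit_values: "binary_digit a k \<in> {0, 1}"
  unfolding binary_digit_def by auto

lemma binary_digit_measurable [measurable]: "(\<lambda>a. binary_digit a k) \<in> borel_measurable borel"
  unfolding binary_digit_def by measurable

lemma binary_digit_sums:
  assumes "0 \<le> a" "a < 1"
  shows "(\<lambda>k. binary_digit a k / 2 ^ Suc k) sums a"
proof -
  have part: "(\<Sum>k<m. binary_digit a k / 2 ^ Suc k) = of_int \<lfloor>2 ^ m * a\<rfloor> / 2 ^ m" for m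
  proof (induction m)
    case 0
    then show ?case using assms by (simp add: floor_eq_iff)
  next
    case (Suc m)
    have "\<lfloor>2 ^ Suc m * a\<rfloor> div 2 = \<lfloor>2 ^ m * a\<rfloor>"
      using floor_divide_real_eq_div[of 2 "2 ^ Suc m * a"] by simp
    then have "\<lfloor>2 ^ Suc m * a\<rfloor> = 2 * \<lfloor>2 ^ m * a\<rfloor> + \<lfloor>2 ^ Suc m * a\<rfloor> mod 2"
      using mult_div_mod_eq[of 2 "\<lfloor>2 ^ Suc m * a\<rfloor>"] by simp
    then have "real_of_int \<lfloor>2 ^ Suc m * a\<rfloor> = 2 * of_int \<lfloor>2 ^ m * a\<rfloor> + binary_digit a m"
      unfolding binary_digit_def by (metis of_int_add of_int_mult of_int_numeral)
    then have "real_of_int \<lfloor>2 ^ Suc m * a\<rfloor> / 2 ^ Suc m = of_int \<lfloor>2 ^ m * a\<rfloor> / 2 ^ m + binary_digit a m / 2 ^ Suc m"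
      by (simp only: add_divide_distrib power_Suc)
    then show ?case by (simp only: Suc.IH sum.lessThan_Suc)
  qed
  have "(\<lambda>m. of_int \<lfloor>2 ^ m * a\<rfloor> / 2 ^ m) \<longlonglongrightarrow> a"
  proof (rule tendsto_sandwich[of "\<lambda>m. a - (1/2) ^ m" _ _ "\<lambda>m. a"])
    show "(\<lambda>m. a - (1/2) ^ m) \<longlonglongrightarrow> a"
      using tendsto_diff[OF tendsto_const LIMSEQ_power_zero[of "1/2::real"], of a] by simp
    have "a - (1/2) ^ m \<le> of_int \<lfloor>2 ^ m * a\<rfloor> / 2 ^ m" for m
    proof -
      have "2 ^ m * a - 1 \<le> of_int \<lfloor>2 ^ m * a\<rfloor>" by linarith
      then have "(2 ^ m * a - 1) / 2 ^ m \<le> of_int \<lfloor>2 ^ m * a\<rfloor> / 2 ^ m"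
        by (rule divide_right_mono) simp
      then show ?thesis by (simp add: diff_divide_distrib power_one_over)
    qed
    then show "\<forall>\<^sub>F m in sequentially. a - (1/2) ^ m \<le> of_int \<lfloor>2 ^ m * a\<rfloor> / 2 ^ m" by simp
    have "of_int \<lfloor>2 ^ m * a\<rfloor> / 2 ^ m \<le> a" for m
      using of_int_floor_le[of "2 ^ m * a"] by (simp add: field_simps)
    then show "\<forall>\<^sub>F m in sequentially. of_int \<lfloor>2 ^ m * a\<rfloor> / 2 ^ m \<le> a" by simp
  qed simp
  then show ?thesis
    unfolding sums_def part .
qed

text \<open>
  The binary digits of all coordinates of \<open>x\<close> are interleaved into one digit sequence, and \<open>s x\<close> is the
  point of the Cantor set with these digits. The curve reads digit \<open>k\<close> of coordinate \<open>b\<close> at position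
  \<open>k * n + e b\<close> and sums the binary series.
\<close>
lemma space_filling_curve:
  fixes S :: "'a::euclidean_space set"
  assumes "bounded S"
  obtains c :: "real \<Rightarrow> 'a" and s :: "'a \<Rightarrow> real"
  where "continuous_on UNIV c" "bounded (range c)" "s \<in> borel_measurable borel"
    "\<And>x. x \<in> S \<Longrightarrow> c (s x) = x" "\<And>x. 0 \<le> s x" "\<And>x. s x \<le> 1"
proof -
  obtain R where R: "R > 0" "\<And>x. x \<in> S \<Longrightarrow> norm x \<le> R"
    using assms bounded_pos by blast
  define n where "n = DIM('a)"
  have n: "n > 0" by (simp add: n_def)
  obtain e where e: "bij_betw e (Basis::'a set) {..<n}"
    using ex_bij_betw_finite_nat[OF finite_Basis] by (auto simp: n_def lessThan_atLeast0)
  define e' where "e' = the_inv_into (Basis::'a set) e"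
  have e'e: "e' (e b) = b" if "b \<in> Basis" for b
    using e that by (simp add: e'_def bij_betw_def the_inv_into_f_f)
  have elt: "e b < n" if "b \<in> Basis" for b
    using e that by (auto simp: bij_betw_def)
  \<comment> \<open>Binary expansions need the half-open interval, hence \<open>2 * R + 1\<close> instead of \<open>2 * R\<close>.\<close>
  define coord where "coord b x = (x \<bullet> b + R) / (2 * R + 1)" for b x :: 'a
  have coord: "0 \<le> coord b x" "coord b x < 1" if "x \<in> S" "b \<in> Basis" for b x
    using Basis_le_norm[OF that(2), of x] R(1) R(2)[OF that(1)] by (auto simp: coord_def field_simps abs_le_iff)
  define digit where "digit x j = binary_digit (coord (e' (j mod n)) x) (j div n)" for x :: 'a and j
  have digit: "digit x j \<in> {0, 1}" for x j
    unfolding digit_def by (rule binary_digit_values)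
  define s where "s x = cantor_point (digit x)" for x
  define cc where "cc b t = (\<Sum>k. plateau_wave (3 ^ (k * n + e b) * t) / 2 ^ Suc k)" for b :: 'a and t
  have Mtest: "norm (plateau_wave (3 ^ (k * n + e b) * t) / 2 ^ Suc k) \<le> (1/2) ^ Suc k" for b t k
    using plateau_wave_bounds[of "3 ^ (k * n + e b) * t"] by (simp add: field_simps)
  have geo: "(\<lambda>k. (1/2::real) ^ Suc k) sums 1"
    using power_half_series .
  have cc_lim: "uniform_limit UNIV (\<lambda>m t. \<Sum>k<m. plateau_wave (3 ^ (k * n + e b) * t) / 2 ^ Suc k) (cc b) sequentially" for b
    unfolding cc_def by (rule Weierstrass_m_test[OF Mtest sums_summable[OF geo]])
  have cc_cont: "continuous_on UNIV (cc b)" for b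
    by (rule uniform_limit_theorem[OF _ cc_lim]) (auto intro!: always_eventually continuous_intros)
  have cc_bd: "\<bar>cc b t\<bar> \<le> 1" for b t
  proof -
    have s1: "summable (\<lambda>k. plateau_wave (3 ^ (k * n + e b) * t) / 2 ^ Suc k)"
      by (rule summable_comparison_test'[OF sums_summable[OF geo] Mtest])
    have "cc b t \<le> (\<Sum>k. (1/2::real) ^ Suc k)" unfolding cc_def
      by (rule suminf_le[OF _ s1 sums_summable[OF geo]]) (use Mtest[of _ b t] in \<open>simp only: real_norm_def abs_le_iff\<close>)
    moreover have "0 \<le> cc b t" unfolding cc_def
      by (rule suminf_nonneg[OF s1]) (simp add: plateau_wave_bounds)
    ultimately show ?thesis using sums_unique[OF geo] by simp
  qed
  have cc_s: "cc b (s x) = coord b x" if "x \<in> S" "b \<in> Basis" for b x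
  proof -
    have "plateau_wave (3 ^ (k * n + e b) * s x) = binary_digit (coord b x) k" for k
      unfolding s_def using digit elt[OF that(2)] e'e[OF that(2)]
      by (subst plateau_wave_cantor_point) (simp_all add: digit_def)
    then show ?thesis
      unfolding cc_def using sums_unique[OF binary_digit_sums[OF coord[OF that]]] by simp
  qed
  define c where "c t = (\<Sum>b\<in>Basis. ((2 * R + 1) * cc b t - R) *\<^sub>R b)" for t
  show ?thesis
  proof
    show "continuous_on UNIV c"
      unfolding c_def by (intro continuous_intros cc_cont)
    have "norm (c t) \<le> (\<Sum>b\<in>(Basis::'a set). 3 * R + 1)" for t
      unfolding c_def
    proof (rule order_trans[OF norm_sum], rule sum_mono)
      fix b :: 'a assume b: "b \<in> Basis"
      have "\<bar>(2 * R + 1) * cc b t\<bar> \<le> (2 * R + 1) * 1"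
        unfolding abs_mult using cc_bd[of b t] R(1) by (intro mult_mono) auto
      then show "norm (((2 * R + 1) * cc b t - R) *\<^sub>R b) \<le> 3 * R + 1"
        using b R(1) by (simp add: norm_Basis)
    qed
    then show "bounded (range c)" by (auto simp: bounded_iff)
    show "s \<in> borel_measurable borel"
      unfolding s_def cantor_point_def digit_def coord_def by measurable
    show "c (s x) = x" if "x \<in> S" for x
      unfolding c_def using cc_s[OF that] R(1)
      by (simp add: coord_def euclidean_representation)
    show "0 \<le> s x" "s x \<le> 1" for x
      unfolding s_def using cantor_series[OF digit] by auto
  qed
qed

text \<open>
  The measures are lifted to \<open>[0, 1]\<close> by the right inverse of the curve, where Helly's theorem
  yields a weak limit, and this limit is pushed forward by the curve. The curve has bounded range, so
  a continuous function composed with it is bounded and may be used as a test function. That the limit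
  lives on \<open>S\<close> is seen by testing against the distance to \<open>S\<close>.
\<close>
lemma weak_compactness:
  fixes M :: "nat \<Rightarrow> 'a::euclidean_space measure"
  assumes prob: "\<And>k. prob_space (M k)" and sets: "\<And>k. sets (M k) = sets borel"
    and "compact S" and S: "\<And>k. AE x in M k. x \<in> S"
  obtains r \<mu> where "strict_mono (r :: nat \<Rightarrow> nat)" "prob_space \<mu>" "sets \<mu> = sets borel"
    "AE x in \<mu>. x \<in> S"
    "\<And>g :: 'a \<Rightarrow> real. continuous_on UNIV g \<Longrightarrow>
        (\<lambda>k. integral\<^sup>L (M (r k)) g) \<longlonglongrightarrow> integral\<^sup>L \<mu> g"
proof -
  obtain c :: "real \<Rightarrow> 'a" and s :: "'a \<Rightarrow> real"
    where c: "continuous_on UNIV c" "bounded (range c)" and s[measurable]: "s \<in> borel_measurable borel"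
    and cs: "\<And>x. x \<in> S \<Longrightarrow> c (s x) = x" and s01: "\<And>x. 0 \<le> s x" "\<And>x. s x \<le> 1"
    using space_filling_curve[OF compact_imp_bounded[OF \<open>compact S\<close>]] by metis
  have [measurable]: "c \<in> borel_measurable borel"
    using c(1) by (rule borel_measurable_continuous_onI)
  note sets[measurable_cong]
  define N where "N k = distr (M k) borel s" for k
  have N: "real_distribution (N k)" for k
    unfolding real_distribution_def real_distribution_axioms_def N_def
    by (auto intro!: prob_space.prob_space_distr[OF prob])
  have "tight N"
    unfolding tight_def
  proof (intro conjI allI impI N)
    fix \<epsilon> :: real assume "0 < \<epsilon>"
    have "measure (N k) {-1<..2} = 1" for k
    proof -
      interpret real_distribution "N k" by (rule N)
      have "AE x in M k. s x \<in> {-1<..2}"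
      proof (rule AE_I2)
        show "s x \<in> {-1<..2}" for x using s01[of x] by simp
      qed
      then have "AE x in N k. x \<in> {-1<..2}"
        unfolding N_def by (subst AE_distr_iff) auto
      then show ?thesis by (subst prob_eq_1) auto
    qed
    then show "\<exists>a b. a < b \<and> (\<forall>n. 1 - \<epsilon> < measure (N n) {a<..b})"
      using \<open>0 < \<epsilon>\<close> by (intro exI[of _ "-1"] exI[of _ 2]) auto
  qed
  from tight_imp_convergent_subsubsequence[OF this strict_mono_id]
  obtain r \<nu> where r: "strict_mono r" and \<nu>: "real_distribution \<nu>" and w: "weak_conv_m (N \<circ> id \<circ> r) \<nu>"
    by auto
  interpret \<nu>: real_distribution \<nu> by (rule \<nu>)
  define \<mu> where "\<mu> = distr \<nu> borel c"
  have conv: "(\<lambda>k. integral\<^sup>L (M (r k)) g) \<longlonglongrightarrow> integral\<^sup>L \<mu> g"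
    if g: "continuous_on UNIV g" for g :: "'a \<Rightarrow> real"
  proof -
    have [measurable]: "g \<in> borel_measurable borel"
      using g by (rule borel_measurable_continuous_onI)
    have gc: "continuous_on UNIV (\<lambda>t. g (c t))"
      using continuous_on_compose2[OF g c(1)] by auto
    have "bounded (g ` closure (range c))"
      using c(2) g by (intro compact_imp_bounded compact_continuous_image)
        (auto intro: continuous_on_subset simp: compact_closure)
    then obtain B where B: "\<And>x. x \<in> range c \<Longrightarrow> norm (g x) \<le> B"
      using closure_subset[of "range c"] unfolding bounded_iff by blast
    have "(\<lambda>k. integral\<^sup>L ((N \<circ> id \<circ> r) k) (\<lambda>t. g (c t))) \<longlonglongrightarrow> integral\<^sup>L \<nu> (\<lambda>t. g (c t))"
      by (rule weak_conv_imp_integral_bdd_continuous_conv[OF _ \<nu> w, of _ B])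
         (use N gc B in \<open>auto simp: continuous_on_eq_continuous_at\<close>)
    moreover have "integral\<^sup>L (N k) (\<lambda>t. g (c t)) = integral\<^sup>L (M k) g" for k
      unfolding N_def
      by (subst integral_distr) (auto intro!: integral_cong_AE intro: AE_mp[OF S] simp: cs)
    moreover have "integral\<^sup>L \<nu> (\<lambda>t. g (c t)) = integral\<^sup>L \<mu> g"
      unfolding \<mu>_def by (subst integral_distr) auto
    ultimately show ?thesis by simp
  qed
  have "prob_space \<mu>" unfolding \<mu>_def by (rule \<nu>.prob_space_distr) simp
  moreover have "AE x in \<mu>. x \<in> S"
  proof -
    have "S \<noteq> {}"
    proof
      assume "S = {}"
      then have "AE x in M 0. False" using S[of 0] by simp
      then show False using prob_space.AE_False[OF prob] by simp
    qed
    have "(\<lambda>k. integral\<^sup>L (M (r k)) (\<lambda>x. infdist x S)) \<longlonglongrightarrow> integral\<^sup>L \<mu> (\<lambda>x. infdist x S)"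
      by (rule conv) (intro continuous_intros)
    moreover have "integral\<^sup>L (M k) (\<lambda>x. infdist x S) = 0" for k
      by (rule integral_eq_zero_AE) (use S[of k] in auto)
    ultimately have z: "integral\<^sup>L \<mu> (\<lambda>x. infdist x S) = 0"
      by (simp add: LIMSEQ_const_iff)
    have [measurable]: "(\<lambda>x. infdist x S) \<in> borel_measurable borel"
      by (intro borel_measurable_continuous_onI continuous_intros)
    have "compact (closure (range c))" using c(2) by (simp add: compact_closure)
    then have "bounded ((\<lambda>x. infdist x S) ` closure (range c))"
      by (intro compact_imp_bounded compact_continuous_image continuous_intros)
    then obtain B where B: "\<And>t. norm (infdist (c t) S) \<le> B"
      using closure_subset[of "range c"] unfolding bounded_iff by blast
    have "integrable \<nu> (\<lambda>t. infdist (c t) S)"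
      by (rule \<nu>.integrable_const_bound[of _ B]) (use B in auto)
    then have "integrable \<mu> (\<lambda>x. infdist x S)"
      unfolding \<mu>_def by (subst integrable_distr_eq) auto
    then have "AE x in \<mu>. infdist x S = 0"
      using z by (subst (asm) integral_nonneg_eq_0_iff_AE) (auto simp: infdist_nonneg)
    then show ?thesis
      by (simp add: in_closed_iff_infdist_zero[OF compact_imp_closed[OF \<open>compact S\<close>] \<open>S \<noteq> {}\<close>])
  qed
  ultimately show ?thesis
    using that[of r \<mu>] r conv by (simp add: \<mu>_def)
qed

section \<open>Gaussian integrals and integrability\<close>
abbreviation std_gauss :: "'a::real_normed_vector \<Rightarrow> real" where
  "std_gauss z \<equiv> exp (- (norm z)\<^sup>2 / 2)"

abbreviation gauss :: "real \<Rightarrow> 'a::real_normed_vector \<Rightarrow> real" where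
  "gauss t z \<equiv> exp (- t * (norm z)\<^sup>2 / 2)"

abbreviation heat :: "real \<Rightarrow> 'a::real_normed_vector \<Rightarrow> 'a \<Rightarrow> real" where
  "heat t x w \<equiv> exp (- (norm (w - x))\<^sup>2 / (2 * t))"

lemma integrable_lborel_prod:
  fixes f :: "'a::euclidean_space \<Rightarrow> real \<Rightarrow> 'b::{real_normed_field,banach,second_countable_topology}"
  assumes f: "\<And>b. b \<in> Basis \<Longrightarrow> integrable lborel (f b)"
  shows "integrable lborel (\<lambda>x. \<Prod>b\<in>Basis. f b (x \<bullet> b))"
    and "(LBINT x. (\<Prod>b\<in>Basis. f b (x \<bullet> b))) = (\<Prod>b\<in>Basis. integral\<^sup>L lborel (f b))"
proof -
  interpret product_sigma_finite "\<lambda>_::'a. lborel :: real measure"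
    by standard
  have [measurable]: "\<And>b. b \<in> Basis \<Longrightarrow> f b \<in> borel_measurable borel"
    using f by (metis borel_measurable_integrable measurable_lborel2)
  have comp: "(\<Prod>b\<in>Basis. f b ((\<Sum>c\<in>Basis. x c *\<^sub>R c) \<bullet> b)) = (\<Prod>b\<in>Basis. f b (x b))" for x :: "'a \<Rightarrow> real"
    by (rule prod.cong) auto
  have m: "(\<lambda>x. \<Prod>b\<in>Basis. f b (x \<bullet> b)) \<in> borel_measurable borel"
    by (rule borel_measurable_prod) measurable
  have m2: "(\<lambda>x::'a \<Rightarrow> real. \<Sum>b\<in>Basis. x b *\<^sub>R b) \<in> measurable (Pi\<^sub>M Basis (\<lambda>_. lborel)) borel"
    by measurable
  show "integrable lborel (\<lambda>x. \<Prod>b\<in>Basis. f b (x \<bullet> b))"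
    unfolding lborel_eq[where 'a='a]
    by (subst integrable_distr_eq[OF m2 m]) (simp add: product_integrable_prod f)
  show "(LBINT x. (\<Prod>b\<in>Basis. f b (x \<bullet> b))) = (\<Prod>b\<in>Basis. integral\<^sup>L lborel (f b))"
    unfolding lborel_eq[where 'a='a]
    by (subst integral_distr[OF m2 m]) (simp add: product_integral_prod f)
qed

lemma lborel_integral_affine:
  fixes f :: "'a::euclidean_space \<Rightarrow> 'b::{banach, second_countable_topology}"
  assumes c: "c \<noteq> 0" and [measurable]: "f \<in> borel_measurable borel"
  shows "integrable lborel f \<longleftrightarrow> integrable lborel (\<lambda>x. f (t + c *\<^sub>R x))"
    and "integral\<^sup>L lborel f = \<bar>c\<bar> ^ DIM('a) *\<^sub>R (LBINT x. f (t + c *\<^sub>R x))"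
proof -
  have scale: "integrable lborel (\<lambda>x. k *\<^sub>R g x) \<longleftrightarrow> integrable lborel g" if "k \<noteq> 0" for k and g :: "'a \<Rightarrow> 'b"
    using integrable_scaleR_right[of "inverse k" lborel "\<lambda>x. k *\<^sub>R g x"] that by auto
  show "integrable lborel f \<longleftrightarrow> integrable lborel (\<lambda>x. f (t + c *\<^sub>R x))"
    by (subst lborel_affine[OF c, of t])
       (use c in \<open>simp add: ennreal_power integrable_density integrable_distr_eq scale\<close>)
  show "integral\<^sup>L lborel f = \<bar>c\<bar> ^ DIM('a) *\<^sub>R (LBINT x. f (t + c *\<^sub>R x))"
    by (subst lborel_affine[OF c, of t])
       (use c in \<open>auto simp: integral_density integral_distr ennreal_power\<close>)
qed

lemma integrable_inverse_square: "integrable lborel (\<lambda>x::real. 1 / (1 + x\<^sup>2))"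
  using integrable_inverse_1_plus_square unfolding set_integrable_def
  by (simp add: inverse_eq_divide)

text \<open>
  The product of \<open>1 + (x \<bullet> b)\<^sup>2\<close> over the coordinates is at most \<open>(1 + norm x) ^ (2 * DIM('a))\<close>, so
  the one-dimensional integral of \<open>1 / (1 + u\<^sup>2)\<close> suffices.
\<close>
lemma integrable_decay:
  fixes g :: "'a::euclidean_space \<Rightarrow> 'b::{banach, second_countable_topology}"
  assumes [measurable]: "g \<in> borel_measurable borel"
    and g: "\<And>x. norm (g x) \<le> C / (1 + norm x) ^ (2 * DIM('a))"
  shows "integrable lborel g"
proof (rule Bochner_Integration.integrable_bound)
  show "integrable lborel (\<lambda>x::'a. \<bar>C\<bar> * (\<Prod>b\<in>Basis. 1 / (1 + (x \<bullet> b)\<^sup>2)))"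
    by (intro integrable_mult_right integrable_lborel_prod(1) integrable_inverse_square)
  show "AE x in lborel. norm (g x) \<le> norm (\<bar>C\<bar> * (\<Prod>b\<in>Basis. 1 / (1 + (x \<bullet> b)\<^sup>2)))"
  proof (rule AE_I2)
    fix x :: 'a
    have "(\<Prod>b\<in>(Basis::'a set). 1 + (x \<bullet> b)\<^sup>2) \<le> (\<Prod>b\<in>(Basis::'a set). (1 + norm x)\<^sup>2)"
    proof (rule prod_mono)
      fix b :: 'a assume b: "b \<in> Basis"
      have "(x \<bullet> b)\<^sup>2 \<le> (norm x)\<^sup>2"
        using Basis_le_norm[OF b, of x] by (simp add: abs_le_square_iff[symmetric])
      then show "0 \<le> 1 + (x \<bullet> b)\<^sup>2 \<and> 1 + (x \<bullet> b)\<^sup>2 \<le> (1 + norm x)\<^sup>2"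
        by (simp add: power2_sum add_increasing2)
    qed
    then have le: "(\<Prod>b\<in>(Basis::'a set). 1 + (x \<bullet> b)\<^sup>2) \<le> (1 + norm x) ^ (2 * DIM('a))"
      by (simp add: power_mult)
    have pos: "0 < (\<Prod>b\<in>(Basis::'a set). 1 + (x \<bullet> b)\<^sup>2)"
      by (intro prod_pos) (simp add: add_pos_nonneg)
    have "norm (g x) \<le> \<bar>C\<bar> / (1 + norm x) ^ (2 * DIM('a))"
      by (rule order_trans[OF g]) (simp add: divide_right_mono)
    also have "\<dots> \<le> \<bar>C\<bar> / (\<Prod>b\<in>(Basis::'a set). 1 + (x \<bullet> b)\<^sup>2)"
      using le pos by (intro divide_left_mono mult_pos_pos) auto
    finally show "norm (g x) \<le> norm (\<bar>C\<bar> * (\<Prod>b\<in>Basis. 1 / (1 + (x \<bullet> b)\<^sup>2)))"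
      using pos by (simp add: prod_dividef abs_mult)
  qed
qed simp

text \<open>
  Layer cake: \<open>- ln (norm x)\<close> is at most the number of balls of radius \<open>exp (- k)\<close> that contain \<open>x\<close>, and
  the volumes of these balls decrease geometrically.
\<close>
lemma integrable_ln_norm_ball:
  "integrable lborel (\<lambda>x::'a::euclidean_space. indicator (ball 0 1) x * - ln (norm x))"
proof (rule integrableI_nonneg)
  show "AE x in lborel. 0 \<le> indicator (ball 0 1) x * - ln (norm (x::'a))"
    using AE_lborel_singleton[of 0]
    by eventually_elim (auto simp: indicator_def ln_le_zero_iff)
  have ptw: "ennreal (indicator (ball 0 1) x * - ln (norm x))
      \<le> (\<Sum>k. indicator (ball 0 (exp (- real k))) x)" if "x \<noteq> 0" for x :: 'a
  proof (cases "norm x < 1")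
    case True
    define m where "m = nat \<lceil>- ln (norm x)\<rceil>"
    have lt: "norm x < exp (- real k)" if "k < m" for k
    proof -
      have "real k < - ln (norm x)" using that unfolding m_def by linarith
      then have "exp (ln (norm x)) < exp (- real k)" by simp
      then show ?thesis using \<open>x \<noteq> 0\<close> by simp
    qed
    have "- ln (norm x) \<le> real m" unfolding m_def by linarith
    then have "ennreal (indicator (ball 0 1) x * - ln (norm x)) \<le> ennreal (real m)"
      using True by (intro ennreal_leI) (simp add: indicator_def)
    also have "\<dots> = (\<Sum>k<m. indicator (ball 0 (exp (- real k))) x)"
      using lt by (simp add: indicator_def ennreal_of_nat_eq_real_of_nat)
    also have "\<dots> \<le> (\<Sum>k. indicator (ball 0 (exp (- real k))) x)"
      by (rule sum_le_suminf) auto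
    finally show ?thesis .
  qed simp
  have "(\<integral>\<^sup>+ x. ennreal (indicator (ball 0 1) x * - ln (norm (x::'a))) \<partial>lborel)
      \<le> (\<integral>\<^sup>+ x. (\<Sum>k. indicator (ball 0 (exp (- real k))) (x::'a)) \<partial>lborel)"
    using AE_lborel_singleton[of 0] by (intro nn_integral_mono_AE) (erule eventually_mono, rule ptw)
  also have "\<dots> = (\<Sum>k. emeasure lborel (ball (0::'a) (exp (- real k))))"
    by (subst nn_integral_suminf) (auto intro!: borel_measurable_indicator)
  also have "\<dots> \<le> (\<Sum>k. ennreal (unit_ball_vol (DIM('a)) * exp (-1) ^ k))"
  proof (rule suminf_le)
    fix k
    have "exp (- real k) ^ DIM('a) \<le> exp (- real k) ^ 1"
      by (rule power_decreasing) (auto simp: Suc_leI)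
    then show "emeasure lborel (ball (0::'a) (exp (- real k))) \<le> ennreal (unit_ball_vol (DIM('a)) * exp (-1) ^ k)"
      by (subst emeasure_ball) (auto intro!: ennreal_leI mult_left_mono simp: exp_of_nat_mult[symmetric])
  qed auto
  also have "\<dots> < \<infinity>"
    by (subst suminf_ennreal2) (auto intro!: summable_mult summable_geometric)
  finally show "(\<integral>\<^sup>+ x. ennreal (indicator (ball 0 1) x * - ln (norm (x::'a))) \<partial>lborel) < \<infinity>" .
  have "(\<lambda>x::'a. - ln (norm x)) \<in> borel_measurable borel" by measurable
  then show "(\<lambda>x::'a. indicator (ball 0 1) x * - ln (norm x)) \<in> borel_measurable lborel"
    by (intro borel_measurable_times borel_measurable_indicator) auto
qed

text \<open>
  The one integrability criterion used for the logarithm: near \<open>0\<close> the singularity is integrable, and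
  far away \<open>ln (norm x)\<close> costs one power of the decay of \<open>g\<close>.
\<close>
lemma integrable_log_decay:
  fixes g :: "'a::euclidean_space \<Rightarrow> 'b::{banach, second_countable_topology}"
  assumes [measurable]: "f \<in> borel_measurable borel" "g \<in> borel_measurable borel"
    and f: "\<And>x. x \<noteq> 0 \<Longrightarrow> \<bar>f x\<bar> \<le> \<bar>ln (norm x)\<bar> + B"
    and g: "\<And>x. norm (g x) \<le> C / (1 + norm x) ^ (2 * DIM('a) + 1)"
  shows "integrable lborel (\<lambda>x. f x *\<^sub>R g x)"
proof (rule Bochner_Integration.integrable_bound)
  let ?h = "\<lambda>x::'a. \<bar>C\<bar> * (indicator (ball 0 1) x * - ln (norm x)) + (1 + \<bar>B\<bar>) * \<bar>C\<bar> * (1 / (1 + norm x) ^ (2 * DIM('a)))"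
  have "integrable lborel (\<lambda>x::'a. 1 / (1 + norm x) ^ (2 * DIM('a)))"
    by (rule integrable_decay[of _ 1]) auto
  then show "integrable lborel ?h"
    by (intro Bochner_Integration.integrable_add integrable_mult_right integrable_ln_norm_ball)
  show "AE x in lborel. norm (f x *\<^sub>R g x) \<le> norm (?h x)"
    using AE_lborel_singleton[of 0]
  proof eventually_elim
    fix x :: 'a assume x: "x \<noteq> 0"
    let ?w = "1 / (1 + norm x) ^ (2 * DIM('a) + 1)" and ?w' = "1 / (1 + norm x) ^ (2 * DIM('a))"
    have w: "?w * (1 + norm x) = ?w'" by (simp add: field_simps add_nonneg_eq_0_iff)
    have w1: "0 \<le> ?w" "?w \<le> 1"
      using one_le_power[of "1 + norm x" "2 * DIM('a) + 1"] by (auto simp: divide_le_eq_1)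
    have gw: "norm (g x) \<le> \<bar>C\<bar> * ?w"
      by (rule order_trans[OF g]) (simp add: divide_right_mono)
    have ln1: "\<bar>ln (norm x)\<bar> + B \<le> indicator (ball 0 1) x * - ln (norm x) + (1 + \<bar>B\<bar>) * (1 + norm x)"
    proof -
      have "\<bar>ln (norm x)\<bar> \<le> indicator (ball 0 1) x * - ln (norm x) + norm x"
        using x ln_bound[of "norm x"] by (cases "norm x < 1") (auto simp: indicator_def ln_le_zero_iff not_less)
      moreover have "B \<le> \<bar>B\<bar> * (1 + norm x)"
        using mult_left_mono[of 1 "1 + norm x" "\<bar>B\<bar>"] by simp
      ultimately show ?thesis by (simp add: algebra_simps)
    qed
    have L: "0 \<le> indicator (ball 0 1) x * - ln (norm x)"
      using x by (auto simp: indicator_def ln_le_zero_iff)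
    have "norm (f x *\<^sub>R g x) \<le> (indicator (ball 0 1) x * - ln (norm x) + (1 + \<bar>B\<bar>) * (1 + norm x)) * (\<bar>C\<bar> * ?w)"
      unfolding norm_scaleR using order_trans[OF f[OF x] ln1] gw L
      by (intro mult_mono) auto
    also have "\<dots> = \<bar>C\<bar> * (indicator (ball 0 1) x * - ln (norm x)) * ?w + (1 + \<bar>B\<bar>) * \<bar>C\<bar> * (?w * (1 + norm x))"
      by (simp only: algebra_simps)
    also have "\<dots> \<le> \<bar>C\<bar> * (indicator (ball 0 1) x * - ln (norm x)) * 1 + (1 + \<bar>B\<bar>) * \<bar>C\<bar> * (?w * (1 + norm x))"
      using w1 mult_nonneg_nonneg[OF abs_ge_zero L, of C] by (intro add_right_mono mult_left_mono)
    finally show "norm (f x *\<^sub>R g x) \<le> norm (?h x)"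
      unfolding w by simp
  qed
qed simp

lemma power_le_fact_exp: "0 \<le> (y::real) \<Longrightarrow> y ^ p \<le> fact p * exp y"
proof -
  assume y: "0 \<le> y"
  have "(\<Sum>n\<in>{p}. inverse (fact n) * y ^ n) \<le> (\<Sum>n. inverse (fact n) * y ^ n)"
    using summable_exp[of y] y by (intro sum_le_suminf) auto
  then have "inverse (fact p) * y ^ p \<le> exp y" by (simp add: exp_def)
  then show ?thesis by (simp add: field_simps)
qed

lemma gaussian_decay:
  assumes t: "t > 0"
  obtains C where "C \<ge> 0" "\<And>x::'a::real_normed_vector. gauss t x \<le> C / (1 + norm x) ^ p"
proof
  let ?C = "fact p * exp (1 + 1 / (2 * t)) :: real"
  show "?C \<ge> 0" by simp
  fix x :: 'a
  have "0 \<le> (t * norm x - 1)\<^sup>2 / (2 * t)" using t by simp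
  then have "norm x - t * (norm x)\<^sup>2 / 2 \<le> 1 / (2 * t)"
    using t by (simp add: power2_diff field_simps power2_eq_square)
  then have "exp (1 + norm x) * gauss t x \<le> exp (1 + 1 / (2 * t))"
    by (simp flip: exp_add)
  then have "fact p * exp (1 + norm x) * gauss t x \<le> ?C"
    by (simp add: mult.assoc)
  moreover have "(1 + norm x) ^ p * gauss t x \<le> fact p * exp (1 + norm x) * gauss t x"
    by (intro mult_right_mono power_le_fact_exp) auto
  ultimately have "(1 + norm x) ^ p * gauss t x \<le> ?C" by (rule order_trans[rotated])
  then show "gauss t x \<le> ?C / (1 + norm x) ^ p"
    by (subst pos_le_divide_eq) (auto simp: mult.commute add_pos_nonneg)
qed

lemma integrable_gaussian:
  assumes t: "t > 0"
  shows "integrable lborel (\<lambda>x::'a::euclidean_space. gauss t x)"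
proof -
  obtain C where "\<And>x::'a. gauss t x \<le> C / (1 + norm x) ^ (2 * DIM('a))"
    using gaussian_decay[OF t, where 'a='a and p="2 * DIM('a)"] by metis
  then show ?thesis by (intro integrable_decay[of _ C]) auto
qed

text \<open>Rescaled, this is the characteristic function of the standard normal distribution.\<close>
lemma gaussian_fourier_real:
  assumes t: "t > 0"
  shows "integrable lborel (\<lambda>u::real. complex_of_real (exp (- t * u\<^sup>2 / 2)) * iexp (v * u))"
    and "(LBINT u. complex_of_real (exp (- t * u\<^sup>2 / 2)) * iexp (v * u))
      = complex_of_real (sqrt (2 * pi / t) * exp (- v\<^sup>2 / (2 * t)))"
proof -
  have "integrable lborel (\<lambda>u::real. exp (- t * u\<^sup>2 / 2))"
    using integrable_gaussian[OF t, where 'a=real] by simp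
  then show "integrable lborel (\<lambda>u::real. complex_of_real (exp (- t * u\<^sup>2 / 2)) * iexp (v * u))"
    by (rule Bochner_Integration.integrable_bound) (auto simp: norm_mult)
  let ?g = "\<lambda>u::real. std_normal_density u *\<^sub>R iexp ((v / sqrt t) * u)"
  have "complex_of_real (exp (- (v / sqrt t)\<^sup>2 / 2)) = integral\<^sup>L lborel ?g"
    using fun_cong[OF char_std_normal_distribution, of "v / sqrt t"]
    unfolding char_def by (subst (asm) integral_density) (auto simp: normal_density_nonneg)
  also have "\<dots> = sqrt t *\<^sub>R (LBINT u. ?g (0 + sqrt t * u))"
    using t by (subst lborel_integral_real_affine[where c="sqrt t" and t=0]) auto
  also have "(\<lambda>u. ?g (0 + sqrt t * u)) = (\<lambda>u. (1 / sqrt (2 * pi)) *\<^sub>R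
      (complex_of_real (exp (- t * u\<^sup>2 / 2)) * iexp (v * u)))"
    using t by (auto simp: std_normal_density_def power_mult_distrib scaleR_conv_of_real field_simps)
  finally have "complex_of_real (exp (- (v / sqrt t)\<^sup>2 / 2)) = sqrt t *\<^sub>R ((1 / sqrt (2 * pi)) *\<^sub>R
      (LBINT u. complex_of_real (exp (- t * u\<^sup>2 / 2)) * iexp (v * u)))"
    by simp
  then show "(LBINT u. complex_of_real (exp (- t * u\<^sup>2 / 2)) * iexp (v * u))
      = complex_of_real (sqrt (2 * pi / t) * exp (- v\<^sup>2 / (2 * t)))"
    using t by (simp add: scaleR_conv_of_real real_sqrt_divide power_divide field_simps)
qed

lemma gaussian_fourier:
  fixes v :: "'a::euclidean_space"
  assumes t: "t > 0"
  shows "(LBINT y. complex_of_real (gauss t y) * iexp (v \<bullet> y))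
      = complex_of_real (sqrt (2 * pi / t) ^ DIM('a) * exp (- (norm v)\<^sup>2 / (2 * t)))"
proof -
  let ?f = "\<lambda>(b::'a) u::real. complex_of_real (exp (- t * u\<^sup>2 / 2)) * iexp ((v \<bullet> b) * u)"
  have sq: "(norm y)\<^sup>2 = (\<Sum>b\<in>Basis. (y \<bullet> b)\<^sup>2)" for y :: 'a
    by (subst power2_norm_eq_inner, subst euclidean_inner) (simp add: power2_eq_square)
  have "complex_of_real (gauss t y) * iexp (v \<bullet> y) = (\<Prod>b\<in>Basis. ?f b (y \<bullet> b))" for y
    unfolding prod.distrib sq euclidean_inner[of v y]
    by (simp add: exp_sum[symmetric] sum_distrib_left sum_divide_distrib sum_negf of_real_prod[symmetric] del: of_real_prod)
  then have "(LBINT y. complex_of_real (gauss t y) * iexp (v \<bullet> y))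
      = (\<Prod>b\<in>Basis. integral\<^sup>L lborel (?f b))"
    by (simp only: integrable_lborel_prod(2)[OF gaussian_fourier_real(1)[OF t]])
  also have "\<dots> = (\<Prod>b\<in>(Basis::'a set). complex_of_real (sqrt (2 * pi / t) * exp (- (v \<bullet> b)\<^sup>2 / (2 * t))))"
    by (rule prod.cong[OF refl]) (rule gaussian_fourier_real(2)[OF t])
  also have "\<dots> = complex_of_real (sqrt (2 * pi / t) ^ DIM('a) * exp (- (norm v)\<^sup>2 / (2 * t)))"
    unfolding of_real_prod[symmetric] prod.distrib sq
    by (simp add: exp_sum[symmetric] sum_divide_distrib sum_negf)
  finally show ?thesis .
qed

section \<open>Fourier transforms of Schwartz functions\<close>
lemma schwartz_iter_deriv:
  assumes "schwartz \<phi>" "bs \<in> lists Basis"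
  shows "schwartz (iter_deriv bs \<phi>)"
proof -
  have app: "iter_deriv cs (iter_deriv bs \<phi>) = iter_deriv (cs @ bs) \<phi>" for cs
    by (induction cs) auto
  show ?thesis
    using assms unfolding schwartz_def app by auto
qed

lemma schwartz_differentiable: "schwartz \<phi> \<Longrightarrow> \<phi> differentiable (at x)"
  unfolding schwartz_def by (metis iter_deriv.simps(1) lists.Nil)

lemma schwartz_continuous_on: "schwartz \<phi> \<Longrightarrow> continuous_on A \<phi>"
  by (meson continuous_at_imp_continuous_on differentiable_imp_continuous_within schwartz_differentiable)

lemma schwartz_borel_measurable: "schwartz \<phi> \<Longrightarrow> \<phi> \<in> borel_measurable borel"
  by (rule borel_measurable_continuous_onI) (rule schwartz_continuous_on)

lemma decay_of_moments:
  fixes g :: "'a::real_normed_vector \<Rightarrow> 'b::real_normed_vector"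
  assumes "\<And>x. norm (g x) \<le> C0" "\<And>x. norm x ^ p * norm (g x) \<le> C1"
  shows "norm (g x) \<le> 2 ^ p * (C0 + C1) / (1 + norm x) ^ p"
proof -
  have "(1 + norm x) ^ p \<le> 2 ^ p * (1 + norm x ^ p)"
  proof (cases "norm x \<le> 1")
    case True
    have "(1 + norm x) ^ p \<le> 2 ^ p" using True by (intro power_mono) auto
    also have "\<dots> \<le> 2 ^ p * (1 + norm x ^ p)" by simp
    finally show ?thesis .
  next
    case False
    have "(1 + norm x) ^ p \<le> (2 * norm x) ^ p" using False by (intro power_mono) auto
    also have "\<dots> \<le> 2 ^ p * (1 + norm x ^ p)" by (simp add: power_mult_distrib)
    finally show ?thesis .
  qed
  then have "(1 + norm x) ^ p * norm (g x) \<le> 2 ^ p * (1 + norm x ^ p) * norm (g x)"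
    by (rule mult_right_mono) simp
  also have "\<dots> = 2 ^ p * (norm (g x) + norm x ^ p * norm (g x))"
    by (simp add: algebra_simps)
  also have "\<dots> \<le> 2 ^ p * (C0 + C1)"
    using assms[of x] by (intro mult_left_mono add_mono) auto
  finally show ?thesis
    by (subst pos_le_divide_eq) (auto simp: mult.commute add_pos_nonneg)
qed

lemma schwartz_decay:
  fixes \<phi> :: "'a::euclidean_space \<Rightarrow> complex"
  assumes "schwartz \<phi>"
  obtains C where "C \<ge> 0" "\<And>x. norm (\<phi> x) \<le> C / (1 + norm x) ^ p"
proof -
  have "\<exists>C. \<forall>x. norm x ^ k * norm (\<phi> x) \<le> C" for k
  proof -
    have "bounded (range (\<lambda>x. norm x ^ k *\<^sub>R iter_deriv [] \<phi> x))"
      using assms unfolding schwartz_def by blast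
    then show ?thesis by (auto simp: bounded_iff)
  qed
  from this[of 0] this[of p] obtain C0 C1
    where C: "\<And>x. norm (\<phi> x) \<le> C0" "\<And>x. norm x ^ p * norm (\<phi> x) \<le> C1" by auto
  show ?thesis
  proof
    show "norm (\<phi> x) \<le> (2 ^ p * (C0 + C1)) / (1 + norm x) ^ p" for x
      using decay_of_moments[where g=\<phi>, OF C] by simp
    have "0 \<le> C0" using order_trans[OF norm_ge_zero C(1)] by simp
    moreover have "0 \<le> C1" using order_trans[OF mult_nonneg_nonneg C(2)[of 0]] by simp
    ultimately show "0 \<le> 2 ^ p * (C0 + C1)" by simp
  qed
qed

lemma schwartz_integrable:
  fixes \<phi> :: "'a::euclidean_space \<Rightarrow> complex"
  assumes "schwartz \<phi>"
  shows "integrable lborel \<phi>"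
proof -
  obtain C where "\<And>x. norm (\<phi> x) \<le> C / (1 + norm x) ^ (2 * DIM('a))"
    using schwartz_decay[OF assms] by metis
  then show ?thesis by (intro integrable_decay schwartz_borel_measurable assms)
qed

lemma integrable_mult_bounded:
  fixes u k :: "'a \<Rightarrow> complex"
  assumes "integrable M u" "k \<in> borel_measurable M" "\<And>x. norm (k x) \<le> B"
  shows "integrable M (\<lambda>x. u x * k x)"
proof (rule Bochner_Integration.integrable_bound[of _ "\<lambda>x. B * norm (u x)"])
  show "integrable M (\<lambda>x. B * norm (u x))" using assms by auto
  show "(\<lambda>x. u x * k x) \<in> borel_measurable M" using assms by measurable
  have "0 \<le> B" using order_trans[OF norm_ge_zero assms(3)] .
  then show "AE x in M. norm (u x * k x) \<le> norm (B * norm (u x))"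
    using mult_left_mono[OF assms(3) norm_ge_zero, of "u _"] by (auto simp: norm_mult mult.commute)
qed

lemma fourier_measurable:
  assumes [measurable]: "\<phi> \<in> borel_measurable borel"
  shows "fourier \<phi> \<in> borel_measurable borel"
  unfolding fourier_def[abs_def] by measurable

lemma vector_derivative_quotient:
  fixes f :: "real \<Rightarrow> 'b::real_normed_vector"
  assumes "(f has_vector_derivative D) (at 0)"
  shows "((\<lambda>s. (f s - f 0) /\<^sub>R s) \<longlongrightarrow> D) (at 0)"
proof -
  have "((\<lambda>s. (f s - f 0 - s *\<^sub>R D) /\<^sub>R norm s) \<longlongrightarrow> 0) (at 0)"
    using assms unfolding has_vector_derivative_def has_derivative_at_within by simp
  then have "((\<lambda>s. norm ((f s - f 0 - s *\<^sub>R D) /\<^sub>R norm s)) \<longlongrightarrow> 0) (at 0)"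
    by (rule tendsto_norm_zero)
  also have "?this \<longleftrightarrow> ((\<lambda>s. norm ((f s - f 0) /\<^sub>R s - D)) \<longlongrightarrow> 0) (at 0)"
  proof (rule filterlim_cong[OF refl refl])
    have "norm ((f s - f 0 - s *\<^sub>R D) /\<^sub>R norm s) = norm ((f s - f 0) /\<^sub>R s - D)" if "s \<noteq> 0" for s
    proof -
      have "(f s - f 0) /\<^sub>R s - D = (f s - f 0 - s *\<^sub>R D) /\<^sub>R s"
        using that by (simp add: scaleR_diff_right)
      then show ?thesis by simp
    qed
    then show "\<forall>\<^sub>F s in at 0. norm ((f s - f 0 - s *\<^sub>R D) /\<^sub>R norm s) = norm ((f s - f 0) /\<^sub>R s - D)"
      by (auto simp: eventually_at_filter)
  qed
  finally show ?thesis
    by (metis LIM_zero_cancel tendsto_norm_zero_cancel)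
qed

lemma fourier_bound: "norm (fourier \<phi> \<xi>) \<le> (LBINT x. norm (\<phi> x))"
  unfolding fourier_def
  by (rule order_trans[OF integral_norm_bound]) (simp add: norm_mult)

text \<open>
  Instead of integrating by parts, translate: the transform of the difference quotient of \<open>\<phi>\<close> in direction
  \<open>b\<close> is an explicit multiple of the transform of \<open>\<phi>\<close>, and the step size tends to \<open>0\<close> under the integral. The
  mean value theorem and the decay of the derivative provide a dominating function.
\<close>
lemma fourier_partial_deriv:
  fixes \<phi> :: "'a::euclidean_space \<Rightarrow> complex"
  assumes \<phi>: "schwartz \<phi>" and b: "b \<in> Basis"
  shows "fourier (iter_deriv [b] \<phi>) \<xi> = \<i> * complex_of_real (\<xi> \<bullet> b) * fourier \<phi> \<xi>"
proof -
  let ?D = "iter_deriv [b] \<phi>"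
  have D: "schwartz ?D" using schwartz_iter_deriv[OF \<phi>, of "[b]"] b by simp
  let ?e = "\<lambda>x. exp (- \<i> * complex_of_real (x \<bullet> \<xi>))"
  define h where "h n = inverse (real (Suc n))" for n
  have h: "h n > 0" "h n \<le> 1" "h n \<noteq> 0" for n by (auto simp: h_def divide_simps)
  have h0: "h \<longlonglongrightarrow> 0" unfolding h_def by (rule LIMSEQ_inverse_real_of_nat)
  have ha: "filterlim h (at 0) sequentially"
    using h0 h by (auto simp: filterlim_at intro!: always_eventually)
  let ?q = "\<lambda>n x. (\<phi> (x + h n *\<^sub>R b) - \<phi> x) /\<^sub>R h n"
  have vd: "((\<lambda>s. \<phi> (x + s *\<^sub>R b)) has_vector_derivative ?D (x + s *\<^sub>R b)) (at s within A)" for x s A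
  proof -
    have "(\<phi> has_derivative frechet_derivative \<phi> (at (x + s *\<^sub>R b))) (at (x + s *\<^sub>R b))"
      using schwartz_differentiable[OF \<phi>] by (simp add: frechet_derivative_works)
    then have "((\<lambda>s. \<phi> (x + s *\<^sub>R b)) has_derivative (\<lambda>r. frechet_derivative \<phi> (at (x + s *\<^sub>R b)) (r *\<^sub>R b))) (at s within A)"
      by (rule has_derivative_compose[rotated]) (auto intro!: derivative_eq_intros)
    moreover have "frechet_derivative \<phi> (at y) (r *\<^sub>R b) = r *\<^sub>R frechet_derivative \<phi> (at y) b" for y r
      using linear_frechet_derivative[OF schwartz_differentiable[OF \<phi>]] by (rule linear_cmul)
    ultimately show ?thesis by (simp add: has_vector_derivative_def)
  qed
  have lim: "(\<lambda>n. ?q n x) \<longlonglongrightarrow> ?D x" for x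
  proof -
    have "((\<lambda>s. (\<phi> (x + s *\<^sub>R b) - \<phi> x) /\<^sub>R s) \<longlongrightarrow> ?D x) (at 0)"
      using vector_derivative_quotient[of "\<lambda>s. \<phi> (x + s *\<^sub>R b)"] vd[of x 0 UNIV] by simp
    then show ?thesis by (rule filterlim_compose[OF _ ha])
  qed
  obtain C where C: "C \<ge> 0" "\<And>x. norm (?D x) \<le> C / (1 + norm x) ^ (2 * DIM('a))"
    using schwartz_decay[OF D] by metis
  have bound: "norm (?q n x) \<le> 2 ^ (2 * DIM('a)) * C / (1 + norm x) ^ (2 * DIM('a))" for n x
  proof -
    let ?K = "2 ^ (2 * DIM('a)) * C / (1 + norm x) ^ (2 * DIM('a))"
    have "norm (\<phi> (x + h n *\<^sub>R b) - \<phi> (x + 0 *\<^sub>R b)) \<le> ?K * norm (h n - 0)"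
    proof (rule differentiable_bound[where S="{0..h n}"])
      fix s assume s: "s \<in> {0..h n}"
      show "((\<lambda>s. \<phi> (x + s *\<^sub>R b)) has_derivative (\<lambda>r. r *\<^sub>R ?D (x + s *\<^sub>R b))) (at s within {0..h n})"
        using vd unfolding has_vector_derivative_def .
      have "norm x \<le> norm (x + s *\<^sub>R b) + norm (s *\<^sub>R b)"
        by (metis add_diff_cancel_right' norm_triangle_ineq4)
      moreover have "norm (s *\<^sub>R b) \<le> 1" using s h[of n] b by simp
      ultimately have "1 + norm x \<le> 2 * (1 + norm (x + s *\<^sub>R b))"
        using norm_ge_zero[of "x + s *\<^sub>R b"] by argo
      then have "(1 + norm x) ^ (2 * DIM('a)) \<le> 2 ^ (2 * DIM('a)) * (1 + norm (x + s *\<^sub>R b)) ^ (2 * DIM('a))"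
        by (metis power_mono power_mult_distrib add_nonneg_nonneg zero_le_one norm_ge_zero)
      then have "C / (1 + norm (x + s *\<^sub>R b)) ^ (2 * DIM('a)) \<le> ?K"
        using C(1) by (simp add: divide_simps add_nonneg_eq_0_iff add_pos_nonneg mult_left_mono mult.assoc mult.left_commute)
      then have "norm (?D (x + s *\<^sub>R b)) \<le> ?K"
        using C(2) order_trans by blast
      then have "norm (r *\<^sub>R ?D (x + s *\<^sub>R b)) \<le> ?K * norm r" for r
        unfolding norm_scaleR mult.commute[of "\<bar>r\<bar>"] real_norm_def by (intro mult_right_mono abs_ge_zero)
      then show "onorm (\<lambda>r. r *\<^sub>R ?D (x + s *\<^sub>R b)) \<le> ?K"
        by (rule onorm_le)
    qed (use h[of n] in auto)
    then have "norm (\<phi> (x + h n *\<^sub>R b) - \<phi> x) \<le> ?K * h n"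
      using h[of n] by simp
    then have "norm (\<phi> (x + h n *\<^sub>R b) - \<phi> x) / h n \<le> ?K"
      by (simp only: pos_divide_le_eq[OF h(1)])
    moreover have "norm (?q n x) = norm (\<phi> (x + h n *\<^sub>R b) - \<phi> x) / h n"
      using h[of n] by (simp add: divide_inverse mult.commute)
    ultimately show ?thesis by simp
  qed
  have int: "integrable lborel \<phi>" by (rule schwartz_integrable[OF \<phi>])
  have [measurable]: "\<phi> \<in> borel_measurable borel" "?D \<in> borel_measurable borel"
    using \<phi> D by (auto intro: schwartz_borel_measurable)
  have L1: "(\<lambda>n. LINT x|lborel. ?q n x * ?e x) \<longlonglongrightarrow> (LBINT x. ?D x * ?e x)"
  proof (rule integral_dominated_convergence[where w="\<lambda>x. 2 ^ (2 * DIM('a)) * C / (1 + norm x) ^ (2 * DIM('a))"])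
    show "integrable lborel (\<lambda>x::'a. 2 ^ (2 * DIM('a)) * C / (1 + norm x) ^ (2 * DIM('a)))"
      using C(1) by (intro integrable_decay[of _ "2 ^ (2 * DIM('a)) * C"]) auto
    show "AE x in lborel. (\<lambda>n. ?q n x * ?e x) \<longlonglongrightarrow> ?D x * ?e x"
      by (intro AE_I2 tendsto_intros lim)
    show "AE x in lborel. norm (?q n x * ?e x) \<le> 2 ^ (2 * DIM('a)) * C / (1 + norm x) ^ (2 * DIM('a))" for n
      using bound by (simp add: norm_mult)
  qed (auto simp del: iter_deriv.simps)
  have E: "(LBINT x. ?q n x * ?e x) = ((iexp (h n * (b \<bullet> \<xi>)) - 1) /\<^sub>R h n) * fourier \<phi> \<xi>" for n
  proof -
    let ?c = "iexp (h n * (b \<bullet> \<xi>))"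
    have i1: "integrable lborel (\<lambda>x. \<phi> x * ?e x)"
      using int by (rule integrable_mult_bounded[where B=1]) auto
    have eq: "\<phi> (x + h n *\<^sub>R b) * ?e x = ?c * (\<phi> (h n *\<^sub>R b + 1 *\<^sub>R x) * ?e (h n *\<^sub>R b + 1 *\<^sub>R x))" for x
      by (simp add: inner_add_left exp_add[symmetric] algebra_simps)
    have i2: "integrable lborel (\<lambda>x. \<phi> (h n *\<^sub>R b + 1 *\<^sub>R x) * ?e (h n *\<^sub>R b + 1 *\<^sub>R x))"
      using i1 by (subst (asm) lborel_integral_affine(1)[where c=1 and t="h n *\<^sub>R b"]) auto
    have "(LBINT x. \<phi> (x + h n *\<^sub>R b) * ?e x) = ?c * (LBINT x. \<phi> x * ?e x)"
      unfolding eq by (subst lborel_integral_affine(2)[where c=1 and t="h n *\<^sub>R b"]) auto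
    moreover have "(LBINT x. ?q n x * ?e x) = ((LBINT x. \<phi> (x + h n *\<^sub>R b) * ?e x) - (LBINT x. \<phi> x * ?e x)) /\<^sub>R h n"
    proof -
      have "(\<lambda>x. ?q n x * ?e x) = (\<lambda>x. (\<phi> (x + h n *\<^sub>R b) * ?e x - \<phi> x * ?e x) /\<^sub>R h n)"
        by (auto simp: algebra_simps)
      moreover have "integrable lborel (\<lambda>x. \<phi> (x + h n *\<^sub>R b) * ?e x)"
        unfolding eq using i2 by simp
      ultimately show ?thesis using i1 by simp
    qed
    ultimately show ?thesis unfolding fourier_def by (simp add: algebra_simps)
  qed
  have L2: "(\<lambda>n. ((iexp (h n * (b \<bullet> \<xi>)) - 1) /\<^sub>R h n) * fourier \<phi> \<xi>) \<longlonglongrightarrow> \<i> * complex_of_real (\<xi> \<bullet> b) * fourier \<phi> \<xi>"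
  proof (intro tendsto_mult tendsto_const)
    have "((\<lambda>s. iexp (s * (b \<bullet> \<xi>))) has_vector_derivative \<i> * complex_of_real (b \<bullet> \<xi>)) (at 0)"
      by (auto intro!: derivative_eq_intros has_vector_derivative_real_field simp: o_def)
    then have "((\<lambda>s. (iexp (s * (b \<bullet> \<xi>)) - 1) /\<^sub>R s) \<longlongrightarrow> \<i> * complex_of_real (\<xi> \<bullet> b)) (at 0)"
      using vector_derivative_quotient[of "\<lambda>s. iexp (s * (b \<bullet> \<xi>))"]
      by (simp add: inner_commute)
    then show "(\<lambda>n. (iexp (h n * (b \<bullet> \<xi>)) - 1) /\<^sub>R h n) \<longlonglongrightarrow> \<i> * complex_of_real (\<xi> \<bullet> b)"
      by (rule filterlim_compose[OF _ ha])
  qed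
  show ?thesis
    unfolding fourier_def[of ?D] by (rule LIMSEQ_unique[OF L1[unfolded E] L2])
qed

lemma fourier_iter_deriv:
  fixes \<phi> :: "'a::euclidean_space \<Rightarrow> complex"
  assumes \<phi>: "schwartz \<phi>" and b: "b \<in> Basis"
  shows "fourier (iter_deriv (replicate k b) \<phi>) \<xi> = (\<i> * complex_of_real (\<xi> \<bullet> b)) ^ k * fourier \<phi> \<xi>"
proof (induction k)
  case (Suc k)
  have "schwartz (iter_deriv (replicate k b) \<phi>)"
    using b by (intro schwartz_iter_deriv[OF \<phi>]) (auto simp: in_lists_conv_set)
  from fourier_partial_deriv[OF this b, of \<xi>] show ?case
    by (simp add: Suc.IH)
qed simp

text \<open>
  Each \<open>\<bar>\<xi> \<bullet> b\<bar> ^ p\<close> times the transform is the transform of an integrable derivative, hence bounded; and the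
  largest coordinate controls the norm up to a factor \<open>DIM('a)\<close>.
\<close>
lemma fourier_decay:
  fixes \<phi> :: "'a::euclidean_space \<Rightarrow> complex"
  assumes \<phi>: "schwartz \<phi>"
  obtains C where "\<And>\<xi>. norm (fourier \<phi> \<xi>) \<le> C / (1 + norm \<xi>) ^ p"
proof -
  define A where "A b = (LBINT x. norm (iter_deriv (replicate p b) \<phi> x))" for b
  have A: "\<bar>\<xi> \<bullet> b\<bar> ^ p * norm (fourier \<phi> \<xi>) \<le> A b" if "b \<in> Basis" for b \<xi>
    using fourier_bound[of "iter_deriv (replicate p b) \<phi>" \<xi>]
    unfolding fourier_iter_deriv[OF \<phi> that] A_def by (simp add: norm_mult norm_power)
  have A0: "0 \<le> A b" for b unfolding A_def by (rule integral_nonneg_AE) simp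
  have "norm \<xi> ^ p * norm (fourier \<phi> \<xi>) \<le> real DIM('a) ^ p * (\<Sum>b\<in>Basis. A b)" for \<xi>
  proof -
    obtain b :: 'a where b: "b \<in> Basis" "norm \<xi> \<le> real DIM('a) * \<bar>\<xi> \<bullet> b\<bar>"
    proof -
      let ?S = "(\<lambda>b. \<bar>\<xi> \<bullet> b\<bar>) ` Basis"
      have "Max ?S \<in> ?S" by (rule Max_in) auto
      then obtain b :: 'a where b: "b \<in> Basis" "Max ?S = \<bar>\<xi> \<bullet> b\<bar>" by blast
      have "\<bar>\<xi> \<bullet> c\<bar> \<le> \<bar>\<xi> \<bullet> b\<bar>" if "c \<in> Basis" for c
        using Max_ge[of ?S "\<bar>\<xi> \<bullet> c\<bar>"] that b(2) by simp
      note b = b(1) this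
      have "norm \<xi> \<le> (\<Sum>c\<in>Basis. \<bar>\<xi> \<bullet> c\<bar>)" by (rule norm_le_l1)
      also have "\<dots> \<le> (\<Sum>c\<in>(Basis::'a set). \<bar>\<xi> \<bullet> b\<bar>)" by (rule sum_mono) (rule b)
      finally show ?thesis using that b(1) by simp
    qed
    have "norm \<xi> ^ p * norm (fourier \<phi> \<xi>) \<le> (real DIM('a) * \<bar>\<xi> \<bullet> b\<bar>) ^ p * norm (fourier \<phi> \<xi>)"
      using b by (intro mult_right_mono power_mono) auto
    also have "\<dots> = real DIM('a) ^ p * (\<bar>\<xi> \<bullet> b\<bar> ^ p * norm (fourier \<phi> \<xi>))"
      by (simp add: power_mult_distrib)
    also have "\<dots> \<le> real DIM('a) ^ p * (\<Sum>b\<in>Basis. A b)"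
      using order_trans[OF A[OF b(1)] member_le_sum[OF b(1), of A]] A0 by (intro mult_left_mono) auto
    finally show ?thesis .
  qed
  from decay_of_moments[where g="fourier \<phi>", OF fourier_bound this] that show ?thesis by blast
qed

lemma fourier_integrable:
  fixes \<phi> :: "'a::euclidean_space \<Rightarrow> complex"
  assumes "schwartz \<phi>"
  shows "integrable lborel (fourier \<phi>)"
proof -
  obtain C where "\<And>x. norm (fourier \<phi> x) \<le> C / (1 + norm x) ^ (2 * DIM('a))"
    using fourier_decay[OF assms] by metis
  then show ?thesis
    by (intro integrable_decay fourier_measurable schwartz_borel_measurable assms)
qed

lemma Fubini_bounded_kernel:
  fixes u :: "'a \<Rightarrow> complex" and w :: "'b \<Rightarrow> complex"
  assumes "sigma_finite_measure M" "sigma_finite_measure N"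
    and u: "integrable M u" and w: "integrable N w"
    and [measurable]: "(\<lambda>(x, y). k x y) \<in> borel_measurable (M \<Otimes>\<^sub>M N)"
    and k: "\<And>x y. norm (k x y) \<le> B"
  shows "(LINT x|M. u x * (LINT y|N. w y * k x y)) = (LINT y|N. w y * (LINT x|M. u x * k x y))"
proof -
  interpret pair_sigma_finite M N using assms(1,2) by (simp add: pair_sigma_finite_def)
  have [measurable]: "u \<in> borel_measurable M" "w \<in> borel_measurable N" using u w by auto
  have kx: "(\<lambda>y. k x y) \<in> borel_measurable N" if "x \<in> space M" for x
    using measurable_compose[OF measurable_Pair1'[OF that] assms(5)] by simp
  have ky: "(\<lambda>x. k x y) \<in> borel_measurable M" if "y \<in> space N" for y
    using measurable_compose[OF measurable_Pair2'[OF that] assms(5)] by simp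
  have B0: "0 \<le> B" using order_trans[OF norm_ge_zero k] .
  have "integrable (M \<Otimes>\<^sub>M N) (\<lambda>(x, y). u x * (w y * k x y))"
  proof (rule Fubini_integrable)
    show "AE x in M. integrable N (\<lambda>y. case (x, y) of (x, y) \<Rightarrow> u x * (w y * k x y))"
      by (rule AE_I2) (auto intro!: integrable_mult_right integrable_mult_bounded[OF w kx k])
    show "integrable M (\<lambda>x. LINT y|N. norm (case (x, y) of (x, y) \<Rightarrow> u x * (w y * k x y)))"
    proof (rule Bochner_Integration.integrable_bound[of _ "\<lambda>x. norm (u x) * (B * (LINT y|N. norm (w y)))"])
      show "AE x in M. norm (LINT y|N. norm (case (x, y) of (x, y) \<Rightarrow> u x * (w y * k x y)))
          \<le> norm (norm (u x) * (B * (LINT y|N. norm (w y))))"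
      proof (rule AE_I2)
        fix x assume x: "x \<in> space M"
        have "(LINT y|N. norm (u x * (w y * k x y))) \<le> (LINT y|N. norm (u x) * (B * norm (w y)))"
          using w integrable_mult_bounded[OF w kx[OF x] k] mult_left_mono[OF k norm_ge_zero]
          by (intro integral_mono integrable_norm integrable_mult_right)
             (auto simp: norm_mult intro!: mult_left_mono simp: mult.commute)
        moreover have "0 \<le> (LINT y|N. norm (u x * (w y * k x y)))" by (rule integral_nonneg_AE) simp
        ultimately show "norm (LINT y|N. norm (case (x, y) of (x, y) \<Rightarrow> u x * (w y * k x y)))
          \<le> norm (norm (u x) * (B * (LINT y|N. norm (w y))))"
          using B0 by (simp add: abs_mult)
      qed
    qed (use u in auto)
  qed simp
  from Fubini_integral[OF this] have
    "(LINT y|N. LINT x|M. u x * (w y * k x y)) = (LINT x|M. LINT y|N. u x * (w y * k x y))" .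
  moreover have "(LINT x|M. LINT y|N. u x * (w y * k x y)) = (LINT x|M. u x * (LINT y|N. w y * k x y))"
    by simp
  moreover have "(LINT x|M. u x * (w y * k x y)) = w y * (LINT x|M. u x * k x y)" for y
    by (subst integral_mult_right_zero[symmetric]) (simp only: mult.left_commute)
  ultimately show ?thesis by simp
qed

lemma gaussian_average:
  fixes g :: "'a::euclidean_space \<Rightarrow> 'b::{banach,second_countable_topology}"
  assumes t: "t > 0" and [measurable]: "g \<in> borel_measurable borel"
  shows "(LBINT w. heat t x w *\<^sub>R g w)
    = sqrt t ^ DIM('a) *\<^sub>R (LBINT z. std_gauss z *\<^sub>R g (x + sqrt t *\<^sub>R z))"
  using t
  by (subst lborel_integral_affine(2)[where c="sqrt t" and t=x]) (auto simp: power_mult_distrib)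

text \<open>
  Insert the factor \<open>gauss h\<close>, exchange the integrals, and evaluate the inner one with
  \<open>gaussian_fourier\<close>: the result is a Gaussian average of \<open>\<phi>\<close> around \<open>v\<close> with variance \<open>h\<close>. Both sides
  converge as \<open>h \<rightarrow> 0\<close>.
\<close>
lemma fourier_inversion:
  fixes \<phi> :: "'a::euclidean_space \<Rightarrow> complex"
  assumes \<phi>: "schwartz \<phi>"
  shows "(LBINT x. fourier \<phi> x * iexp (x \<bullet> v)) = complex_of_real ((2 * pi) ^ DIM('a)) * \<phi> v"
proof -
  define h where "h n = inverse (real (Suc n))" for n
  have h: "h n > 0" for n by (auto simp: h_def)
  have h0: "h \<longlonglongrightarrow> 0" unfolding h_def by (rule LIMSEQ_inverse_real_of_nat)
  have [measurable]: "\<phi> \<in> borel_measurable borel" "fourier \<phi> \<in> borel_measurable borel"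
    using \<phi> by (auto intro: schwartz_borel_measurable fourier_measurable)
  let ?I = "\<lambda>n. LINT x|lborel. fourier \<phi> x * iexp (x \<bullet> v) * complex_of_real (gauss (h n) x)"
  have L1: "?I \<longlonglongrightarrow> (LBINT x. fourier \<phi> x * iexp (x \<bullet> v))"
  proof (rule integral_dominated_convergence[where w="\<lambda>x. norm (fourier \<phi> x)"])
    show "integrable lborel (\<lambda>x. norm (fourier \<phi> x))" using fourier_integrable[OF \<phi>] by simp
    show "AE x in lborel. (\<lambda>n. fourier \<phi> x * iexp (x \<bullet> v) * complex_of_real (gauss (h n) x))
        \<longlonglongrightarrow> fourier \<phi> x * iexp (x \<bullet> v)"
    proof (rule AE_I2)
      fix x
      have "(\<lambda>n. fourier \<phi> x * iexp (x \<bullet> v) * complex_of_real (gauss (h n) x))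
        \<longlonglongrightarrow> fourier \<phi> x * iexp (x \<bullet> v) * complex_of_real (gauss 0 x)"
        by (intro tendsto_intros h0) simp
      then show "(\<lambda>n. fourier \<phi> x * iexp (x \<bullet> v) * complex_of_real (gauss (h n) x))
        \<longlonglongrightarrow> fourier \<phi> x * iexp (x \<bullet> v)" by simp
    qed
    show "AE x in lborel. norm (fourier \<phi> x * iexp (x \<bullet> v) * complex_of_real (gauss (h n) x)) \<le> norm (fourier \<phi> x)" for n
      using h[of n] by (intro AE_I2) (simp add: norm_mult mult_left_le zero_le_mult_iff less_imp_le)
  qed simp_all
  define J where "J n = complex_of_real (sqrt (2 * pi) ^ DIM('a)) * (LBINT z. std_gauss z *\<^sub>R \<phi> (v + sqrt (h n) *\<^sub>R z))" for n
  have E: "?I n = J n" for n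
  proof -
    have "?I n = (LBINT x. complex_of_real (gauss (h n) x) * (LBINT y. \<phi> y * iexp ((v - y) \<bullet> x)))"
    proof (rule Bochner_Integration.integral_cong[OF refl])
      fix x :: 'a
      have "fourier \<phi> x * iexp (x \<bullet> v) = (LBINT y. \<phi> y * exp (- \<i> * complex_of_real (y \<bullet> x)) * iexp (x \<bullet> v))"
        unfolding fourier_def by simp
      also have "\<dots> = (LBINT y. \<phi> y * iexp ((v - y) \<bullet> x))"
        by (intro Bochner_Integration.integral_cong refl)
           (simp add: mult.assoc exp_add[symmetric] inner_diff_left algebra_simps inner_commute)
      finally show "fourier \<phi> x * iexp (x \<bullet> v) * complex_of_real (gauss (h n) x)
        = complex_of_real (gauss (h n) x) * (LBINT y. \<phi> y * iexp ((v - y) \<bullet> x))"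
        by (simp only: mult.commute)
    qed
    also have "\<dots> = (LBINT y. \<phi> y * (LBINT x. complex_of_real (gauss (h n) x) * iexp ((v - y) \<bullet> x)))"
    proof (rule Fubini_bounded_kernel[where B=1])
      show "integrable lborel (\<lambda>x. complex_of_real (gauss (h n) (x::'a)))"
        using integrable_gaussian[OF h[of n], where 'a='a] by (rule integrable_of_real)
      show "integrable lborel \<phi>" by (rule schwartz_integrable[OF \<phi>])
    qed (auto intro: sigma_finite_lborel)
    also have "\<dots> = (LBINT y. complex_of_real (sqrt (2 * pi / h n) ^ DIM('a)) * (heat (h n) v y *\<^sub>R \<phi> y))"
      by (subst gaussian_fourier[OF h]) (simp add: scaleR_conv_of_real norm_minus_commute mult_ac)
    also have "\<dots> = complex_of_real (sqrt (2 * pi / h n) ^ DIM('a)) * (sqrt (h n) ^ DIM('a) *\<^sub>R (LBINT z. std_gauss z *\<^sub>R \<phi> (v + sqrt (h n) *\<^sub>R z)))"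
      by (subst integral_mult_right_zero) (simp only: gaussian_average[OF h] \<open>\<phi> \<in> borel_measurable borel\<close>)
    also have "\<dots> = complex_of_real (sqrt (2 * pi) ^ DIM('a)) * (LBINT z. std_gauss z *\<^sub>R \<phi> (v + sqrt (h n) *\<^sub>R z))"
      using h[of n] by (simp add: scaleR_conv_of_real real_sqrt_divide power_divide)
    finally show ?thesis unfolding J_def .
  qed
  have L2: "J
     \<longlonglongrightarrow> complex_of_real (sqrt (2 * pi) ^ DIM('a)) * (LBINT z. std_gauss (z::'a) *\<^sub>R \<phi> v)"
    unfolding J_def
  proof (intro tendsto_mult tendsto_const)
    obtain C where C: "C \<ge> 0" "\<And>x. norm (\<phi> x) \<le> C / (1 + norm x) ^ 0"
      using schwartz_decay[OF \<phi>] by metis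
    show "(\<lambda>n. LINT z|lborel. std_gauss z *\<^sub>R \<phi> (v + sqrt (h n) *\<^sub>R z)) \<longlonglongrightarrow> (LBINT z. std_gauss (z::'a) *\<^sub>R \<phi> v)"
    proof (rule integral_dominated_convergence[where w="\<lambda>z::'a. std_gauss z * C"])
      show "integrable lborel (\<lambda>z::'a. std_gauss z * C)"
        using integrable_gaussian[of 1, where 'a='a] by simp
      show "AE z in lborel. (\<lambda>n. std_gauss z *\<^sub>R \<phi> (v + sqrt (h n) *\<^sub>R z)) \<longlonglongrightarrow> std_gauss z *\<^sub>R \<phi> v"
      proof (rule AE_I2)
        fix z
        have "(\<lambda>n. v + sqrt (h n) *\<^sub>R z) \<longlonglongrightarrow> v + sqrt 0 *\<^sub>R z"
          by (intro tendsto_intros h0)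
        moreover have "isCont \<phi> v"
          using schwartz_continuous_on[OF \<phi>, of UNIV] by (simp add: continuous_on_eq_continuous_at)
        ultimately have "(\<lambda>n. \<phi> (v + sqrt (h n) *\<^sub>R z)) \<longlonglongrightarrow> \<phi> v"
          using isCont_tendsto_compose by fastforce
        then show "(\<lambda>n. std_gauss z *\<^sub>R \<phi> (v + sqrt (h n) *\<^sub>R z)) \<longlonglongrightarrow> std_gauss z *\<^sub>R \<phi> v"
          by (intro tendsto_intros)
      qed
      show "AE z in lborel. norm (std_gauss z *\<^sub>R \<phi> (v + sqrt (h n) *\<^sub>R z)) \<le> std_gauss z * C" for n
        using C(2) by (intro AE_I2) (auto intro!: mult_left_mono)
    qed simp_all
  qed
  have G: "(LBINT z. std_gauss (z::'a) *\<^sub>R \<phi> v) = complex_of_real (sqrt (2 * pi) ^ DIM('a)) * \<phi> v"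
  proof -
    have "(LBINT z. complex_of_real (std_gauss (z::'a))) = complex_of_real (sqrt (2 * pi) ^ DIM('a))"
      using gaussian_fourier[of 1 "0::'a"] by simp
    then show ?thesis by (simp add: scaleR_conv_of_real)
  qed
  have "(LBINT x. fourier \<phi> x * iexp (x \<bullet> v))
     = complex_of_real (sqrt (2 * pi) ^ DIM('a)) * (complex_of_real (sqrt (2 * pi) ^ DIM('a)) * \<phi> v)"
  proof -
    have IJ: "?I = J" by (rule ext) (rule E)
    have "J \<longlonglongrightarrow> (LBINT x. fourier \<phi> x * iexp (x \<bullet> v))"
      unfolding IJ[symmetric] by (rule L1)
    from LIMSEQ_unique[OF this L2] show ?thesis by (subst (asm) G)
  qed
  also have "\<dots> = complex_of_real ((2 * pi) ^ DIM('a)) * \<phi> v"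
  proof -
    have "sqrt (2 * pi) ^ DIM('a) * sqrt (2 * pi) ^ DIM('a) = (2 * pi) ^ DIM('a)"
      by (subst power_mult_distrib[symmetric]) simp
    then show ?thesis by (simp only: mult.assoc[symmetric] of_real_mult[symmetric])
  qed
  finally show ?thesis .
qed

section \<open>Logarithms as mixtures of Gaussians\<close>

text \<open>
  By the mean value theorem the increment is \<open>a\<close> times a value of \<open>p\<close> at distance at most \<open>\<bar>a\<bar>\<close> from \<open>u\<close>; the
  hypothesis on \<open>F\<close> says that such intermediate points follow \<open>u\<close> to the limit. It covers both
  \<open>at_top\<close> and \<open>at_bot\<close>.
\<close>
lemma integral_shift_limit:
  fixes p P :: "real \<Rightarrow> real"
  assumes P: "\<And>u. (P has_real_derivative p u) (at u)" and p: "(p \<longlongrightarrow> L) F"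
    and F: "\<And>\<xi>. (\<And>u. \<bar>\<xi> u - u\<bar> \<le> \<bar>a\<bar>) \<Longrightarrow> filterlim \<xi> F F"
  shows "((\<lambda>u. P (u + a) - P u) \<longlongrightarrow> a * L) F"
proof -
  have "\<exists>z. \<bar>z - u\<bar> \<le> \<bar>a\<bar> \<and> P (u + a) - P u = a * p z" for u
  proof (cases a "0::real" rule: linorder_cases)
    case less
    then obtain z where "u + a < z" "z < u" "P u - P (u + a) = (u - (u + a)) * p z"
      using MVT2[of "u + a" u P p] P by auto
    then show ?thesis using less by (intro exI[of _ z]) auto
  next
    case greater
    then obtain z where "u < z" "z < u + a" "P (u + a) - P u = (u + a - u) * p z"
      using MVT2[of u "u + a" P p] P by auto
    then show ?thesis using greater by (intro exI[of _ z]) auto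
  qed (auto intro!: exI[of _ u])
  then obtain \<xi> where \<xi>: "\<And>u. \<bar>\<xi> u - u\<bar> \<le> \<bar>a\<bar>" "\<And>u. P (u + a) - P u = a * p (\<xi> u)" by metis
  show ?thesis
    unfolding \<xi>(2) by (intro tendsto_mult tendsto_const filterlim_compose[OF p] F \<xi>(1))
qed

text \<open>
  Frullani's formula in the logarithmic variable, where dilations are translations. For an antiderivative
  \<open>P\<close> of \<open>p\<close>, the integrand has the antiderivative \<open>\<Sum> c\<^sub>i (P (u + \<alpha>\<^sub>i) - P u)\<close>, since the \<open>c\<^sub>i\<close> sum to \<open>0\<close>;
  its limits follow from \<open>integral_shift_limit\<close>. Nonnegativity replaces the assumption of absolute
  integrability. Three shifts are needed later, not only two.
\<close>
lemma frullani:
  fixes p :: "real \<Rightarrow> real" and c \<alpha> :: "'i \<Rightarrow> real"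
  assumes cont: "\<And>u. isCont p u" and A: "(p \<longlongrightarrow> A) at_bot" and B: "(p \<longlongrightarrow> B) at_top"
    and c: "sum c I = 0" and nonneg: "\<And>u. 0 \<le> (\<Sum>i\<in>I. c i * p (u + \<alpha> i))"
  shows "integrable lborel (\<lambda>u. \<Sum>i\<in>I. c i * p (u + \<alpha> i))"
    and "(LBINT u. (\<Sum>i\<in>I. c i * p (u + \<alpha> i))) = (B - A) * (\<Sum>i\<in>I. c i * \<alpha> i)"
proof -
  obtain P where "\<And>u. (P has_vector_derivative p u) (at u)"
    using einterval_antiderivative[of "-\<infinity>" "\<infinity>" p] cont by auto
  then have P: "(P has_real_derivative p u) (at u)" for u
    by (simp add: has_real_derivative_iff_has_vector_derivative)
  define W where "W u = (\<Sum>i\<in>I. c i * (P (u + \<alpha> i) - P u))" for u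
  have W: "W u = (\<Sum>i\<in>I. c i * P (u + \<alpha> i))" for u
  proof -
    have "W u = (\<Sum>i\<in>I. c i * P (u + \<alpha> i)) - sum c I * P u"
      by (simp add: W_def right_diff_distrib sum_subtractf sum_distrib_right)
    then show ?thesis by (simp add: c)
  qed
  have top: "(W \<longlongrightarrow> (\<Sum>i\<in>I. c i * (\<alpha> i * B))) at_top"
    unfolding W_def
  proof (intro tendsto_sum tendsto_mult tendsto_const integral_shift_limit[OF P B])
    fix i and \<xi> :: "real \<Rightarrow> real" assume \<xi>: "\<And>u. \<bar>\<xi> u - u\<bar> \<le> \<bar>\<alpha> i\<bar>"
    have "filterlim (\<lambda>u. - \<bar>\<alpha> i\<bar> + u) at_top at_top"
      by (intro filterlim_tendsto_add_at_top[OF tendsto_const] filterlim_ident)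
    then show "filterlim \<xi> at_top at_top"
      by (rule filterlim_at_top_mono) (use \<xi> in \<open>auto simp: abs_le_iff algebra_simps intro!: always_eventually\<close>)
  qed
  have bot: "(W \<longlongrightarrow> (\<Sum>i\<in>I. c i * (\<alpha> i * A))) at_bot"
    unfolding W_def
  proof (intro tendsto_sum tendsto_mult tendsto_const integral_shift_limit[OF P A])
    fix i and \<xi> :: "real \<Rightarrow> real" assume \<xi>: "\<And>u. \<bar>\<xi> u - u\<bar> \<le> \<bar>\<alpha> i\<bar>"
    have "eventually (\<lambda>u. \<xi> u \<le> Z) at_bot" for Z
      using eventually_le_at_bot[of "Z - \<bar>\<alpha> i\<bar>"]
    proof eventually_elim
      case (elim u)
      then show ?case using \<xi>[of u] by linarith
    qed
    then show "filterlim \<xi> at_bot at_bot"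
      by (simp add: filterlim_at_bot)
  qed
  let ?f = "\<lambda>u. \<Sum>i\<in>I. c i * p (u + \<alpha> i)"
  have der: "(W has_real_derivative ?f u) (at u)" for u
  proof -
    have "((\<lambda>u. P (u + \<alpha> i)) has_real_derivative p (u + \<alpha> i)) (at u)" for i
      using P[of "u + \<alpha> i"] by (simp add: DERIV_shift add.commute)
    then show ?thesis unfolding W by (intro DERIV_sum DERIV_cmult)
  qed
  have fc: "isCont ?f u" for u
    by (intro continuous_intros isCont_o2[OF _ cont])
  have 1: "set_integrable lborel (einterval (-\<infinity>) \<infinity>) ?f"
    by (rule interval_integral_FTC_nonneg(1)[where F=W and A="\<Sum>i\<in>I. c i * (\<alpha> i * A)" and B="\<Sum>i\<in>I. c i * (\<alpha> i * B)"])
       (use der fc nonneg top bot in \<open>simp_all add: ereal_tendsto_simps1\<close>)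
  have 2: "(LBINT u=-\<infinity>..\<infinity>. ?f u) = (\<Sum>i\<in>I. c i * (\<alpha> i * B)) - (\<Sum>i\<in>I. c i * (\<alpha> i * A))"
    by (rule interval_integral_FTC_nonneg(2)[where F=W and A="\<Sum>i\<in>I. c i * (\<alpha> i * A)" and B="\<Sum>i\<in>I. c i * (\<alpha> i * B)"])
       (use der fc nonneg top bot in \<open>simp_all add: ereal_tendsto_simps1\<close>)
  show "integrable lborel ?f"
    using 1 by (simp add: set_integrable_def)
  show "integral\<^sup>L lborel ?f = (B - A) * (\<Sum>i\<in>I. c i * \<alpha> i)"
    using 2 by (simp add: interval_lebesgue_integral_def set_lebesgue_integral_def
        sum_distrib_left sum_subtractf[symmetric] algebra_simps)
qed

text \<open>The function \<open>exp (- r\<^sup>2 / 2)\<close> of the logarithmic variable \<open>v = ln r\<close>.\<close>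
definition log_gauss :: "real \<Rightarrow> real" where
  "log_gauss v = exp (- (exp v)\<^sup>2 / 2)"

lemma log_gauss_limits:
  "isCont log_gauss u" "(log_gauss \<longlongrightarrow> 1) at_bot" "(log_gauss \<longlongrightarrow> 0) at_top"
proof -
  show "isCont log_gauss u" unfolding log_gauss_def[abs_def] by (intro continuous_intros) auto
  show "(log_gauss \<longlongrightarrow> 1) at_bot" unfolding log_gauss_def[abs_def] by real_asymp
  show "(log_gauss \<longlongrightarrow> 0) at_top" unfolding log_gauss_def[abs_def] by real_asymp
qed

lemma log_gauss_shift: "a \<noteq> 0 \<Longrightarrow> log_gauss (v + ln \<bar>a\<bar>) = exp (- (exp v * a)\<^sup>2 / 2)"
  by (simp add: log_gauss_def exp_add power_mult_distrib)

lemma ln_as_gaussian_integral: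
  assumes a: "a \<noteq> 0"
  shows "integrable lborel (\<lambda>v. log_gauss v - exp (- (exp v * a)\<^sup>2 / 2))"
    and "(LBINT v. log_gauss v - exp (- (exp v * a)\<^sup>2 / 2)) = ln \<bar>a\<bar>"
    and "(LBINT v. \<bar>log_gauss v - exp (- (exp v * a)\<^sup>2 / 2)\<bar>) = \<bar>ln \<bar>a\<bar>\<bar>"
proof -
  \<comment> \<open>The integrand has the sign of \<open>ln \<bar>a\<bar>\<close>; multiplied by \<open>\<sigma>\<close> it is nonnegative, as \<open>frullani\<close> requires.\<close>
  define \<sigma> :: real where "\<sigma> = (if \<bar>a\<bar> \<ge> 1 then 1 else -1)"
  let ?d = "\<lambda>v. log_gauss v - log_gauss (v + ln \<bar>a\<bar>)"
  have \<sigma>: "\<sigma> * \<sigma> = 1" "\<sigma> * ln \<bar>a\<bar> = \<bar>ln \<bar>a\<bar>\<bar>"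
    using a by (auto simp: \<sigma>_def ln_ge_zero ln_le_zero_iff)
  have nn: "0 \<le> \<sigma> * ?d u" for u
  proof -
    have "(exp u)\<^sup>2 \<le> (exp u * a)\<^sup>2 \<longleftrightarrow> \<bar>a\<bar> \<ge> 1"
      by (simp add: power_mult_distrib abs_square_le_1 abs_le_square_iff[of 1 a, simplified])
    then show ?thesis unfolding log_gauss_shift[OF a] by (auto simp: \<sigma>_def log_gauss_def)
  qed
  let ?c = "\<lambda>i::bool. if i then - \<sigma> else \<sigma>" and ?\<alpha> = "\<lambda>i::bool. if i then ln \<bar>a\<bar> else 0"
  have eq: "(\<Sum>i\<in>UNIV. ?c i * log_gauss (u + ?\<alpha> i)) = \<sigma> * ?d u" for u
    by (simp add: UNIV_bool algebra_simps)
  note fr = frullani[OF log_gauss_limits, of ?c UNIV ?\<alpha>, unfolded eq]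
  have i: "integrable lborel (\<lambda>u. \<sigma> * ?d u)"
    by (rule fr(1)) (use nn in \<open>auto simp: UNIV_bool\<close>)
  have v: "(LBINT u. \<sigma> * ?d u) = \<bar>ln \<bar>a\<bar>\<bar>"
    by (subst fr(2)) (use nn \<sigma> in \<open>auto simp: UNIV_bool\<close>)
  have d: "?d v = \<sigma> * (\<sigma> * ?d v)" for v
    using \<sigma>(1) by (simp add: mult.assoc[symmetric])
  show "integrable lborel (\<lambda>v. log_gauss v - exp (- (exp v * a)\<^sup>2 / 2))"
    unfolding log_gauss_shift[OF a, symmetric] by (subst d) (rule integrable_mult_right[OF i])
  have "(LBINT v. ?d v) = \<sigma> * \<bar>ln \<bar>a\<bar>\<bar>"
    by (subst d, subst integral_mult_right_zero) (simp only: v)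
  also have "\<dots> = ln \<bar>a\<bar>"
    unfolding \<sigma>(2)[symmetric] using \<sigma>(1) by (simp add: mult.assoc[symmetric])
  finally show "(LBINT v. log_gauss v - exp (- (exp v * a)\<^sup>2 / 2)) = ln \<bar>a\<bar>"
    unfolding log_gauss_shift[OF a, symmetric] .
  have "\<bar>?d v\<bar> = \<sigma> * ?d v" for v
    using nn[of v] by (auto simp: \<sigma>_def split: if_splits)
  then show "(LBINT v. \<bar>log_gauss v - exp (- (exp v * a)\<^sup>2 / 2)\<bar>) = \<bar>ln \<bar>a\<bar>\<bar>"
    unfolding log_gauss_shift[OF a, symmetric] by (simp only: v)
qed

lemma integral_nonneg_Reals:
  fixes h :: "'a \<Rightarrow> complex"
  assumes "\<And>x. x \<in> space M \<Longrightarrow> h x \<in> \<real>\<^sub>\<ge>\<^sub>0"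
  shows "integral\<^sup>L M h \<in> \<real>\<^sub>\<ge>\<^sub>0"
proof -
  have "integral\<^sup>L M h = (LINT x|M. complex_of_real (Re (h x)))"
    using assms by (intro Bochner_Integration.integral_cong refl) (auto simp: complex_nonneg_Reals_iff complex_eq_iff)
  moreover have "0 \<le> (LINT x|M. Re (h x))"
    using assms by (intro Bochner_Integration.integral_nonneg) (auto simp: complex_nonneg_Reals_iff)
  ultimately show ?thesis by simp
qed

text \<open>
  A Gaussian in \<open>x \<bullet> \<xi>\<close> is the average of the characters with frequencies \<open>u s \<xi>\<close> over normally distributed
  \<open>u\<close>. By Fourier inversion the integral is an average of \<open>(2\<pi>)\<^sup>n \<phi> (u s \<xi>)\<close>.
\<close>
lemma gaussian_slice_nonneg:
  fixes \<phi> :: "'a::euclidean_space \<Rightarrow> complex"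
  assumes \<phi>: "schwartz \<phi>" and nn: "\<And>x. \<phi> x \<in> \<real>\<^sub>\<ge>\<^sub>0"
  shows "(LBINT x. fourier \<phi> x * complex_of_real (exp (- (s * (x \<bullet> \<xi>))\<^sup>2 / 2))) \<in> \<real>\<^sub>\<ge>\<^sub>0"
proof -
  let ?w = "\<lambda>u::real. complex_of_real (std_normal_density u)"
  have iw: "integrable lborel ?w"
    by (rule integrable_of_real) (simp add: integrable_normal_density)
  have g: "complex_of_real (exp (- (s * (x \<bullet> \<xi>))\<^sup>2 / 2)) = (LBINT u. ?w u * iexp (u * s * (x \<bullet> \<xi>)))" for x
  proof -
    have "(LBINT u. ?w u * iexp (u * s * (x \<bullet> \<xi>)))
      = (LBINT u. complex_of_real (1 / sqrt (2 * pi)) * (complex_of_real (exp (- 1 * u\<^sup>2 / 2)) * iexp ((s * (x \<bullet> \<xi>)) * u)))"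
      by (intro Bochner_Integration.integral_cong refl) (simp add: std_normal_density_def mult_ac)
    also have "\<dots> = complex_of_real (exp (- (s * (x \<bullet> \<xi>))\<^sup>2 / 2))"
      by (subst integral_mult_right_zero, subst gaussian_fourier_real(2)) simp_all
    finally show ?thesis by simp
  qed
  have "(LBINT x. fourier \<phi> x * complex_of_real (exp (- (s * (x \<bullet> \<xi>))\<^sup>2 / 2)))
    = (LBINT u. ?w u * (LBINT x. fourier \<phi> x * iexp (u * s * (x \<bullet> \<xi>))))"
    unfolding g
    by (rule Fubini_bounded_kernel[where B=1]) (auto intro: sigma_finite_lborel fourier_integrable[OF \<phi>] iw)
  also have "\<dots> = (LBINT u. ?w u * (complex_of_real ((2 * pi) ^ DIM('a)) * \<phi> ((u * s) *\<^sub>R \<xi>)))"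
    by (subst fourier_inversion[OF \<phi>, symmetric]) (simp add: mult.assoc)
  also have "\<dots> \<in> \<real>\<^sub>\<ge>\<^sub>0"
    by (intro integral_nonneg_Reals nonneg_Reals_mult_I nn) (auto simp: normal_density_nonneg)
  finally show ?thesis .
qed

lemma ext_integral_ext_ln:
  fixes g :: "'a \<Rightarrow> real"
  assumes [measurable]: "g \<in> borel_measurable M" and nz: "AE \<xi> in M. g \<xi> \<noteq> 0"
    and int: "integrable M (\<lambda>\<xi>. ln \<bar>g \<xi>\<bar>)"
  shows "ext_integral M (\<lambda>\<xi>. ext_ln \<bar>g \<xi>\<bar>) = ereal (LINT \<xi>|M. ln \<bar>g \<xi>\<bar>)"
proof -
  let ?l = "\<lambda>\<xi>. ln \<bar>g \<xi>\<bar>"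
  have P: "(\<integral>\<^sup>+ \<xi>. e2ennreal (ext_ln \<bar>g \<xi>\<bar>) \<partial>M) = (\<integral>\<^sup>+ \<xi>. ennreal (?l \<xi>) \<partial>M)"
    and N: "(\<integral>\<^sup>+ \<xi>. e2ennreal (- ext_ln \<bar>g \<xi>\<bar>) \<partial>M) = (\<integral>\<^sup>+ \<xi>. ennreal (- ?l \<xi>) \<partial>M)"
    using nz by (auto intro!: nn_integral_cong_AE simp: ext_ln_def)
  obtain r q where rq: "0 \<le> r" "0 \<le> q" "(\<integral>\<^sup>+ \<xi>. ennreal (?l \<xi>) \<partial>M) = ennreal r"
     "(\<integral>\<^sup>+ \<xi>. ennreal (- ?l \<xi>) \<partial>M) = ennreal q" "integral\<^sup>L M ?l = r - q"
    by (rule integrableE[OF int])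
  show ?thesis
    unfolding ext_integral_def P N rq by (simp add: rq(1,2))
qed

text \<open>
  The positive part of the logarithm is bounded and the measure is finite. So a finite value of
  the extended integral forces the integral of the negative part to be finite as well, and then \<open>g\<close> vanishes
  only on a null set.
\<close>
lemma ext_integral_ext_ln_finite:
  fixes g :: "'a \<Rightarrow> real"
  assumes "finite_measure M" and [measurable]: "g \<in> borel_measurable M"
    and B: "AE \<xi> in M. \<bar>g \<xi>\<bar> \<le> B"
    and fin: "ext_integral M (\<lambda>\<xi>. ext_ln \<bar>g \<xi>\<bar>) = ereal c"
  shows "AE \<xi> in M. g \<xi> \<noteq> 0" and "integrable M (\<lambda>\<xi>. ln \<bar>g \<xi>\<bar>)" and "(LINT \<xi>|M. ln \<bar>g \<xi>\<bar>) = c"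
proof -
  interpret finite_measure M by fact
  let ?P = "\<integral>\<^sup>+ \<xi>. e2ennreal (ext_ln \<bar>g \<xi>\<bar>) \<partial>M" and ?N = "\<integral>\<^sup>+ \<xi>. e2ennreal (- ext_ln \<bar>g \<xi>\<bar>) \<partial>M"
  have [measurable]: "(\<lambda>\<xi>. ext_ln \<bar>g \<xi>\<bar>) \<in> borel_measurable M"
    unfolding ext_ln_def by measurable
  have "?P \<le> (\<integral>\<^sup>+ \<xi>. ennreal \<bar>B\<bar> \<partial>M)"
  proof (rule nn_integral_mono_AE, use B in eventually_elim)
    fix \<xi> assume "\<bar>g \<xi>\<bar> \<le> B"
    then show "e2ennreal (ext_ln \<bar>g \<xi>\<bar>) \<le> ennreal \<bar>B\<bar>"
      using ln_bound[of "\<bar>g \<xi>\<bar>"] by (auto simp: ext_ln_def e2ennreal_neg intro!: ennreal_leI)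
  qed
  also have "\<dots> < \<infinity>" by (simp add: ennreal_mult_less_top emeasure_eq_measure)
  finally have P: "?P < \<infinity>" .
  have N: "?N < \<infinity>"
  proof (rule ccontr)
    assume "\<not> ?N < \<infinity>"
    then have "?N = \<infinity>" by (auto simp: less_top[symmetric])
    moreover obtain p where "?P = ennreal p" "0 \<le> p" using P by (cases ?P) auto
    ultimately show False using fin by (simp add: ext_integral_def)
  qed
  have "AE \<xi> in M. e2ennreal (- ext_ln \<bar>g \<xi>\<bar>) \<noteq> \<infinity>"
    using N by (intro nn_integral_PInf_AE) auto
  then show nz: "AE \<xi> in M. g \<xi> \<noteq> 0"
    by eventually_elim (auto simp: ext_ln_def)
  have "(\<integral>\<^sup>+ \<xi>. ennreal (norm (ln \<bar>g \<xi>\<bar>)) \<partial>M) = (\<integral>\<^sup>+ \<xi>. e2ennreal (ext_ln \<bar>g \<xi>\<bar>) + e2ennreal (- ext_ln \<bar>g \<xi>\<bar>) \<partial>M)"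
    using nz by (intro nn_integral_cong_AE) (auto elim!: eventually_mono simp: ext_ln_def abs_if ennreal_neg)
  also have "\<dots> = ?P + ?N" by (rule nn_integral_add) auto
  also have "\<dots> < \<infinity>" using P N by simp
  finally show int: "integrable M (\<lambda>\<xi>. ln \<bar>g \<xi>\<bar>)" by (intro integrableI_bounded) auto
  show "(LINT \<xi>|M. ln \<bar>g \<xi>\<bar>) = c"
    using ext_integral_ext_ln[OF _ nz int] fin by simp
qed

section \<open>Logarithms of homogeneous functions\<close>

text \<open>
  Besides \<open>ln (minkowski_functional K)\<close> there is a second instance, the logarithm \<open>ln \<bar>u\<bar>\<close> on the line, which
  serves to identify a kernel in \<open>log_kernel_eq_increment\<close>.
\<close>
locale homogeneous_log =
  fixes f :: "'a::euclidean_space \<Rightarrow> real" and B :: real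
  assumes f_measurable [measurable]: "f \<in> borel_measurable borel"
    and f_bound: "x \<noteq> 0 \<Longrightarrow> \<bar>f x - ln (norm x)\<bar> \<le> B"
    and f_scale: "c > 0 \<Longrightarrow> x \<noteq> 0 \<Longrightarrow> f (c *\<^sub>R x) = ln c + f x"
    and f_even: "f (- x) = f x"
    and f_cont: "x \<noteq> 0 \<Longrightarrow> isCont f x"
begin

lemma f_log_bound: "x \<noteq> 0 \<Longrightarrow> \<bar>f x\<bar> \<le> \<bar>ln (norm x)\<bar> + B"
  using f_bound[of x] by linarith

lemma integrable_f_decay:
  fixes g :: "'a \<Rightarrow> 'b::{banach, second_countable_topology}"
  assumes "g \<in> borel_measurable borel"
    and "\<And>x. norm (g x) \<le> C / (1 + norm x) ^ (2 * DIM('a) + 1)"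
  shows "integrable lborel (\<lambda>x. f x *\<^sub>R g x)"
  by (rule integrable_log_decay[OF f_measurable assms(1) f_log_bound assms(2)])

text \<open>
  The logarithm under the integral is replaced by its Gaussian mixture, and all integrals are exchanged so
  that the one over \<open>x\<close> comes first. Absolute integrability needs no estimate uniform in \<open>\<xi>\<close>: since
  \<open>ln \<bar>x \<bullet> \<xi>\<bar> \<le> ln (norm x)\<close>, the integral of \<open>\<bar>ln \<bar>x \<bullet> \<xi>\<bar>\<bar>\<close> over \<open>\<xi>\<close> is controlled by \<open>f x\<close> and \<open>ln (norm x)\<close>, which
  are integrable against the transform of \<open>\<phi>\<close>.
\<close>
lemma fourier_nonpos_of_log_integral:
  assumes "finite_measure \<mu>" and sets_\<mu>[measurable_cong]: "sets \<mu> = sets borel"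
    and sph: "AE \<xi> in \<mu>. norm \<xi> = 1"
    and nz: "\<And>x. x \<noteq> 0 \<Longrightarrow> AE \<xi> in \<mu>. x \<bullet> \<xi> \<noteq> 0"
    and int: "\<And>x. x \<noteq> 0 \<Longrightarrow> integrable \<mu> (\<lambda>\<xi>. ln \<bar>x \<bullet> \<xi>\<bar>)"
    and rep: "\<And>x. x \<noteq> 0 \<Longrightarrow> f x = (LINT \<xi>|\<mu>. ln \<bar>x \<bullet> \<xi>\<bar>) + C"
    and \<phi>: "schwartz \<phi>" "\<And>x. \<phi> x \<in> \<real>\<^sub>\<ge>\<^sub>0" "\<phi> 0 = 0"
  shows "(LBINT x. complex_of_real (f x) * fourier \<phi> x) \<in> \<real>\<^sub>\<le>\<^sub>0"
proof -
  interpret \<mu>: finite_measure \<mu> by fact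
  interpret Q: pair_sigma_finite \<mu> "lborel :: real measure"
    by (simp add: pair_sigma_finite_def \<mu>.sigma_finite_measure_axioms sigma_finite_lborel)
  define Q where "Q = \<mu> \<Otimes>\<^sub>M (lborel :: real measure)"
  interpret R: pair_sigma_finite "lborel :: 'a measure" Q
    unfolding pair_sigma_finite_def Q_def using Q.sigma_finite_measure_axioms sigma_finite_lborel by blast
  have [measurable]: "fourier \<phi> \<in> borel_measurable borel"
    by (intro fourier_measurable schwartz_borel_measurable \<phi>)
  have [measurable]: "log_gauss \<in> borel_measurable borel" unfolding log_gauss_def[abs_def] by measurable
  define k where "k x q = log_gauss (snd q) - exp (- (exp (snd q) * (x \<bullet> fst q))\<^sup>2 / 2)" for x :: 'a and q :: "'a \<times> real"
  have km[measurable]: "(\<lambda>(x, q). k x q) \<in> borel_measurable (lborel \<Otimes>\<^sub>M Q)"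
    unfolding k_def Q_def by measurable
  have kx[measurable]: "k x \<in> borel_measurable Q" for x
    unfolding k_def[abs_def] Q_def by measurable
  have kQ: "integrable Q (k x)" and kf: "(LINT q|Q. k x q) = f x - C"
    and ka: "(LINT q|Q. \<bar>k x q\<bar>) = (LINT \<xi>|\<mu>. \<bar>ln \<bar>x \<bullet> \<xi>\<bar>\<bar>)" if x: "x \<noteq> 0" for x
  proof -
    have i: "AE \<xi> in \<mu>. integrable lborel (\<lambda>v. k x (\<xi>, v))"
      using nz[OF x] unfolding k_def fst_conv snd_conv by eventually_elim (rule ln_as_gaussian_integral(1))
    have e: "AE \<xi> in \<mu>. (LBINT v. \<bar>k x (\<xi>, v)\<bar>) = \<bar>ln \<bar>x \<bullet> \<xi>\<bar>\<bar>"
      using nz[OF x] unfolding k_def fst_conv snd_conv by eventually_elim (rule ln_as_gaussian_integral(3))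
    have e2: "AE \<xi> in \<mu>. (LBINT v. k x (\<xi>, v)) = ln \<bar>x \<bullet> \<xi>\<bar>"
      using nz[OF x] unfolding k_def fst_conv snd_conv by eventually_elim (rule ln_as_gaussian_integral(2))
    have kx': "k x \<in> borel_measurable (\<mu> \<Otimes>\<^sub>M lborel)" using kx unfolding Q_def .
    have "integrable \<mu> (\<lambda>\<xi>. LINT v|lborel. norm (k x (\<xi>, v)))"
    proof (rule integrable_cong_AE_imp)
      show "integrable \<mu> (\<lambda>\<xi>. \<bar>ln \<bar>x \<bullet> \<xi>\<bar>\<bar>)" using int[OF x] by (rule integrable_abs)
      show "(\<lambda>\<xi>. LINT v|lborel. norm (k x (\<xi>, v))) \<in> borel_measurable \<mu>" using kx' by measurable
      show "AE \<xi> in \<mu>. \<bar>ln \<bar>x \<bullet> \<xi>\<bar>\<bar> = (LBINT v. norm (k x (\<xi>, v)))"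
        using e by eventually_elim simp
    qed
    then have I: "integrable (\<mu> \<Otimes>\<^sub>M lborel) (k x)"
      using kx' i by (intro Q.Fubini_integrable) auto
    then show "integrable Q (k x)" by (simp add: Q_def)
    have "(LINT q|Q. k x q) = (LINT \<xi>|\<mu>. LINT v|lborel. k x (\<xi>, v))"
      unfolding Q_def by (rule Q.integral_fst'[OF I, symmetric])
    also have "\<dots> = (LINT \<xi>|\<mu>. ln \<bar>x \<bullet> \<xi>\<bar>)"
      using borel_measurable_integrable[OF Q.integrable_fst'[OF I]] borel_measurable_integrable[OF int[OF x]]
      by (intro integral_cong_AE e2)
    finally show "(LINT q|Q. k x q) = f x - C" using rep[OF x] by simp
    have "(LINT q|Q. \<bar>k x q\<bar>) = (LINT \<xi>|\<mu>. LINT v|lborel. \<bar>k x (\<xi>, v)\<bar>)"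
      unfolding Q_def by (rule Q.integral_fst'[symmetric]) (use I in auto)
    also have "\<dots> = (LINT \<xi>|\<mu>. \<bar>ln \<bar>x \<bullet> \<xi>\<bar>\<bar>)"
      using borel_measurable_integrable[OF Q.integrable_fst'[OF integrable_abs[OF I]]]
        borel_measurable_integrable[OF integrable_abs[OF int[OF x]]]
      by (intro integral_cong_AE e)
    finally show "(LINT q|Q. \<bar>k x q\<bar>) = (LINT \<xi>|\<mu>. \<bar>ln \<bar>x \<bullet> \<xi>\<bar>\<bar>)" .
  qed
  define H where "H x = (LINT q|Q. \<bar>k x q\<bar>)" for x
  have H0: "0 \<le> H x" for x unfolding H_def by (rule Bochner_Integration.integral_nonneg) simp
  have "H \<in> borel_measurable lborel"
    unfolding H_def[abs_def] by (rule R.M2.borel_measurable_lebesgue_integral) measurable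
  then have [measurable]: "H \<in> borel_measurable borel" by simp
  \<comment> \<open>The summand \<open>1\<close> accounts for the bound on \<open>\<bar>f x\<bar>\<close> and keeps \<open>m\<close> positive.\<close>
  define m where "m = 2 * measure \<mu> (space \<mu>) + 1"
  have m: "m \<ge> 1" by (simp add: m_def)
  have H: "\<bar>H x / m\<bar> \<le> \<bar>ln (norm x)\<bar> + (\<bar>B\<bar> + \<bar>C\<bar>)" if x: "x \<noteq> 0" for x
  proof -
    have "(LINT \<xi>|\<mu>. \<bar>ln \<bar>x \<bullet> \<xi>\<bar>\<bar>) \<le> (LINT \<xi>|\<mu>. 2 * \<bar>ln (norm x)\<bar> - ln \<bar>x \<bullet> \<xi>\<bar>)"
    proof (rule integral_mono_AE)
      show "AE \<xi> in \<mu>. \<bar>ln \<bar>x \<bullet> \<xi>\<bar>\<bar> \<le> 2 * \<bar>ln (norm x)\<bar> - ln \<bar>x \<bullet> \<xi>\<bar>"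
        using nz[OF x] sph
      proof eventually_elim
        case (elim \<xi>)
        have "\<bar>x \<bullet> \<xi>\<bar> \<le> norm x" using Cauchy_Schwarz_ineq2[of x \<xi>] elim by simp
        then have "ln \<bar>x \<bullet> \<xi>\<bar> \<le> ln (norm x)" using elim by (intro ln_mono) auto
        then show ?case by linarith
      qed
    qed (use int[OF x] in auto)
    also have "\<dots> = 2 * measure \<mu> (space \<mu>) * \<bar>ln (norm x)\<bar> - (f x - C)"
      using int[OF x] rep[OF x] by simp
    also have "\<dots> \<le> 2 * measure \<mu> (space \<mu>) * \<bar>ln (norm x)\<bar> + (\<bar>ln (norm x)\<bar> + (\<bar>B\<bar> + \<bar>C\<bar>))"
      using f_log_bound[OF x] by linarith
    also have "\<dots> \<le> m * (\<bar>ln (norm x)\<bar> + (\<bar>B\<bar> + \<bar>C\<bar>))"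
      by (simp add: m_def algebra_simps)
    finally have "H x \<le> m * (\<bar>ln (norm x)\<bar> + (\<bar>B\<bar> + \<bar>C\<bar>))" unfolding H_def ka[OF x] .
    then show ?thesis using m H0[of x] by (simp add: divide_le_eq mult.commute)
  qed
  obtain D where D: "\<And>x. norm (fourier \<phi> x) \<le> D / (1 + norm x) ^ (2 * DIM('a) + 1)"
    using fourier_decay[OF \<phi>(1)] by blast
  have "integrable lborel (\<lambda>x. (H x / m) *\<^sub>R norm (fourier \<phi> x))"
    by (rule integrable_log_decay[OF _ _ H]) (use D in auto)
  from integrable_mult_right[OF this, of m] have Hint: "integrable lborel (\<lambda>x. norm (fourier \<phi> x) * H x)"
    using m by (simp add: mult.commute)
  let ?F = "\<lambda>x q. fourier \<phi> x * complex_of_real (k x q)"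
  have AE0: "AE x in lborel. x \<noteq> (0::'a)" by (rule AE_lborel_singleton)
  have F: "integrable (lborel \<Otimes>\<^sub>M Q) (\<lambda>(x, q). ?F x q)"
  proof (rule R.Fubini_integrable)
    show "AE x in lborel. integrable Q (\<lambda>q. case (x, q) of (x, q) \<Rightarrow> ?F x q)"
      using AE0 by eventually_elim (auto intro!: integrable_mult_right integrable_of_real kQ)
    show "integrable lborel (\<lambda>x. LINT q|Q. norm (case (x, q) of (x, q) \<Rightarrow> ?F x q))"
      using Hint unfolding H_def by (simp add: norm_mult)
  qed simp
  have \<phi>0: "(LBINT x. fourier \<phi> x) = 0"
    using fourier_inversion[OF \<phi>(1), of 0] \<phi>(3) by simp
  have fi: "integrable lborel (fourier \<phi>)" by (rule fourier_integrable[OF \<phi>(1)])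
  have "(LBINT x. complex_of_real (f x) * fourier \<phi> x)
      = (LBINT x. (LINT q|Q. ?F x q) + complex_of_real C * fourier \<phi> x)"
  proof (rule integral_cong_AE)
    show "AE x in lborel. complex_of_real (f x) * fourier \<phi> x = (LINT q|Q. ?F x q) + complex_of_real C * fourier \<phi> x"
      using AE0
    proof eventually_elim
      case (elim x)
      have "(LINT q|Q. ?F x q) = fourier \<phi> x * complex_of_real (f x - C)"
        using kf[OF elim] by simp
      then show ?case by (simp add: algebra_simps)
    qed
    show "(\<lambda>x. (LINT q|Q. ?F x q) + complex_of_real C * fourier \<phi> x) \<in> borel_measurable lborel"
      by measurable
  qed measurable
  also have "\<dots> = (LBINT x. LINT q|Q. ?F x q) + complex_of_real C * (LBINT x. fourier \<phi> x)"
    using R.integrable_fst'[OF F] fi by simp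
  also have "\<dots> = (LINT q|Q. LINT x|lborel. ?F x q)"
    using R.Fubini_integral[OF F] by (simp add: \<phi>0)
  also have "\<dots> = - (LINT q|Q. - (LBINT x. ?F x q))" by simp
  also have "\<dots> \<in> \<real>\<^sub>\<le>\<^sub>0"
  proof -
    have "- (LBINT x. ?F x q) \<in> \<real>\<^sub>\<ge>\<^sub>0" for q
    proof -
      let ?e = "\<lambda>x. fourier \<phi> x * complex_of_real (exp (- (exp (snd q) * (x \<bullet> fst q))\<^sup>2 / 2))"
      have "(LBINT x. ?F x q) = (LBINT x. fourier \<phi> x * complex_of_real (log_gauss (snd q)) - ?e x)"
        by (simp add: k_def algebra_simps)
      also have "\<dots> = (LBINT x. fourier \<phi> x) * complex_of_real (log_gauss (snd q)) - (LBINT x. ?e x)"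
        using fi by (subst Bochner_Integration.integral_diff) (auto intro!: integrable_mult_bounded[where B=1])
      also have "\<dots> = - (LBINT x. ?e x)" by (simp add: \<phi>0)
      finally show ?thesis using gaussian_slice_nonneg[OF \<phi>(1,2)] by simp
    qed
    then have "(LINT q|Q. - (LBINT x. ?F x q)) \<in> \<real>\<^sub>\<ge>\<^sub>0" by (intro integral_nonneg_Reals)
    then show ?thesis by (simp add: complex_nonneg_Reals_iff complex_nonpos_Reals_iff)
  qed
  finally show ?thesis .
qed

end

context
  fixes K :: "'a::euclidean_space set"
  assumes K: "symmetric_star_body K"
begin

section \<open>The Minkowski functional of a star body\<close>

text \<open>
  The factors \<open>a \<le> a0\<close> with \<open>x\<close> in the dilate of \<open>K\<close> by \<open>a\<close> form a compact set, the projection of a closed subset of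
  \<open>{0..a0} \<times> K\<close>; hence there is a least one.
\<close>
lemma minkowski_attained:
  "0 \<le> minkowski_functional K x \<and> x \<in> (\<lambda>y. minkowski_functional K x *\<^sub>R y) ` K
   \<and> (\<forall>b. 0 \<le> b \<and> x \<in> (\<lambda>y. b *\<^sub>R y) ` K \<longrightarrow> minkowski_functional K x \<le> b)"
proof -
  let ?A = "\<lambda>a. 0 \<le> a \<and> x \<in> (\<lambda>y. a *\<^sub>R y) ` K"
  have cpt: "compact K" and "0 \<in> interior K" using K by (auto simp: symmetric_star_body_def)
  then obtain e where e: "e > 0" "cball 0 e \<subseteq> K" by (meson mem_interior_cball)
  have "\<exists>a. ?A a \<and> (\<forall>b. ?A b \<longrightarrow> a \<le> b)"
  proof -
    define a0 where "a0 = norm x / e"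
    have A0: "?A a0"
    proof (cases "x = 0")
      case True
      have "0 \<in> K" using e by (intro subsetD[OF e(2)]) simp
      then show ?thesis using True by (auto simp: a0_def)
    next
      case False
      then have "a0 > 0" using e by (simp add: a0_def)
      moreover have "(1 / a0) *\<^sub>R x \<in> K" using e False by (intro subsetD[OF e(2)]) (simp add: a0_def)
      ultimately show ?thesis by (auto intro!: image_eqI[of _ _ "(1 / a0) *\<^sub>R x"])
    qed
    let ?S = "{a \<in> {0..a0}. \<exists>y\<in>K. a *\<^sub>R y = x}"
    have "?S = fst ` (({0..a0} \<times> K) \<inter> (\<lambda>p. fst p *\<^sub>R snd p) -` {x})"
      by (force simp: image_iff)
    moreover have "compact (({0..a0} \<times> K) \<inter> (\<lambda>p. fst p *\<^sub>R snd p) -` {x})"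
      by (intro compact_Int_closed compact_Times compact_Icc cpt continuous_closed_vimage) (auto intro!: continuous_intros)
    ultimately have "compact ?S" by (auto intro!: compact_continuous_image continuous_intros)
    moreover have "a0 \<in> ?S" using A0 by (auto simp: image_iff)
    ultimately obtain a where a: "a \<in> ?S" "\<And>b. b \<in> ?S \<Longrightarrow> a \<le> b"
      using compact_attains_inf[of ?S] by blast
    have "a \<le> b" if "?A b" for b
    proof (cases "b \<le> a0")
      case True
      then show ?thesis using that a(2)[of b] by (auto simp: image_iff)
    next
      case False
      then show ?thesis using a(1) by simp
    qed
    then show ?thesis using a(1) by (intro exI[of _ a]) (auto simp: image_iff)
  qed
  then obtain a where a: "?A a" "\<forall>b. ?A b \<longrightarrow> a \<le> b" by blast
  have "minkowski_functional K x = a"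
    unfolding minkowski_functional_def using a by (intro Least_equality) auto
  then show ?thesis using a by simp
qed

lemma minkowski_le: "0 \<le> b \<Longrightarrow> y \<in> K \<Longrightarrow> minkowski_functional K (b *\<^sub>R y) \<le> b"
  using minkowski_attained[of "b *\<^sub>R y"] by blast

lemma minkowski_zero: "minkowski_functional K 0 = 0"
proof -
  have "0 \<in> K" using K interior_subset by (auto simp: symmetric_star_body_def)
  from minkowski_le[OF order_refl this] minkowski_attained[of 0] show ?thesis by simp
qed

lemma minkowski_scale:
  assumes c: "c > 0" shows "minkowski_functional K (c *\<^sub>R x) = c * minkowski_functional K x"
proof -
  have le: "minkowski_functional K (d *\<^sub>R z) \<le> d * minkowski_functional K z" if "d > 0" for d z
  proof -
    obtain y where y: "y \<in> K" "z = minkowski_functional K z *\<^sub>R y" using minkowski_attained[of z] by blast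
    then have "d *\<^sub>R z = (d * minkowski_functional K z) *\<^sub>R y" by (metis scaleR_scaleR)
    then show ?thesis using minkowski_le[of "d * minkowski_functional K z" y] minkowski_attained[of z] that y by simp
  qed
  have "minkowski_functional K x \<le> inverse c * minkowski_functional K (c *\<^sub>R x)"
    using le[of "inverse c" "c *\<^sub>R x"] c by simp
  then show ?thesis using le[OF c, of x] c by (simp add: field_simps)
qed

lemma minkowski_even: "minkowski_functional K (- x) = minkowski_functional K x"
proof -
  have le: "minkowski_functional K (- z) \<le> minkowski_functional K z" for z
  proof -
    obtain y where y: "y \<in> K" "z = minkowski_functional K z *\<^sub>R y" using minkowski_attained[of z] by blast
    then have "- y \<in> K" using K by (auto simp: symmetric_star_body_def)
    then show ?thesis using minkowski_le[of "minkowski_functional K z" "- y"] minkowski_attained[of z] y by simp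
  qed
  show ?thesis using le[of x] le[of "- x"] by simp
qed

lemma minkowski_norm_equiv:
  obtains r R where "0 < r" "0 < R" "\<And>x. norm x \<le> R * minkowski_functional K x"
    "\<And>x. minkowski_functional K x \<le> norm x / r"
proof -
  have "compact K" and "0 \<in> interior K" using K by (auto simp: symmetric_star_body_def)
  then obtain r where r: "r > 0" "cball 0 r \<subseteq> K" by (meson mem_interior_cball)
  obtain R where R: "R > 0" "\<And>y. y \<in> K \<Longrightarrow> norm y \<le> R"
    using compact_imp_bounded[OF \<open>compact K\<close>] bounded_pos by blast
  show ?thesis
  proof
    fix x
    obtain y where y: "y \<in> K" "x = minkowski_functional K x *\<^sub>R y" using minkowski_attained[of x] by blast
    have "norm x = minkowski_functional K x * norm y"
      using minkowski_attained[of x] by (subst y(2)) simp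
    also have "\<dots> \<le> minkowski_functional K x * R"
      using R(2)[OF y(1)] minkowski_attained[of x] by (intro mult_left_mono) auto
    finally show "norm x \<le> R * minkowski_functional K x" by (simp add: mult.commute)
    show "minkowski_functional K x \<le> norm x / r"
    proof (cases "x = 0")
      case False
      have "(r / norm x) *\<^sub>R x \<in> K" using r False by (intro subsetD[OF r(2)]) simp
      from minkowski_le[OF _ this, of "norm x / r"] False r show ?thesis by simp
    qed (simp add: minkowski_zero)
  qed (use r R in auto)
qed

lemma minkowski_pos: "x \<noteq> 0 \<Longrightarrow> minkowski_functional K x > 0"
  using minkowski_norm_equiv minkowski_attained[of x]
  by (metis less_eq_real_def mult_zero_right norm_le_zero_iff)

lemma minkowski_continuous: assumes "x \<noteq> 0" shows "isCont (minkowski_functional K) x"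
proof -
  have c0: "continuous_on (sphere 0 1) (\<lambda>x. inverse (minkowski_functional K x))"
    using K by (simp add: symmetric_star_body_def)
  have "inverse (minkowski_functional K x) \<noteq> 0" if "x \<in> sphere 0 1" for x
    using minkowski_pos[of x] that by force
  with continuous_on_inverse[OF c0] have c: "continuous_on (sphere 0 1) (minkowski_functional K)" by simp
  have "continuous_on (- {0}) (\<lambda>x. norm x * minkowski_functional K (inverse (norm x) *\<^sub>R x))"
    by (intro continuous_intros continuous_on_compose2[OF c]) (auto simp: field_simps split: if_splits)
  also have "?this \<longleftrightarrow> continuous_on (- {0}) (minkowski_functional K)"
    by (intro continuous_on_cong refl) (simp add: minkowski_scale)
  finally show ?thesis using assms by (simp add: continuous_on_eq_continuous_at open_Compl)
qed

lemma homogeneous_log_minkowski: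
  obtains B where "homogeneous_log (\<lambda>x. ln (minkowski_functional K x)) B"
proof -
  let ?N = "minkowski_functional K"
  obtain r R where rR: "0 < r" "0 < R" "\<And>x. norm x \<le> R * ?N x" "\<And>x. ?N x \<le> norm x / r"
    by (rule minkowski_norm_equiv) blast
  have cont: "isCont (\<lambda>x. ln (?N x)) x" if "x \<noteq> 0" for x
    using minkowski_continuous[OF that] minkowski_pos[OF that] by (intro continuous_intros) auto
  have "homogeneous_log (\<lambda>x. ln (?N x)) (max (ln R) (- ln r))"
  proof
    have "(\<lambda>x. indicator (- {0}) x *\<^sub>R ln (?N x)) \<in> borel_measurable borel"
      using cont by (intro borel_measurable_continuous_on_indicator continuous_at_imp_continuous_on) auto
    also have "(\<lambda>x. indicator (- {0}) x *\<^sub>R ln (?N x)) = (\<lambda>x. ln (?N x))"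
    proof
      show "indicator (- {0}) x *\<^sub>R ln (?N x) = ln (?N x)" for x
        by (cases "x = 0") (simp_all add: minkowski_zero)
    qed
    finally show "(\<lambda>x. ln (?N x)) \<in> borel_measurable borel" .
    fix x :: 'a assume x: "x \<noteq> 0"
    have p: "?N x > 0" by (rule minkowski_pos[OF x])
    have "ln (norm x) \<le> ln (R * ?N x)" using rR(3)[of x] x p rR(2) by (intro ln_mono) auto
    moreover have "ln (?N x) \<le> ln (norm x / r)" using rR(4)[of x] x p rR(1) by (intro ln_mono) auto
    ultimately show "\<bar>ln (?N x) - ln (norm x)\<bar> \<le> max (ln R) (- ln r)"
      using rR(1,2) p x by (simp add: ln_mult ln_div)
  next
    fix c :: real and x :: 'a assume "c > 0" "x \<noteq> 0"
    then show "ln (?N (c *\<^sub>R x)) = ln c + ln (?N x)"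
      using minkowski_pos[of x] by (simp add: minkowski_scale ln_mult)
  qed (use cont minkowski_even in auto)
  then show ?thesis by (rule that)
qed

end

section \<open>A smooth bump\<close>

text \<open>
  The powers of \<open>t\<close> in the denominator make the span of these functions closed under differentiation
  (\<open>flat_exp_deriv\<close>).
\<close>
definition flat_exp :: "nat \<Rightarrow> real \<Rightarrow> real" where
  "flat_exp k t = (if t \<le> 0 then 0 else exp (- 1 / t) / t ^ k)"

lemma flat_exp_nonneg: "0 \<le> flat_exp k t"
  by (simp add: flat_exp_def)

lemma flat_exp_le: "\<bar>flat_exp k t\<bar> \<le> fact (k + 2) * t\<^sup>2"
proof (cases "t \<le> 0")
  case False
  then have t: "t > 0" by simp
  have "(1 / t) ^ (k + 2) \<le> fact (k + 2) * exp (1 / t)"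
    by (rule power_le_fact_exp) (use t in auto)
  then have "exp (- 1 / t) * (1 / t) ^ (k + 2) \<le> fact (k + 2) * (exp (- 1 / t) * exp (1 / t))"
    using mult_left_mono[of "(1 / t) ^ (k + 2)" "fact (k + 2) * exp (1 / t)" "exp (- 1 / t)"]
    by (simp only: exp_ge_zero mult.left_commute)
  also have "exp (- 1 / t) * exp (1 / t) = 1" by (simp flip: exp_add)
  finally have "exp (- 1 / t) * (1 / t) ^ (k + 2) * t\<^sup>2 \<le> fact (k + 2) * t\<^sup>2"
    by (intro mult_right_mono) auto
  then show ?thesis using t by (simp add: flat_exp_def power_divide power_add power2_eq_square field_simps)
qed (simp add: flat_exp_def)

lemma flat_exp_deriv:
  "(flat_exp k has_real_derivative (flat_exp (k + 2) t - real k * flat_exp (k + 1) t)) (at t)"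
proof (cases t "0::real" rule: linorder_cases)
  case less
  have "((\<lambda>t. 0) has_real_derivative 0) (at t)" by simp
  then have "(flat_exp k has_real_derivative 0) (at t)"
    by (rule has_field_derivative_transform_within_open[of _ _ _ "{..<0}"]) (use less in \<open>auto simp: flat_exp_def\<close>)
  then show ?thesis using less by (simp add: flat_exp_def)
next
  case equal
  have "((\<lambda>h. flat_exp k h / h) \<longlongrightarrow> 0) (at 0)"
  proof (rule Lim_null_comparison)
    show "\<forall>\<^sub>F h in at 0. norm (flat_exp k h / h) \<le> fact (k + 2) * \<bar>h\<bar>"
    proof (rule always_eventually, rule allI)
      fix h :: real
      show "norm (flat_exp k h / h) \<le> fact (k + 2) * \<bar>h\<bar>"
      proof (cases "h = 0")
        case False
        have "\<bar>flat_exp k h\<bar> / \<bar>h\<bar> \<le> fact (k + 2) * h\<^sup>2 / \<bar>h\<bar>"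
          by (intro divide_right_mono flat_exp_le) simp
        also have "fact (k + 2) * h\<^sup>2 / \<bar>h\<bar> = fact (k + 2) * \<bar>h\<bar>"
          using False by (cases "h > 0") (auto simp: power2_eq_square)
        finally show ?thesis by simp
      qed simp
    qed
    show "((\<lambda>h. fact (k + 2) * \<bar>h\<bar>) \<longlongrightarrow> 0) (at (0::real))"
      by (auto intro!: tendsto_eq_intros)
  qed
  then show ?thesis using equal by (simp add: DERIV_def flat_exp_def)
next
  case greater
  have "((\<lambda>t. exp (- 1 / t) / t ^ k) has_real_derivative (exp (- 1 / t) / t ^ (k + 2) - real k * (exp (- 1 / t) / t ^ (k + 1)))) (at t)"
  proof -
    have e: "((\<lambda>t. exp (- 1 / t)) has_real_derivative exp (- 1 / t) / t\<^sup>2) (at t)"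
      using greater by (auto intro!: derivative_eq_intros simp: power2_eq_square)
    have p: "((\<lambda>t. t ^ k) has_real_derivative real k * t ^ (k - 1)) (at t)"
      using DERIV_pow[of k t UNIV] by simp
    show ?thesis
      by (rule DERIV_cong[OF DERIV_divide[OF e p]]) (use greater in \<open>cases k; simp add: field_simps power2_eq_square\<close>)+
  qed
  then have "(flat_exp k has_real_derivative (exp (- 1 / t) / t ^ (k + 2) - real k * (exp (- 1 / t) / t ^ (k + 1)))) (at t)"
    by (rule has_field_derivative_transform_within_open[of _ _ _ "{0<..}"]) (use greater in \<open>auto simp: flat_exp_def\<close>)
  then show ?thesis using greater by (simp add: flat_exp_def)
qed

text \<open>
  Sums of polynomials in \<open>y - z\<close> times \<open>flat_exp k (1 - a * (norm (y - z))\<^sup>2)\<close>. The space contains the bump and is closed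
  under partial derivatives (\<open>bump_span_derivative\<close>); for \<open>a > 0\<close> its members vanish outside a ball.
\<close>
inductive_set bump_span :: "real \<Rightarrow> 'a::euclidean_space \<Rightarrow> ('a \<Rightarrow> complex) set"
  for a :: real and z :: 'a where
  base: "(\<lambda>y. complex_of_real (flat_exp k (1 - a * (norm (y - z))\<^sup>2))) \<in> bump_span a z"
| coord: "g \<in> bump_span a z \<Longrightarrow> (\<lambda>y. complex_of_real ((y - z) \<bullet> b) * g y) \<in> bump_span a z"
| scale: "g \<in> bump_span a z \<Longrightarrow> (\<lambda>y. complex_of_real c * g y) \<in> bump_span a z"
| add: "g \<in> bump_span a z \<Longrightarrow> h \<in> bump_span a z \<Longrightarrow> (\<lambda>y. g y + h y) \<in> bump_span a z"

lemma bump_span_derivative: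
  assumes "g \<in> bump_span a z"
  shows "\<exists>g'. (\<forall>y. (g has_derivative g' y) (at y)) \<and> (\<forall>b. (\<lambda>y. g' y b) \<in> bump_span a z)"
  using assms
proof induction
  case (base k)
  let ?t = "\<lambda>y. 1 - a * (norm (y - z))\<^sup>2"
  let ?d = "\<lambda>y. flat_exp (k + 2) (?t y) - real k * flat_exp (k + 1) (?t y)"
  let ?g' = "\<lambda>y h. complex_of_real (?d y * (- 2 * a * ((y - z) \<bullet> h)))"
  have "((\<lambda>y. complex_of_real (flat_exp k (?t y))) has_derivative ?g' y) (at y)" for y
  proof -
    have "(?t has_derivative (\<lambda>h. - 2 * a * ((y - z) \<bullet> h))) (at y)"
      unfolding power2_norm_eq_inner by (auto intro!: derivative_eq_intros simp: inner_commute)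
    from has_derivative_compose[OF this flat_exp_deriv[unfolded has_field_derivative_def, of k "?t y"]]
    show ?thesis by (intro has_derivative_of_real) (simp add: mult.commute)
  qed
  moreover have "(\<lambda>y. ?g' y b) \<in> bump_span a z" for b
  proof -
    have "(\<lambda>y. ?g' y b) = (\<lambda>y. complex_of_real (- 2 * a) * (complex_of_real ((y - z) \<bullet> b) *
       (complex_of_real (flat_exp (k + 2) (?t y)) + complex_of_real (- real k) * complex_of_real (flat_exp (k + 1) (?t y)))))"
      by (auto simp: fun_eq_iff algebra_simps)
    moreover have "\<dots> \<in> bump_span a z"
      by (intro bump_span.intros)
    ultimately show ?thesis by (simp only:)
  qed
  ultimately show ?case by (intro exI[of _ ?g']) auto
next
  case (coord g c)
  then obtain g' where g': "\<And>y. (g has_derivative g' y) (at y)" "\<And>b. (\<lambda>y. g' y b) \<in> bump_span a z" by blast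
  let ?h = "\<lambda>y h. complex_of_real ((y - z) \<bullet> c) * g' y h + complex_of_real (h \<bullet> c) * g y"
  have "((\<lambda>y. complex_of_real ((y - z) \<bullet> c) * g y) has_derivative ?h y) (at y)" for y
    by (rule has_derivative_mult[OF _ g'(1)]) (auto intro!: derivative_eq_intros)
  moreover have "(\<lambda>y. ?h y b) \<in> bump_span a z" for b
    by (intro bump_span.intros g' coord)
  ultimately show ?case by (intro exI[of _ ?h]) auto
next
  case (scale g c)
  then obtain g' where g': "\<And>y. (g has_derivative g' y) (at y)" "\<And>b. (\<lambda>y. g' y b) \<in> bump_span a z" by blast
  have "((\<lambda>y. complex_of_real c * g y) has_derivative (\<lambda>h. complex_of_real c * g' y h)) (at y)" for y
    by (rule has_derivative_mult_right[OF g'(1)])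
  moreover have "(\<lambda>y. complex_of_real c * g' y b) \<in> bump_span a z" for b
    by (intro bump_span.intros g')
  ultimately show ?case by (intro exI[of _ "\<lambda>y h. complex_of_real c * g' y h"]) auto
next
  case (add g h)
  then obtain g' h' where g': "\<And>y. (g has_derivative g' y) (at y)" "\<And>b. (\<lambda>y. g' y b) \<in> bump_span a z"
    and h': "\<And>y. (h has_derivative h' y) (at y)" "\<And>b. (\<lambda>y. h' y b) \<in> bump_span a z" by metis
  have "((\<lambda>y. g y + h y) has_derivative (\<lambda>x. g' y x + h' y x)) (at y)" for y
    by (rule has_derivative_add[OF g'(1) h'(1)])
  moreover have "(\<lambda>y. g' y b + h' y b) \<in> bump_span a z" for b
    by (intro bump_span.intros g' h')
  ultimately show ?case by (intro exI[of _ "\<lambda>y x. g' y x + h' y x"]) auto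
qed

lemma bump_span_iter_deriv: "g \<in> bump_span a z \<Longrightarrow> iter_deriv bs g \<in> bump_span a z"
proof (induction bs)
  case (Cons b bs)
  then obtain g' where g': "\<And>y. (iter_deriv bs g has_derivative g' y) (at y)" "\<And>b. (\<lambda>y. g' y b) \<in> bump_span a z"
    using bump_span_derivative by blast
  have "iter_deriv (b # bs) g = (\<lambda>y. g' y b)"
    using frechet_derivative_at[OF g'(1)] by (auto simp: fun_eq_iff)
  then show ?case using g'(2) by simp
qed simp

lemma bump_span_support: "g \<in> bump_span a z \<Longrightarrow> 1 \<le> a * (norm (y - z))\<^sup>2 \<Longrightarrow> g y = 0"
  by (induction rule: bump_span.induct) (auto simp: flat_exp_def)

lemma schwartz_bump:
  assumes a: "a > 0" and g: "g \<in> bump_span a z"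
  shows "schwartz g"
proof -
  have "bounded (range (\<lambda>y. norm y ^ k *\<^sub>R h y))" if h: "h \<in> bump_span a z" for h k
  proof -
    have diff: "h differentiable (at y)" for y
      using bump_span_derivative[OF h] unfolding differentiable_def by blast
    have "continuous_on UNIV h"
      using diff differentiable_imp_continuous_within by (intro continuous_at_imp_continuous_on) blast
    then have "continuous_on (cball z (1 / sqrt a)) (\<lambda>y. norm y ^ k *\<^sub>R h y)"
      by (intro continuous_intros) (auto intro: continuous_on_subset)
    then have b: "bounded ((\<lambda>y. norm y ^ k *\<^sub>R h y) ` cball z (1 / sqrt a))"
      by (intro compact_imp_bounded compact_continuous_image compact_cball)
    have "h y = 0" if "y \<notin> cball z (1 / sqrt a)" for y
    proof (rule bump_span_support[OF h])
      have "1 / sqrt a \<le> norm (y - z)" using that by (simp add: dist_norm norm_minus_commute)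
      then have "(1 / sqrt a)\<^sup>2 \<le> (norm (y - z))\<^sup>2" using a by (intro power_mono) auto
      then show "1 \<le> a * (norm (y - z))\<^sup>2" using a by (simp add: power_divide field_simps)
    qed
    then have "range (\<lambda>y. norm y ^ k *\<^sub>R h y) \<subseteq> insert 0 ((\<lambda>y. norm y ^ k *\<^sub>R h y) ` cball z (1 / sqrt a))"
      by (smt (verit) image_subset_iff insertCI scaleR_zero_right imageI)
    then show ?thesis using b by (meson bounded_insert bounded_subset)
  qed
  moreover have "h differentiable (at y)" if "h \<in> bump_span a z" for h y
    using bump_span_derivative[OF that] unfolding differentiable_def by blast
  ultimately show ?thesis
    unfolding schwartz_def using bump_span_iter_deriv[OF g] by blast
qed

definition bump :: "real \<Rightarrow> 'a::euclidean_space \<Rightarrow> 'a \<Rightarrow> complex" where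
  "bump \<delta> z y = complex_of_real (flat_exp 0 (1 - (norm (y - z) / \<delta>)\<^sup>2))"

lemma bump_schwartz: "\<delta> > 0 \<Longrightarrow> schwartz (bump \<delta> z)"
proof -
  assume \<delta>: "\<delta> > 0"
  have "bump \<delta> z = (\<lambda>y. complex_of_real (flat_exp 0 (1 - (1 / \<delta>\<^sup>2) * (norm (y - z))\<^sup>2)))"
    by (simp add: bump_def fun_eq_iff power_divide)
  moreover have "schwartz \<dots>"
    by (rule schwartz_bump[OF _ bump_span.base]) (use \<delta> in simp)
  ultimately show ?thesis by (simp only:)
qed

lemma bump_nonneg: "bump \<delta> z y \<in> \<real>\<^sub>\<ge>\<^sub>0"
  by (simp add: bump_def flat_exp_nonneg)

lemma bump_support:
  assumes \<delta>: "\<delta> > 0"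
  shows "closure {y. bump \<delta> z y \<noteq> 0} \<subseteq> cball z \<delta>"
proof (rule closure_minimal)
  show "{y. bump \<delta> z y \<noteq> 0} \<subseteq> cball z \<delta>"
  proof (rule subsetI, rule ccontr)
    fix y assume "y \<in> {y. bump \<delta> z y \<noteq> 0}" "y \<notin> cball z \<delta>"
    then have "1 \<le> norm (y - z) / \<delta>" using \<delta> by (simp add: dist_norm norm_minus_commute)
    then have "1 \<le> (norm (y - z) / \<delta>)\<^sup>2" by (simp add: one_le_power)
    then show False using \<open>y \<in> {y. bump \<delta> z y \<noteq> 0}\<close> by (simp add: bump_def flat_exp_def)
  qed
qed simp

text \<open>
  Translations become characters and dilations become dilations. This is how pairing the transform of \<open>f\<close>
  with a bump around \<open>z\<close> turns into the transform of \<open>f\<close> times a fixed window, evaluated at \<open>z\<close>.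
\<close>
lemma fourier_bump:
  fixes z :: "'a::euclidean_space"
  assumes \<delta>: "\<delta> > 0"
  shows "fourier (bump \<delta> z) x = complex_of_real (\<delta> ^ DIM('a)) * (exp (- \<i> * complex_of_real (x \<bullet> z)) * fourier (bump 1 0) (\<delta> *\<^sub>R x))"
proof -
  have m: "bump \<delta> z \<in> borel_measurable borel" by (intro schwartz_borel_measurable bump_schwartz \<delta>)
  have "fourier (bump \<delta> z) x = \<bar>\<delta>\<bar> ^ DIM('a) *\<^sub>R (LBINT y. bump \<delta> z (z + \<delta> *\<^sub>R y) * exp (- \<i> * complex_of_real ((z + \<delta> *\<^sub>R y) \<bullet> x)))"
    unfolding fourier_def using \<delta> m by (intro lborel_integral_affine(2)) auto
  also have "(\<lambda>y. bump \<delta> z (z + \<delta> *\<^sub>R y) * exp (- \<i> * complex_of_real ((z + \<delta> *\<^sub>R y) \<bullet> x)))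
     = (\<lambda>y. exp (- \<i> * complex_of_real (x \<bullet> z)) * (bump 1 0 y * exp (- \<i> * complex_of_real (y \<bullet> (\<delta> *\<^sub>R x)))))"
    using \<delta> by (auto simp: bump_def fun_eq_iff inner_add_left exp_add[symmetric] algebra_simps inner_commute)
  finally show ?thesis
    using \<delta> unfolding fourier_def by (simp add: scaleR_conv_of_real)
qed

lemma bump_mass_pos:
  obtains c where "c > 0" "fourier (bump 1 0) (0::'a::euclidean_space) = complex_of_real c"
proof
  let ?b = "\<lambda>y::'a. flat_exp 0 (1 - (norm y)\<^sup>2)"
  have eq: "bump 1 (0::'a) = (\<lambda>y. complex_of_real (?b y))" by (simp add: bump_def fun_eq_iff)
  have i: "integrable lborel ?b"
    using integrable_Re[OF schwartz_integrable[OF bump_schwartz[of 1 "0::'a"]]] unfolding eq by simp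
  show "fourier (bump 1 0) (0::'a) = complex_of_real (LBINT y. ?b y)"
    unfolding fourier_def eq by simp
  have "0 < exp (- 4 / 3) * measure lborel (cball (0::'a) (1/2))"
    using content_cball_pos[of "1/2" "0::'a"] by simp
  also have "\<dots> = (LBINT y. exp (- 4 / 3) * indicator (cball (0::'a) (1/2)) y)"
    by (simp add: lmeasurable_cball)
  also have "\<dots> \<le> (LBINT y. ?b y)"
  proof (rule integral_mono[OF _ i])
    show "integrable lborel (\<lambda>y. exp (- 4 / 3) * indicat_real (cball (0::'a) (1/2)) y)"
      by (intro integrable_mult_right integrable_real_indicator) (auto simp: emeasure_lborel_cball_finite[simplified])
    fix y :: 'a
    have "exp (- 4 / 3) \<le> ?b y" if "norm y \<le> 1/2"
    proof -
      have "(norm y)\<^sup>2 \<le> (1/2)\<^sup>2" using that by (intro power_mono) auto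
      then have s: "3/4 \<le> 1 - (norm y)\<^sup>2" by (simp add: power2_eq_square)
      then have "1 / (1 - (norm y)\<^sup>2) \<le> 1 / (3/4)" by (intro divide_left_mono) auto
      then show ?thesis using s by (simp add: flat_exp_def)
    qed
    then show "exp (- 4 / 3) * indicat_real (cball 0 (1/2)) y \<le> ?b y"
      by (auto simp: indicator_def flat_exp_nonneg)
  qed
  finally show "(LBINT y. ?b y) > 0" .
qed

section \<open>Gaussian averages\<close>
lemma gaussian_total: "(LBINT z. std_gauss (z::'a::euclidean_space)) = sqrt (2 * pi) ^ DIM('a)"
proof -
  have "(LBINT z. complex_of_real (std_gauss (z::'a))) = complex_of_real (sqrt (2 * pi) ^ DIM('a))"
    using gaussian_fourier[of 1 "0::'a"] by simp
  then show ?thesis by (metis integral_complex_of_real of_real_eq_iff)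
qed

lemma shifted_gaussian_le:
  fixes w x :: "'a::real_inner"
  assumes "t > 0"
  shows "heat t x w \<le> exp ((norm x)\<^sup>2 / (2 * t)) * gauss (1 / (2 * t)) w"
proof -
  have "norm w \<le> norm (w - x) + norm x" by (metis diff_add_cancel norm_triangle_ineq)
  then have "(norm w)\<^sup>2 \<le> (norm (w - x) + norm x)\<^sup>2" by (intro power_mono) auto
  also have "\<dots> \<le> 2 * (norm (w - x))\<^sup>2 + 2 * (norm x)\<^sup>2"
    using sum_squares_bound[of "norm (w - x)" "norm x"] by (simp add: power2_sum)
  finally have "- (norm (w - x))\<^sup>2 / (2 * t) \<le> (norm x)\<^sup>2 / (2 * t) - (1 / (2 * t)) * (norm w)\<^sup>2 / 2"
    using assms by (simp add: field_simps)
  then show ?thesis by (simp flip: exp_add)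
qed

lemma tendsto_at_right_0_sequentially:
  fixes g :: "real \<Rightarrow> real"
  assumes "\<And>h. (\<And>n. 0 < h n) \<Longrightarrow> (\<And>n. h n \<le> 1) \<Longrightarrow> h \<longlonglongrightarrow> 0 \<Longrightarrow> (\<lambda>n. g (h n)) \<longlonglongrightarrow> L"
  shows "(g \<longlongrightarrow> L) (at_right 0)"
proof (rule tendsto_at_right_sequentially[of 0 1])
  fix S :: "nat \<Rightarrow> real"
  assume "\<And>n. 0 < S n" "\<And>n. S n < 1" "decseq S" "S \<longlonglongrightarrow> 0"
  then show "(\<lambda>n. g (S n)) \<longlonglongrightarrow> L" by (intro assms) (auto intro: less_imp_le)
qed simp

context homogeneous_log
begin

text \<open>The average \<open>E f (x + \<surd>t Z)\<close> over a standard Gaussian vector \<open>Z\<close>.\<close>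
definition smoothed :: "'a \<Rightarrow> real \<Rightarrow> real" where
  "smoothed x t = (LBINT z. std_gauss z * f (x + sqrt t *\<^sub>R z)) / sqrt (2 * pi) ^ DIM('a)"

lemma heat_kernel_integrable:
  assumes t: "t > 0"
  shows "integrable lborel (\<lambda>w. f w * heat t x w)"
proof -
  obtain C where C: "C \<ge> 0" "\<And>w::'a. gauss (1 / (2 * t)) w \<le> C / (1 + norm w) ^ (2 * DIM('a) + 1)"
    using gaussian_decay[of "1 / (2 * t)" "2 * DIM('a) + 1", where 'a='a] t by (metis divide_pos_pos mult_pos_pos zero_less_numeral zero_less_one)
  have "integrable lborel (\<lambda>w. f w *\<^sub>R heat t x w)"
  proof (rule integrable_f_decay)
    fix w
    have "heat t x w \<le> exp ((norm x)\<^sup>2 / (2 * t)) * (C / (1 + norm w) ^ (2 * DIM('a) + 1))"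
      by (rule order_trans[OF shifted_gaussian_le[OF t] mult_left_mono[OF C(2)]]) simp
    then show "norm (heat t x w) \<le> exp ((norm x)\<^sup>2 / (2 * t)) * C / (1 + norm w) ^ (2 * DIM('a) + 1)"
      by simp
  qed measurable
  then show ?thesis by simp
qed

lemma gauss_f_integrable:
  assumes t: "t > 0"
  shows "integrable lborel (\<lambda>z. std_gauss z * f (x + sqrt t *\<^sub>R z))"
proof -
  have "integrable lborel (\<lambda>z. f (x + sqrt t *\<^sub>R z) * exp (- (norm ((x + sqrt t *\<^sub>R z) - x))\<^sup>2 / (2 * t)))"
    using heat_kernel_integrable[OF t, of x] t
    by (subst (asm) lborel_integral_affine(1)[where c="sqrt t" and t=x]) auto
  then show ?thesis using t by (simp add: power_mult_distrib mult.commute)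
qed

lemma smoothed_heat_kernel:
  assumes t: "t > 0"
  shows "smoothed x t = (LBINT w. f w * heat t x w) / sqrt (2 * pi * t) ^ DIM('a)"
proof -
  have "(LBINT w. heat t x w *\<^sub>R f w)
    = sqrt t ^ DIM('a) *\<^sub>R (LBINT z. std_gauss z *\<^sub>R f (x + sqrt t *\<^sub>R z))"
    by (rule gaussian_average[OF t f_measurable])
  then show ?thesis
    using t by (simp add: smoothed_def real_sqrt_mult power_mult_distrib mult.commute)
qed

lemma smoothed_scale:
  assumes t: "t > 0"
  shows "smoothed x t = ln (sqrt t) + smoothed (x /\<^sub>R sqrt t) 1"
proof -
  let ?s = "sqrt t"
  have s: "?s > 0" using t by simp
  have nz: "AE z in lborel. z \<noteq> - (x /\<^sub>R ?s)" by (rule AE_lborel_singleton)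
  have "(LBINT z. std_gauss z * f (x + ?s *\<^sub>R z))
    = (LBINT z. std_gauss z * ln ?s + std_gauss z * f (x /\<^sub>R ?s + sqrt 1 *\<^sub>R z))"
  proof (rule integral_cong_AE)
    show "AE z in lborel. std_gauss z * f (x + ?s *\<^sub>R z)
       = std_gauss z * ln ?s + std_gauss z * f (x /\<^sub>R ?s + sqrt 1 *\<^sub>R z)"
      using nz
    proof eventually_elim
      case (elim z)
      have "x /\<^sub>R ?s + z \<noteq> 0" using elim by (metis add.commute add.inverse_unique)
      from f_scale[OF s this] have "f (x + ?s *\<^sub>R z) = ln ?s + f (x /\<^sub>R ?s + z)"
        using s by (simp add: scaleR_add_right)
      then show ?case by (simp add: algebra_simps)
    qed
  qed measurable
  also have "\<dots> = (LBINT z. std_gauss (z::'a) * ln ?s) + (LBINT z. std_gauss z * f (x /\<^sub>R ?s + sqrt 1 *\<^sub>R z))"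
    using integrable_gaussian[of 1, where 'a='a] gauss_f_integrable[of 1 "x /\<^sub>R ?s"]
    by (intro Bochner_Integration.integral_add) auto
  also have "(LBINT z. std_gauss (z::'a) * ln ?s) = sqrt (2 * pi) ^ DIM('a) * ln ?s"
    by (subst integral_mult_left_zero) (simp only: gaussian_total)
  finally show ?thesis unfolding smoothed_def by (simp add: add_divide_distrib)
qed

lemma smoothed_even: "t > 0 \<Longrightarrow> smoothed (- x) t = smoothed x t"
proof -
  assume t: "t > 0"
  have "(LBINT z. std_gauss z * f (- x + sqrt t *\<^sub>R z))
      = (LBINT z. std_gauss (- z) * f (- x + sqrt t *\<^sub>R (- z)))"
    by (subst lborel_integral_affine(2)[where c="-1" and t=0]) auto
  also have "\<dots> = (LBINT z. std_gauss z * f (x + sqrt t *\<^sub>R z))"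
    using f_even[of "x + sqrt t *\<^sub>R _"] by simp
  finally show ?thesis by (simp add: smoothed_def)
qed

lemma smoothed_continuous: "isCont (\<lambda>x. smoothed x 1) x"
  unfolding continuous_at_sequentially
proof (intro allI impI)
  fix y :: "nat \<Rightarrow> 'a" assume y: "y \<longlonglongrightarrow> x"
  then obtain R where R: "\<And>n. norm (y n) \<le> R"
    by (meson BseqE convergent_imp_Bseq convergentI)
  then have R0: "0 \<le> R" by (meson norm_ge_zero order_trans)
  have "(\<lambda>n. LINT w|lborel. f w * heat 1 (y n) w) \<longlonglongrightarrow> (LBINT w. f w * heat 1 x w)"
  proof (rule integral_dominated_convergence[where w="\<lambda>w. exp (R\<^sup>2 / 2) * \<bar>f w * heat 2 0 w\<bar>"])
    show "integrable lborel (\<lambda>w. exp (R\<^sup>2 / 2) * \<bar>f w * heat 2 0 w\<bar>)"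
      by (intro integrable_mult_right integrable_abs heat_kernel_integrable) simp
    show "AE w in lborel. (\<lambda>n. f w * heat 1 (y n) w) \<longlonglongrightarrow> f w * heat 1 x w"
      by (intro AE_I2 tendsto_intros y) simp
    show "AE w in lborel. norm (f w * heat 1 (y n) w) \<le> exp (R\<^sup>2 / 2) * \<bar>f w * heat 2 0 w\<bar>" for n
    proof (rule AE_I2)
      fix w
      have "heat 1 (y n) w \<le> exp ((norm (y n))\<^sup>2 / (2 * 1)) * gauss (1 / (2 * 1)) w"
        by (rule shifted_gaussian_le) simp
      also have "\<dots> \<le> exp (R\<^sup>2 / 2) * heat 2 0 w"
        using power_mono[OF R norm_ge_zero, of n 2] by (intro mult_mono) auto
      finally have "\<bar>f w\<bar> * heat 1 (y n) w \<le> \<bar>f w\<bar> * (exp (R\<^sup>2 / 2) * heat 2 0 w)"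
        by (rule mult_left_mono) simp
      then show "norm (f w * heat 1 (y n) w) \<le> exp (R\<^sup>2 / 2) * \<bar>f w * heat 2 0 w\<bar>"
        by (simp add: abs_mult mult_ac)
    qed
  qed measurable
  then show "((\<lambda>x. smoothed x 1) \<circ> y) \<longlonglongrightarrow> smoothed x 1"
    unfolding o_def smoothed_heat_kernel[OF zero_less_one] by (intro tendsto_divide tendsto_const) auto
qed

lemma integrable_f_ball: "integrable lborel (\<lambda>w. indicator (ball 0 \<rho>) w * f w)"
proof (rule Bochner_Integration.integrable_bound)
  show "integrable lborel (\<lambda>w. exp (\<rho>\<^sup>2 / 2) * (f w * heat 1 0 w))"
    by (intro integrable_mult_right heat_kernel_integrable) simp
  show "AE w in lborel. norm (indicator (ball 0 \<rho>) w * f w) \<le> norm (exp (\<rho>\<^sup>2 / 2) * (f w * heat 1 0 w))"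
  proof (rule AE_I2)
    fix w :: 'a
    show "norm (indicator (ball 0 \<rho>) w * f w) \<le> norm (exp (\<rho>\<^sup>2 / 2) * (f w * heat 1 0 w))"
    proof (cases "norm w < \<rho>")
      case True
      then have "(norm w)\<^sup>2 \<le> \<rho>\<^sup>2" by (intro power_mono) auto
      then have "1 \<le> exp (\<rho>\<^sup>2 / 2) * std_gauss w" by (simp flip: exp_add)
      from mult_right_mono[OF this abs_ge_zero[of "f w"]] show ?thesis
        by (simp add: abs_mult mult_ac True)
    qed (simp add: indicator_def)
  qed
  show "(\<lambda>w. indicator (ball 0 \<rho>) w * f w) \<in> borel_measurable lborel"
    by (intro borel_measurable_times borel_measurable_indicator) auto
qed

text \<open>
  Split \<open>f\<close> at the sphere of radius \<open>\<rho> = norm x / 2\<close>. Outside, \<open>f\<close> grows at most linearly and dominated convergence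
  applies. Inside, \<open>f\<close> is integrable and the Gaussian density around \<open>x\<close> tends to \<open>0\<close> uniformly, which
  disposes of the singularity at the origin.
\<close>
lemma smoothed_tendsto:
  assumes x: "x \<noteq> 0"
  shows "((\<lambda>t. smoothed x t) \<longlongrightarrow> f x) (at_right 0)"
proof (rule tendsto_at_right_0_sequentially)
  fix h :: "nat \<Rightarrow> real"
  assume h: "\<And>n. 0 < h n" "\<And>n. h n \<le> 1" and h0: "h \<longlonglongrightarrow> 0"
  define \<rho> where "\<rho> = norm x / 2"
  have \<rho>: "\<rho> > 0" using x by (simp add: \<rho>_def)
  let ?S = "sqrt (2 * pi) ^ DIM('a)"
  have S: "?S > 0" by simp
  define f1 where "f1 w = indicator (ball 0 \<rho>) w * f w" for w
  define f2 where "f2 w = indicator (- ball 0 \<rho>) w * f w" for w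
  have f12: "f w = f1 w + f2 w" for w by (simp add: f1_def f2_def indicator_def)
  have [measurable]: "f1 \<in> borel_measurable borel" "f2 \<in> borel_measurable borel"
    unfolding f1_def[abs_def] f2_def[abs_def] by (intro borel_measurable_times borel_measurable_indicator; auto)+
  define D where "D = \<bar>ln \<rho>\<bar> + \<bar>B\<bar>"
  have f2b: "\<bar>f2 w\<bar> \<le> D + norm w" for w
  proof (cases "norm w < \<rho>")
    case False
    then have w: "w \<noteq> 0" "\<rho> \<le> norm w" using \<rho> by auto
    have "ln \<rho> \<le> ln (norm w)" using w \<rho> by (intro ln_mono) auto
    moreover have "ln (norm w) \<le> norm w" using w by (intro ln_bound) auto
    ultimately have "\<bar>ln (norm w)\<bar> \<le> \<bar>ln \<rho>\<bar> + norm w"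
      using norm_ge_zero[of w] by argo
    then show ?thesis using f_log_bound[OF w(1)] False by (auto simp: f2_def D_def indicator_def)
  qed (simp add: f2_def D_def indicator_def add_nonneg_nonneg)
  have f1i: "integrable lborel f1" unfolding f1_def[abs_def] by (rule integrable_f_ball)
  have gi: "integrable lborel (\<lambda>z::'a. std_gauss z)"
    using integrable_gaussian[of 1, where 'a='a] by simp
  have gni: "integrable lborel (\<lambda>z::'a. std_gauss z * norm z)"
  proof -
    obtain C where C: "C \<ge> 0" "\<And>w::'a. gauss 1 w \<le> C / (1 + norm w) ^ (2 * DIM('a) + 1)"
      using gaussian_decay[of 1 "2 * DIM('a) + 1", where 'a='a] by (metis zero_less_one)
    show ?thesis
    proof (rule integrable_decay[where C=C])
      fix z :: 'a
      have "std_gauss z * norm z \<le> C / (1 + norm z) ^ (2 * DIM('a) + 1) * (1 + norm z)"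
        using C(2)[of z] C(1) by (intro mult_mono) auto
      also have "\<dots> = C / (1 + norm z) ^ (2 * DIM('a))"
        by (simp add: field_simps add_nonneg_eq_0_iff)
      finally show "norm (std_gauss z * norm z) \<le> C / (1 + norm z) ^ (2 * DIM('a))" by simp
    qed measurable
  qed
  let ?I1 = "\<lambda>n. LINT z|lborel. std_gauss z * f1 (x + sqrt (h n) *\<^sub>R z)"
  let ?I2 = "\<lambda>n. LINT z|lborel. std_gauss z * f2 (x + sqrt (h n) *\<^sub>R z)"
  let ?w = "\<lambda>z::'a. std_gauss z * (D + norm x) + std_gauss z * norm z"
  have wi: "integrable lborel ?w" using gi gni by simp
  have dom: "norm (std_gauss z * f2 (x + sqrt (h n) *\<^sub>R z)) \<le> ?w z" for n z
  proof -
    have "norm (sqrt (h n) *\<^sub>R z) \<le> 1 * norm z"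
      using h[of n] unfolding norm_scaleR by (intro mult_right_mono) auto
    then have "norm (x + sqrt (h n) *\<^sub>R z) \<le> norm x + norm z"
      using norm_triangle_ineq[of x "sqrt (h n) *\<^sub>R z"] by simp
    then have "\<bar>f2 (x + sqrt (h n) *\<^sub>R z)\<bar> \<le> (D + norm x) + norm z"
      using f2b[of "x + sqrt (h n) *\<^sub>R z"] by simp
    then have "std_gauss z * \<bar>f2 (x + sqrt (h n) *\<^sub>R z)\<bar> \<le> std_gauss z * ((D + norm x) + norm z)"
      by (rule mult_left_mono) simp
    then show ?thesis by (simp add: abs_mult algebra_simps)
  qed
  have i2: "integrable lborel (\<lambda>z. std_gauss z * f2 (x + sqrt (h n) *\<^sub>R z))" for n
  proof (rule Bochner_Integration.integrable_bound[OF wi])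
    show "AE z in lborel. norm (std_gauss z * f2 (x + sqrt (h n) *\<^sub>R z)) \<le> norm (?w z)"
      by (rule AE_I2, rule order_trans[OF dom]) (simp only: real_norm_def abs_ge_self)
  qed measurable
  have "?I2 \<longlonglongrightarrow> (LBINT z. std_gauss (z::'a) * f x)"
  proof (rule integral_dominated_convergence[where w="?w"])
    show "AE z in lborel. (\<lambda>n. std_gauss z * f2 (x + sqrt (h n) *\<^sub>R z)) \<longlonglongrightarrow> std_gauss z * f x"
    proof (intro AE_I2 tendsto_mult tendsto_const)
      fix z
      have "(\<lambda>n. x + sqrt (h n) *\<^sub>R z) \<longlonglongrightarrow> x + sqrt 0 *\<^sub>R z" by (intro tendsto_intros h0)
      then have l: "(\<lambda>n. x + sqrt (h n) *\<^sub>R z) \<longlonglongrightarrow> x" by simp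
      have "(\<lambda>n. f (x + sqrt (h n) *\<^sub>R z)) \<longlonglongrightarrow> f x"
        by (rule isCont_tendsto_compose[OF f_cont[OF x] l])
      moreover have "eventually (\<lambda>n. \<rho> < norm (x + sqrt (h n) *\<^sub>R z)) sequentially"
        using tendsto_norm[OF l] x by (intro order_tendstoD) (auto simp: \<rho>_def)
      then have "eventually (\<lambda>n. f (x + sqrt (h n) *\<^sub>R z) = f2 (x + sqrt (h n) *\<^sub>R z)) sequentially"
        by eventually_elim (simp add: f2_def indicator_def)
      ultimately show "(\<lambda>n. f2 (x + sqrt (h n) *\<^sub>R z)) \<longlonglongrightarrow> f x"
        by (rule Lim_transform_eventually)
    qed
    show "AE z in lborel. norm (std_gauss z * f2 (x + sqrt (h n) *\<^sub>R z)) \<le> ?w z" for n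
      by (rule AE_I2) (rule dom)
  qed (use wi in auto)
  then have L2: "?I2 \<longlonglongrightarrow> ?S * f x" by (simp only: integral_mult_left_zero gaussian_total)
  have L1: "?I1 \<longlonglongrightarrow> 0"
  proof (rule Lim_null_comparison)
    let ?A = "LBINT w. \<bar>f1 w\<bar>"
    show "\<forall>\<^sub>F n in sequentially. norm (?I1 n) \<le> exp (- \<rho>\<^sup>2 / (2 * h n)) / sqrt (h n) ^ DIM('a) * ?A"
    proof (rule always_eventually, rule allI)
      fix n
      have "sqrt (h n) ^ DIM('a) *\<^sub>R ?I1 n = (LBINT w. heat (h n) x w *\<^sub>R f1 w)"
        using gaussian_average[OF h(1), of f1 x n] by simp
      also have "norm \<dots> \<le> (LBINT w. exp (- \<rho>\<^sup>2 / (2 * h n)) * \<bar>f1 w\<bar>)"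
      proof (rule order_trans[OF integral_norm_bound integral_mono'])
        show "integrable lborel (\<lambda>w. exp (- \<rho>\<^sup>2 / (2 * h n)) * \<bar>f1 w\<bar>)" using f1i by simp
        fix w
        show "norm (heat (h n) x w *\<^sub>R f1 w) \<le> exp (- \<rho>\<^sup>2 / (2 * h n)) * \<bar>f1 w\<bar>"
        proof (cases "norm w < \<rho>")
          case True
          have "norm x \<le> norm (w - x) + norm w" by (metis norm_minus_commute norm_triangle_sub add.commute)
          then have "\<rho> \<le> norm (w - x)" using True by (simp add: \<rho>_def)
          then have "\<rho>\<^sup>2 \<le> (norm (w - x))\<^sup>2" using \<rho> by (intro power_mono) auto
          then have "heat (h n) x w \<le> exp (- \<rho>\<^sup>2 / (2 * h n))"
            using h(1)[of n] by (simp add: divide_right_mono)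
          from mult_right_mono[OF this abs_ge_zero[of "f1 w"]] show ?thesis by (simp add: abs_mult)
        qed (simp add: f1_def indicator_def)
      qed auto
      also have "\<dots> = exp (- \<rho>\<^sup>2 / (2 * h n)) * ?A" by simp
      finally have "sqrt (h n) ^ DIM('a) * norm (?I1 n) \<le> exp (- \<rho>\<^sup>2 / (2 * h n)) * ?A"
        using h(1)[of n] by (simp add: abs_mult)
      then show "norm (?I1 n) \<le> exp (- \<rho>\<^sup>2 / (2 * h n)) / sqrt (h n) ^ DIM('a) * ?A"
        using h(1)[of n] by (simp add: field_simps)
    qed
    have "(\<lambda>n. exp (- \<rho>\<^sup>2 / (2 * h n)) / sqrt (h n) ^ DIM('a)) \<longlonglongrightarrow> 0"
    proof -
      have "((\<lambda>y::real. exp (- (\<rho>\<^sup>2 / 2) * y\<^sup>2) * y ^ DIM('a)) \<longlongrightarrow> 0) at_top"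
      proof (rule Lim_null_comparison)
        let ?c = "\<rho>\<^sup>2 / 2"
        have c: "?c > 0" using \<rho> by simp
        show "\<forall>\<^sub>F y in at_top. norm (exp (- ?c * y\<^sup>2) * y ^ DIM('a)) \<le> (fact (DIM('a)) / ?c ^ DIM('a)) * inverse y"
          using eventually_ge_at_top[of 1]
        proof eventually_elim
          case (elim y)
          let ?n = "DIM('a)"
          have n: "?n \<ge> 1" by (simp add: Suc_leI)
          have "(?c * y\<^sup>2) ^ ?n \<le> fact ?n * exp (?c * y\<^sup>2)" by (rule power_le_fact_exp) (use c in auto)
          then have "exp (- ?c * y\<^sup>2) * (?c * y\<^sup>2) ^ ?n \<le> fact ?n"
            by (simp add: exp_minus field_simps)
          then have a: "exp (- ?c * y\<^sup>2) * y ^ ?n * y ^ ?n \<le> fact ?n / ?c ^ ?n"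
          proof -
            have e: "(?c * y\<^sup>2) ^ ?n = y ^ ?n * y ^ ?n * ?c ^ ?n"
              by (simp only: power_mult_distrib power2_eq_square mult_ac)
            have "exp (- ?c * y\<^sup>2) * y ^ ?n * y ^ ?n * ?c ^ ?n \<le> fact ?n"
              using \<open>exp (- ?c * y\<^sup>2) * (?c * y\<^sup>2) ^ ?n \<le> fact ?n\<close> unfolding e by (simp only: mult.assoc)
            then show ?thesis by (simp only: pos_le_divide_eq[OF zero_less_power[OF c]])
          qed
          have "exp (- ?c * y\<^sup>2) * y ^ ?n * y \<le> exp (- ?c * y\<^sup>2) * y ^ ?n * y ^ ?n"
            using elim power_increasing[OF n elim] by (intro mult_left_mono) auto
          then have "exp (- ?c * y\<^sup>2) * y ^ ?n \<le> fact ?n / ?c ^ ?n * inverse y"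
            using order_trans[OF _ a] elim by (simp only: divide_inverse[symmetric] pos_le_divide_eq)
          then show ?case using elim by simp
        qed
        show "((\<lambda>y. (fact (DIM('a)) / ?c ^ DIM('a)) * inverse y) \<longlongrightarrow> 0) at_top"
          by (rule tendsto_mult_right_zero[OF tendsto_inverse_0_at_top[OF filterlim_ident]])
      qed
      moreover have "filterlim (\<lambda>n. inverse (sqrt (h n))) at_top sequentially"
      proof (rule filterlim_inverse_at_top)
        show "(\<lambda>n. sqrt (h n)) \<longlonglongrightarrow> 0" using tendsto_real_sqrt[OF h0] by simp
      qed (use h in auto)
      ultimately have "(\<lambda>n. exp (- (\<rho>\<^sup>2 / 2) * (inverse (sqrt (h n)))\<^sup>2) * (inverse (sqrt (h n))) ^ DIM('a)) \<longlonglongrightarrow> 0"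
        by (rule filterlim_compose)
      moreover have "exp (- (\<rho>\<^sup>2 / 2) * (inverse (sqrt (h n)))\<^sup>2) * (inverse (sqrt (h n))) ^ DIM('a) = exp (- \<rho>\<^sup>2 / (2 * h n)) / sqrt (h n) ^ DIM('a)" for n
      proof -
        have i: "(inverse (sqrt (h n)))\<^sup>2 = inverse (h n)"
          unfolding power2_eq_square inverse_mult_distrib[symmetric] using h(1)[of n] by simp
        have a: "- (\<rho>\<^sup>2 / 2) * inverse (h n) = - \<rho>\<^sup>2 / (2 * h n)"
          using h(1)[of n] by (simp add: field_simps)
        show ?thesis
          unfolding i a by (simp only: power_inverse divide_inverse)
      qed
      ultimately show ?thesis by (simp only:)
    qed
    then show "(\<lambda>n. exp (- \<rho>\<^sup>2 / (2 * h n)) / sqrt (h n) ^ DIM('a) * ?A) \<longlonglongrightarrow> 0"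
      by (rule tendsto_mult_left_zero)
  qed
  have "smoothed x (h n) = (?I1 n + ?I2 n) / ?S" for n
  proof -
    have "integrable lborel (\<lambda>z. std_gauss z * f (x + sqrt (h n) *\<^sub>R z) - std_gauss z * f2 (x + sqrt (h n) *\<^sub>R z))"
      by (intro Bochner_Integration.integrable_diff gauss_f_integrable h i2)
    then have i1: "integrable lborel (\<lambda>z. std_gauss z * f1 (x + sqrt (h n) *\<^sub>R z))"
      unfolding f12 by (simp add: algebra_simps)
    show ?thesis
      unfolding smoothed_def f12 distrib_left by (simp only: Bochner_Integration.integral_add[OF i1 i2])
  qed
  moreover have "(\<lambda>n. (?I1 n + ?I2 n) / ?S) \<longlonglongrightarrow> (0 + ?S * f x) / ?S"
    by (intro tendsto_intros L1 L2) simp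
  ultimately show "(\<lambda>n. smoothed x (h n)) \<longlonglongrightarrow> f x" by simp
qed

end

section \<open>The logarithmic kernel\<close>
lemma one_minus_exp_bounds:
  fixes u :: real
  assumes "0 \<le> u"
  shows "0 \<le> 1 - exp (- u)" "1 - exp (- u) \<le> u" "1 - exp (- u) \<le> 1"
  using assms exp_ge_add_one_self[of "- u"] by auto

lemma one_minus_cos_bounds: "0 \<le> 1 - cos (u::real)" "1 - cos u \<le> 2" "1 - cos u \<le> u\<^sup>2 / 2"
proof -
  show "0 \<le> 1 - cos u" "1 - cos u \<le> 2" using cos_le_one[of u] cos_ge_minus_one[of u] by linarith+
  have "1 - cos u = 2 * (sin (u / 2))\<^sup>2"
    using cos_double_sin[of "u / 2"] by simp
  also have "(sin (u / 2))\<^sup>2 \<le> (u / 2)\<^sup>2"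
    using abs_sin_x_le_abs_x[of "u / 2"] by (simp only: abs_le_square_iff)
  finally show "1 - cos u \<le> u\<^sup>2 / 2" by (simp add: power_divide)
qed

lemma mult_exp_minus_le_one: "0 \<le> u \<Longrightarrow> u * exp (- u) \<le> (1::real)"
proof -
  have "u \<le> exp u" using exp_ge_add_one_self[of u] by linarith
  then show ?thesis by (simp add: exp_minus divide_simps)
qed

text \<open>This bound makes all integrals over the logarithmic variable converge.\<close>
lemma exp_abs_le_inverse_square: "exp (- 2 * \<bar>v\<bar>) \<le> 1 / (1 + v\<^sup>2)" for v :: real
proof -
  have "1 + 2 * \<bar>v\<bar> + (2 * \<bar>v\<bar>)\<^sup>2 / 2 \<le> exp (2 * \<bar>v\<bar>)"
    by (rule exp_lower_Taylor_quadratic) simp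
  then have "1 + v\<^sup>2 \<le> exp (2 * \<bar>v\<bar>)"
  proof -
    assume a: "1 + 2 * \<bar>v\<bar> + (2 * \<bar>v\<bar>)\<^sup>2 / 2 \<le> exp (2 * \<bar>v\<bar>)"
    have "(2 * \<bar>v\<bar>)\<^sup>2 / 2 = 2 * v\<^sup>2" by (simp add: power_mult_distrib)
    then show ?thesis using a zero_le_power2[of v] abs_ge_zero[of v] by argo
  qed
  then show ?thesis by (simp add: exp_minus divide_simps add_pos_nonneg)
qed

text \<open>
  In the variable \<open>r = exp v\<close>, \<open>log_kernel a\<close> is the integral of \<open>(1 - cos (r a)) exp (- r\<^sup>2 / 2)\<close> against \<open>dr / r\<close>.
  It is what integration along a ray makes of the test function \<open>(1 - cos (x \<bullet> y)) std_gauss y\<close>.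
\<close>
definition cos_gauss :: "real \<Rightarrow> real \<Rightarrow> real" where
  "cos_gauss a v = (1 - cos (exp v * a)) * log_gauss v"

definition log_kernel :: "real \<Rightarrow> real" where
  "log_kernel a = (LBINT v. cos_gauss a v)"

lemma cos_gauss_measurable [measurable]:
  "(\<lambda>p. cos_gauss (fst p) (snd p)) \<in> borel_measurable (borel \<Otimes>\<^sub>M borel)"
  "(\<lambda>v. cos_gauss a v) \<in> borel_measurable borel"
  unfolding cos_gauss_def log_gauss_def by measurable

lemma cos_gauss_bound: "0 \<le> cos_gauss a v" "cos_gauss a v \<le> (a\<^sup>2 + 4) * exp (- 2 * \<bar>v\<bar>)"
proof -
  show "0 \<le> cos_gauss a v"
    unfolding cos_gauss_def log_gauss_def using one_minus_cos_bounds(1) by (intro mult_nonneg_nonneg) auto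
  let ?s = "(exp v)\<^sup>2"
  have s: "?s = exp (2 * v)" by (simp add: exp_double)
  show "cos_gauss a v \<le> (a\<^sup>2 + 4) * exp (- 2 * \<bar>v\<bar>)"
  proof (cases "v \<le> 0")
    case True
    have "cos_gauss a v \<le> ((exp v * a)\<^sup>2 / 2) * 1"
      unfolding cos_gauss_def log_gauss_def using one_minus_cos_bounds by (intro mult_mono) auto
    also have "\<dots> = (a\<^sup>2 / 2) * exp (2 * v)" by (simp only: power_mult_distrib s) simp
    also have "\<dots> \<le> (a\<^sup>2 + 4) * exp (2 * v)" by (intro mult_right_mono) auto
    finally show ?thesis using True by simp
  next
    case False
    have "?s / 2 * exp (- (?s / 2)) \<le> 1" by (rule mult_exp_minus_le_one) simp
    then have "exp (- (?s / 2)) \<le> 2 * exp (- 2 * v)" by (simp add: s exp_minus field_simps)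
    then have "log_gauss v \<le> 2 * exp (- 2 * v)" by (simp add: log_gauss_def)
    then have "cos_gauss a v \<le> 2 * (2 * exp (- 2 * v))"
      unfolding cos_gauss_def using one_minus_cos_bounds by (intro mult_mono) (auto simp: log_gauss_def)
    also have "\<dots> \<le> (a\<^sup>2 + 4) * exp (- 2 * v)" by (simp add: algebra_simps)
    finally show ?thesis using False by simp
  qed
qed

lemma cos_gauss_integrable: "integrable lborel (cos_gauss a)"
proof (rule Bochner_Integration.integrable_bound)
  show "integrable lborel (\<lambda>v. (a\<^sup>2 + 4) * (1 / (1 + v\<^sup>2)))"
    by (intro integrable_mult_right integrable_inverse_square)
  show "AE v in lborel. norm (cos_gauss a v) \<le> norm ((a\<^sup>2 + 4) * (1 / (1 + v\<^sup>2)))"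
  proof (rule AE_I2)
    fix v
    have "cos_gauss a v \<le> (a\<^sup>2 + 4) * (1 / (1 + v\<^sup>2))"
      by (rule order_trans[OF cos_gauss_bound(2) mult_left_mono[OF exp_abs_le_inverse_square]]) simp
    then show "norm (cos_gauss a v) \<le> norm ((a\<^sup>2 + 4) * (1 / (1 + v\<^sup>2)))"
      using cos_gauss_bound(1)[of a v] by simp
  qed
qed measurable

lemma log_kernel_nonneg: "0 \<le> log_kernel a"
  unfolding log_kernel_def by (rule Bochner_Integration.integral_nonneg) (rule cos_gauss_bound)

lemma log_kernel_even: "log_kernel \<bar>a\<bar> = log_kernel a"
proof -
  have "cos_gauss (- a) v = cos_gauss a v" for v by (simp add: cos_gauss_def)
  then have "cos_gauss (- a) = cos_gauss a" by (rule ext)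
  then have "log_kernel (- a) = log_kernel a" by (simp only: log_kernel_def)
  then show ?thesis by (cases "a \<ge> 0") (simp_all only: abs_of_nonneg abs_of_neg not_le)
qed

lemma log_kernel_continuous: "isCont log_kernel a"
  unfolding continuous_at_sequentially
proof (intro allI impI)
  fix y assume y: "y \<longlonglongrightarrow> a"
  then obtain R where R: "\<And>n. norm (y n) \<le> R" by (meson BseqE convergent_imp_Bseq convergentI)
  have "(\<lambda>n. LINT v|lborel. cos_gauss (y n) v) \<longlonglongrightarrow> (LBINT v. cos_gauss a v)"
  proof (rule integral_dominated_convergence[where w="\<lambda>v. (R\<^sup>2 + 4) * (1 / (1 + v\<^sup>2))"])
    show "integrable lborel (\<lambda>v. (R\<^sup>2 + 4) * (1 / (1 + v\<^sup>2)))"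
      by (intro integrable_mult_right integrable_inverse_square)
    show "AE v in lborel. (\<lambda>n. cos_gauss (y n) v) \<longlonglongrightarrow> cos_gauss a v"
      unfolding cos_gauss_def by (intro AE_I2 tendsto_intros y)
    show "AE v in lborel. norm (cos_gauss (y n) v) \<le> (R\<^sup>2 + 4) * (1 / (1 + v\<^sup>2))" for n
    proof (rule AE_I2)
      fix v
      have "(y n)\<^sup>2 \<le> R\<^sup>2" using power_mono[OF R[of n] norm_ge_zero, of 2] by simp
      then have "cos_gauss (y n) v \<le> (R\<^sup>2 + 4) * exp (- 2 * \<bar>v\<bar>)"
        by (intro order_trans[OF cos_gauss_bound(2)] mult_right_mono) auto
      also have "\<dots> \<le> (R\<^sup>2 + 4) * (1 / (1 + v\<^sup>2))"
        by (intro mult_left_mono exp_abs_le_inverse_square) auto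
      finally show "norm (cos_gauss (y n) v) \<le> (R\<^sup>2 + 4) * (1 / (1 + v\<^sup>2))"
        using cos_gauss_bound(1)[of "y n" v] by simp
    qed
  qed measurable
  then show "(log_kernel \<circ> y) \<longlonglongrightarrow> log_kernel a" by (simp add: o_def log_kernel_def)
qed

lemma log_kernel_radial:
  assumes r: "r > 0"
  shows "(LBINT v. (1 - cos (exp v * (r * a))) * exp (- (exp v * r)\<^sup>2 / 2)) = log_kernel a"
proof -
  have "log_kernel a = (LBINT v. cos_gauss a (ln r + 1 * v))"
    unfolding log_kernel_def by (subst lborel_integral_real_affine[where c=1 and t="ln r"]) auto
  also have "(\<lambda>v. cos_gauss a (ln r + 1 * v)) = (\<lambda>v. (1 - cos (exp v * (r * a))) * exp (- (exp v * r)\<^sup>2 / 2))"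
    using r by (simp add: cos_gauss_def log_gauss_def fun_eq_iff exp_add mult_ac)
  finally show ?thesis by simp
qed

section \<open>The mollified spectrum\<close>
locale negative_log = homogeneous_log f B for f :: "'a::euclidean_space \<Rightarrow> real" and B :: real +
  assumes negative: "negative_outside_origin (fourier_distr (regular_distr f))"
begin

definition \<delta> :: "nat \<Rightarrow> real" where "\<delta> k = inverse (real (Suc k))"

lemma \<delta>: "\<delta> k > 0" "\<delta> k \<le> 1" "\<delta> \<longlonglongrightarrow> 0"
proof -
  show "\<delta> k > 0" "\<delta> k \<le> 1" by (auto simp: \<delta>_def divide_simps)
  show "\<delta> \<longlonglongrightarrow> 0" unfolding \<delta>_def by (rule LIMSEQ_inverse_real_of_nat)
qed

abbreviation bump_hat :: "'a \<Rightarrow> complex" where "bump_hat \<equiv> fourier (bump 1 0)"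

definition bump_mass :: real where "bump_mass = Re (bump_hat 0)"

lemma bump_mass: "bump_mass > 0" "bump_hat 0 = complex_of_real bump_mass"
  using bump_mass_pos[where 'a='a] unfolding bump_mass_def by (metis Re_complex_of_real)+

lemma bump_hat_measurable [measurable]: "bump_hat \<in> borel_measurable borel"
  by (intro fourier_measurable schwartz_borel_measurable bump_schwartz) simp

definition \<kappa> :: real where "\<kappa> = (2 * pi) ^ DIM('a) * bump_mass"

lemma \<kappa>_pos: "\<kappa> > 0" using bump_mass by (simp add: \<kappa>_def)

text \<open>
  Minus the Fourier transform of \<open>f\<close> multiplied by the window \<open>bump_hat (\<delta> k x)\<close>, that is, minus the transform of \<open>f\<close>
  mollified at scale \<open>\<delta> k\<close>.
\<close>
definition windowed :: "nat \<Rightarrow> 'a \<Rightarrow> complex" where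
  "windowed k x = complex_of_real (f x) * bump_hat (\<delta> k *\<^sub>R x)"

definition spectrum :: "nat \<Rightarrow> 'a \<Rightarrow> complex" where
  "spectrum k y = - (LBINT x. windowed k x * exp (- \<i> * complex_of_real (x \<bullet> y)))"

definition spectral_density :: "nat \<Rightarrow> 'a \<Rightarrow> real" where
  "spectral_density k y = Re (spectrum k y)"

lemma bump_hat_decay:
  obtains C where "\<And>x. norm (bump_hat x) \<le> C / (1 + norm x) ^ p"
  using fourier_decay[OF bump_schwartz[of 1 "0::'a"]] by (metis zero_less_one)

lemma windowed_measurable [measurable]: "windowed k \<in> borel_measurable borel"
  unfolding windowed_def[abs_def] by measurable

lemma windowed_integrable: "integrable lborel (windowed k)"
proof -
  let ?p = "2 * DIM('a) + 1"
  obtain C where C: "\<And>x. norm (bump_hat x) \<le> C / (1 + norm x) ^ ?p" by (rule bump_hat_decay[where p="?p"]) blast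
  have "integrable lborel (\<lambda>x. f x *\<^sub>R bump_hat (\<delta> k *\<^sub>R x))"
  proof (rule integrable_f_decay)
    fix x :: 'a
    have "\<delta> k * (1 + norm x) \<le> 1 + norm (\<delta> k *\<^sub>R x)" using \<delta>(1,2)[of k] by (simp add: algebra_simps)
    then have "(\<delta> k * (1 + norm x)) ^ ?p \<le> (1 + norm (\<delta> k *\<^sub>R x)) ^ ?p"
      using \<delta>(1)[of k] by (intro power_mono mult_nonneg_nonneg) auto
    then have "\<bar>C\<bar> / (1 + norm (\<delta> k *\<^sub>R x)) ^ ?p \<le> \<bar>C\<bar> / (\<delta> k * (1 + norm x)) ^ ?p"
      using \<delta>(1)[of k] by (intro divide_left_mono) (auto intro!: mult_pos_pos zero_less_power add_pos_nonneg)
    moreover have "norm (bump_hat (\<delta> k *\<^sub>R x)) \<le> \<bar>C\<bar> / (1 + norm (\<delta> k *\<^sub>R x)) ^ ?p"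
      by (rule order_trans[OF C]) (simp add: divide_right_mono)
    ultimately have "norm (bump_hat (\<delta> k *\<^sub>R x)) \<le> \<bar>C\<bar> / (\<delta> k * (1 + norm x)) ^ ?p"
      by (rule order_trans[rotated])
    then show "norm (bump_hat (\<delta> k *\<^sub>R x)) \<le> (\<bar>C\<bar> / \<delta> k ^ ?p) / (1 + norm x) ^ ?p"
      by (simp only: power_mult_distrib divide_divide_eq_left)
  qed measurable
  then show ?thesis by (simp add: windowed_def[abs_def] scaleR_conv_of_real)
qed

lemma spectrum_measurable [measurable]: "spectrum k \<in> borel_measurable borel"
  unfolding spectrum_def[abs_def] by measurable

lemma spectral_density_measurable [measurable]: "spectral_density k \<in> borel_measurable borel"
  unfolding spectral_density_def[abs_def] by measurable

lemma spectrum_nonneg: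
  assumes y: "norm y > \<delta> k"
  shows "0 \<le> spectral_density k y"
proof -
  let ?\<phi> = "bump (\<delta> k) y"
  have "0 \<notin> cball y (\<delta> k)" using y by simp
  moreover have "compact (closure {x. ?\<phi> x \<noteq> 0})"
    using bump_support[OF \<delta>(1)[of k], of y] by (meson bounded_cball bounded_subset closed_closure compact_eq_bounded_closed)
  ultimately have "fourier_distr (regular_distr f) ?\<phi> \<in> \<real>\<^sub>\<le>\<^sub>0"
    using negative bump_support[OF \<delta>(1)[of k], of y] bump_schwartz[OF \<delta>(1)[of k], of y] bump_nonneg[of "\<delta> k" y]
    unfolding negative_outside_origin_def by blast
  also have "fourier_distr (regular_distr f) ?\<phi> = (LBINT x. complex_of_real (\<delta> k ^ DIM('a)) * (windowed k x * exp (- \<i> * complex_of_real (x \<bullet> y))))"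
    unfolding fourier_distr_def regular_distr_def fourier_bump[OF \<delta>(1)] windowed_def
    by (intro Bochner_Integration.integral_cong refl) (simp only: mult_ac)
  also have "\<dots> = complex_of_real (\<delta> k ^ DIM('a)) * (- spectrum k y)"
    by (simp add: spectrum_def)
  finally have "\<delta> k ^ DIM('a) * (- spectral_density k y) \<le> 0"
    by (simp add: complex_nonpos_Reals_iff spectral_density_def)
  then show ?thesis using zero_less_power[OF \<delta>(1)[of k], of "DIM('a)"] by (simp add: zero_le_mult_iff)
qed

text \<open>
  Rescaling by \<open>\<delta> k\<close> turns \<open>f\<close> into \<open>f - ln (\<delta> k)\<close>. The bound is the inverse volume of a ball of radius \<open>\<delta> k\<close>
  times a logarithm, so two powers of \<open>norm y\<close> make the integral over that ball negligible.
\<close>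
lemma spectrum_bound:
  obtains C where "C \<ge> 0" "\<And>k y. norm (spectrum k y) \<le> C * (1 + \<bar>ln (\<delta> k)\<bar>) / \<delta> k ^ DIM('a)"
proof
  let ?A = "LBINT w. norm (bump_hat w)" and ?A' = "LBINT w. \<bar>f w\<bar> * norm (bump_hat w)"
  obtain C where C: "\<And>x. norm (bump_hat x) \<le> C / (1 + norm x) ^ (2 * DIM('a) + 1)" by (rule bump_hat_decay[where p="2 * DIM('a) + 1"]) blast
  have i: "integrable lborel (\<lambda>w. norm (bump_hat w))"
    using fourier_integrable[OF bump_schwartz[of 1 "0::'a"]] by simp
  have "integrable lborel (\<lambda>w. f w *\<^sub>R bump_hat w)" by (rule integrable_f_decay[OF _ C]) measurable
  from integrable_norm[OF this] have i': "integrable lborel (\<lambda>w. \<bar>f w\<bar> * norm (bump_hat w))" by simp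
  show "?A + ?A' \<ge> 0" by (intro add_nonneg_nonneg Bochner_Integration.integral_nonneg) auto
  fix k y
  let ?d = "\<delta> k"
  have d: "?d > 0" by (rule \<delta>)
  have "norm (spectrum k y) \<le> (LBINT x. norm (windowed k x))"
    unfolding spectrum_def norm_minus_cancel by (rule order_trans[OF integral_norm_bound]) (simp add: norm_mult)
  also have "\<dots> = inverse ?d ^ DIM('a) * (LBINT w. norm (windowed k (0 + inverse ?d *\<^sub>R w)))"
    using d by (subst lborel_integral_affine(2)[where c="inverse ?d" and t=0]) auto
  also have "(LBINT w. norm (windowed k (0 + inverse ?d *\<^sub>R w))) \<le> (LBINT w. \<bar>ln ?d\<bar> * norm (bump_hat w) + \<bar>f w\<bar> * norm (bump_hat w))"
  proof (rule integral_mono_AE)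
    show "integrable lborel (\<lambda>w. norm (windowed k (0 + inverse ?d *\<^sub>R w)))"
      using windowed_integrable[of k] d
      by (intro integrable_norm) (subst (asm) lborel_integral_affine(1)[where c="inverse ?d" and t=0], auto)
    show "integrable lborel (\<lambda>w. \<bar>ln ?d\<bar> * norm (bump_hat w) + \<bar>f w\<bar> * norm (bump_hat w))"
      using i i' by simp
    show "AE w in lborel. norm (windowed k (0 + inverse ?d *\<^sub>R w)) \<le> \<bar>ln ?d\<bar> * norm (bump_hat w) + \<bar>f w\<bar> * norm (bump_hat w)"
      using AE_lborel_singleton[of 0]
    proof eventually_elim
      case (elim w)
      have "\<bar>f (inverse ?d *\<^sub>R w)\<bar> \<le> \<bar>ln ?d\<bar> + \<bar>f w\<bar>"
        using f_scale[of "inverse ?d" w] elim d by (simp add: ln_inverse)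
      then have "\<bar>f (inverse ?d *\<^sub>R w)\<bar> * norm (bump_hat w) \<le> (\<bar>ln ?d\<bar> + \<bar>f w\<bar>) * norm (bump_hat w)"
        by (rule mult_right_mono) simp
      then show ?case using d by (simp add: windowed_def norm_mult distrib_right)
    qed
  qed
  also have "\<dots> = \<bar>ln ?d\<bar> * ?A + ?A'" using i i' by simp
  also have "\<dots> \<le> (?A + ?A') * (1 + \<bar>ln ?d\<bar>)"
  proof -
    have "0 \<le> ?A" "0 \<le> ?A' * \<bar>ln ?d\<bar>" by (auto intro!: Bochner_Integration.integral_nonneg mult_nonneg_nonneg)
    then show ?thesis by (simp add: algebra_simps)
  qed
  finally show "norm (spectrum k y) \<le> (?A + ?A') * (1 + \<bar>ln ?d\<bar>) / ?d ^ DIM('a)"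
    using d by (simp add: power_inverse divide_inverse mult.commute)
qed

text \<open>
  After an exchange of integrals \<open>gaussian_fourier\<close> turns the wave at frequency \<open>x\<close> into the heat kernel around
  \<open>x\<close>; as \<open>\<delta> k \<rightarrow> 0\<close> the window tends to the constant \<open>bump_mass\<close>.
\<close>
lemma spectrum_gauss_limit:
  assumes t: "t > 0"
  shows "(\<lambda>k. LINT y|lborel. complex_of_real (gauss t y) * (iexp (x \<bullet> y) * spectrum k y))
     \<longlonglongrightarrow> - complex_of_real (\<kappa> * smoothed x t)"
proof -
  let ?S = "sqrt (2 * pi / t) ^ DIM('a)"
  let ?g = "\<lambda>w. heat t x w"
  have E: "(LBINT y. complex_of_real (gauss t y) * (iexp (x \<bullet> y) * spectrum k y))
    = - (complex_of_real ?S * (LBINT w. windowed k w * complex_of_real (?g w)))" for k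
  proof -
    have "(LBINT y. complex_of_real (gauss t y) * (iexp (x \<bullet> y) * spectrum k y))
      = (LBINT y. - (complex_of_real (gauss t y) * (LBINT w. windowed k w * iexp ((x - w) \<bullet> y))))"
    proof (rule Bochner_Integration.integral_cong[OF refl])
      fix y :: 'a
      have "iexp (x \<bullet> y) * (LBINT w. windowed k w * exp (- \<i> * complex_of_real (w \<bullet> y)))
        = (LBINT w. windowed k w * iexp ((x - w) \<bullet> y))"
        by (subst integral_mult_right_zero[symmetric], intro Bochner_Integration.integral_cong refl)
           (simp add: inner_diff_left algebra_simps exp_add[symmetric])
      then show "complex_of_real (gauss t y) * (iexp (x \<bullet> y) * spectrum k y)
       = - (complex_of_real (gauss t y) * (LBINT w. windowed k w * iexp ((x - w) \<bullet> y)))"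
        by (simp only: spectrum_def mult_minus_right)
    qed
    also have "\<dots> = - (LBINT y. complex_of_real (gauss t y) * (LBINT w. windowed k w * iexp ((x - w) \<bullet> y)))"
      by (rule integral_minus)
    also have "(LBINT y. complex_of_real (gauss t y) * (LBINT w. windowed k w * iexp ((x - w) \<bullet> y)))
       = (LBINT w. windowed k w * (LBINT y. complex_of_real (gauss t y) * iexp ((x - w) \<bullet> y)))"
    proof (rule Fubini_bounded_kernel[where B=1])
      show "integrable lborel (\<lambda>y::'a. complex_of_real (gauss t y))"
        using integrable_gaussian[OF t, where 'a='a] by (rule integrable_of_real)
    qed (auto intro: sigma_finite_lborel windowed_integrable)
    also have "\<dots> = (LBINT w. complex_of_real ?S * (windowed k w * complex_of_real (?g w)))"
      by (subst gaussian_fourier[OF t]) (simp add: norm_minus_commute mult_ac)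
    finally show ?thesis by simp
  qed
  have L: "(\<lambda>k. LINT w|lborel. windowed k w * complex_of_real (?g w)) \<longlonglongrightarrow> (LBINT w. complex_of_real (f w * ?g w) * complex_of_real bump_mass)"
  proof -
    obtain C where C: "\<And>x. norm (bump_hat x) \<le> C / (1 + norm x) ^ 0" by (rule bump_hat_decay[where p=0]) blast
    show ?thesis
    proof (rule integral_dominated_convergence[where w="\<lambda>w. C * \<bar>f w * ?g w\<bar>"])
      show "integrable lborel (\<lambda>w. C * \<bar>f w * ?g w\<bar>)"
        by (intro integrable_mult_right integrable_abs heat_kernel_integrable t)
      show "AE w in lborel. (\<lambda>k. windowed k w * complex_of_real (?g w)) \<longlonglongrightarrow> complex_of_real (f w * ?g w) * complex_of_real bump_mass"
      proof (rule AE_I2)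
        fix w :: 'a
        have "isCont bump_hat 0"
          unfolding continuous_at_sequentially
        proof (intro allI impI)
          fix y :: "nat \<Rightarrow> 'a" assume y: "y \<longlonglongrightarrow> 0"
          have bi: "integrable lborel (bump 1 (0::'a))" by (intro schwartz_integrable bump_schwartz) simp
          have [measurable]: "bump 1 (0::'a) \<in> borel_measurable borel" by (intro schwartz_borel_measurable bump_schwartz) simp
          have "(\<lambda>n. LINT x|lborel. bump 1 0 x * exp (- \<i> * complex_of_real (x \<bullet> y n))) \<longlonglongrightarrow> (LBINT x. bump 1 (0::'a) x * exp (- \<i> * complex_of_real (x \<bullet> 0)))"
          proof (rule integral_dominated_convergence[where w="\<lambda>x::'a. norm (bump 1 0 x)"])
            show "AE x in lborel. (\<lambda>n. bump 1 0 x * exp (- \<i> * complex_of_real (x \<bullet> y n))) \<longlonglongrightarrow> bump 1 0 x * exp (- \<i> * complex_of_real (x \<bullet> 0))"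
              by (intro AE_I2 tendsto_intros y)
          qed (use bi in \<open>auto simp: norm_mult\<close>)
          then show "(bump_hat \<circ> y) \<longlonglongrightarrow> bump_hat 0" by (simp add: o_def fourier_def)
        qed
        moreover have "(\<lambda>k. \<delta> k *\<^sub>R w) \<longlonglongrightarrow> 0" using tendsto_scaleR[OF \<delta>(3) tendsto_const, of w] by simp
        ultimately have "(\<lambda>k. bump_hat (\<delta> k *\<^sub>R w)) \<longlonglongrightarrow> bump_hat 0" by (rule isCont_tendsto_compose)
        then have "(\<lambda>k. complex_of_real (f w) * bump_hat (\<delta> k *\<^sub>R w) * complex_of_real (?g w)) \<longlonglongrightarrow> complex_of_real (f w) * bump_hat 0 * complex_of_real (?g w)"
          by (intro tendsto_intros)
        then show "(\<lambda>k. windowed k w * complex_of_real (?g w)) \<longlonglongrightarrow> complex_of_real (f w * ?g w) * complex_of_real bump_mass"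
          unfolding bump_mass(2) windowed_def by (simp add: mult_ac)
      qed
      show "AE w in lborel. norm (windowed k w * complex_of_real (?g w)) \<le> C * \<bar>f w * ?g w\<bar>" for k
      proof (rule AE_I2)
        fix w
        have "norm (bump_hat (\<delta> k *\<^sub>R w)) * \<bar>f w * ?g w\<bar> \<le> C * \<bar>f w * ?g w\<bar>"
          using C[of "\<delta> k *\<^sub>R w"] by (intro mult_right_mono) auto
        then show "norm (windowed k w * complex_of_real (?g w)) \<le> C * \<bar>f w * ?g w\<bar>"
          by (simp add: windowed_def norm_mult abs_mult mult_ac)
      qed
    qed measurable
  qed
  have V: "complex_of_real ?S * (LBINT w. complex_of_real (f w * ?g w) * complex_of_real bump_mass) = complex_of_real (\<kappa> * smoothed x t)"
  proof -
    have "(LBINT w. f w * ?g w) = sqrt (2 * pi * t) ^ DIM('a) * smoothed x t"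
      using t by (simp add: smoothed_heat_kernel[OF t])
    then have "(LBINT w. complex_of_real (f w * ?g w)) = complex_of_real (sqrt (2 * pi * t) ^ DIM('a) * smoothed x t)"
      by (simp only: integral_complex_of_real)
    then have "(LBINT w. complex_of_real (f w * ?g w) * complex_of_real bump_mass) = complex_of_real (sqrt (2 * pi * t) ^ DIM('a) * smoothed x t * bump_mass)"
      by (subst integral_mult_left_zero) (simp only: of_real_mult[of "_ * _" bump_mass])
    moreover have "?S * sqrt (2 * pi * t) ^ DIM('a) = (2 * pi) ^ DIM('a)"
    proof -
      have "sqrt (2 * pi / t) * sqrt (2 * pi * t) = 2 * pi"
      proof -
        have "2 * pi / t * (2 * pi * t) = (2 * pi)\<^sup>2" using t by (simp add: power2_eq_square)
        then show ?thesis by (simp only: real_sqrt_mult[symmetric] real_sqrt_abs) simp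
      qed
      then show ?thesis by (simp only: power_mult_distrib[symmetric])
    qed
    then have "?S * (sqrt (2 * pi * t) ^ DIM('a) * smoothed x t * bump_mass) = \<kappa> * smoothed x t"
      unfolding \<kappa>_def by (simp only: mult.assoc[symmetric]) (simp only: mult_ac)
    ultimately show ?thesis by (simp only: of_real_mult[symmetric])
  qed
  show ?thesis
    unfolding E V[symmetric] by (intro tendsto_minus tendsto_mult tendsto_const L)
qed

end

context negative_log
begin

section \<open>Spectral measures and test functions\<close>
definition cos_wave :: "'a \<Rightarrow> real \<Rightarrow> 'a \<Rightarrow> real" where
  "cos_wave x t y = cos (x \<bullet> y) * gauss t y"

definition spectral_limit :: "('a \<Rightarrow> real) \<Rightarrow> real \<Rightarrow> bool" where
  "spectral_limit \<psi> l \<longleftrightarrow> integrable lborel \<psi> \<and>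
     (\<lambda>k. LINT y|lborel. \<psi> y * spectral_density k y) \<longlonglongrightarrow> l"

lemma spectral_density_bounded:
  obtains C where "\<And>y. \<bar>spectral_density k y\<bar> \<le> C"
proof -
  obtain C where "\<And>k y. norm (spectrum k y) \<le> C * (1 + \<bar>ln (\<delta> k)\<bar>) / \<delta> k ^ DIM('a)"
    using spectrum_bound by metis
  then show ?thesis
    using that abs_Re_le_cmod order_trans unfolding spectral_density_def by blast
qed

lemma spectral_product_integrable:
  assumes "integrable lborel \<psi>"
  shows "integrable lborel (\<lambda>y. \<psi> y * spectral_density k y)"
proof -
  obtain C where C: "\<And>y. \<bar>spectral_density k y\<bar> \<le> C" using spectral_density_bounded by blast
  show ?thesis
  proof (rule Bochner_Integration.integrable_bound)
    show "integrable lborel (\<lambda>y. \<bar>C\<bar> * \<psi> y)" using assms by simp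
    show "AE y in lborel. norm (\<psi> y * spectral_density k y) \<le> norm (\<bar>C\<bar> * \<psi> y)"
    proof (rule AE_I2)
      fix y
      have "\<bar>spectral_density k y\<bar> \<le> \<bar>C\<bar>" using C[of y] by linarith
      then have "\<bar>spectral_density k y\<bar> * \<bar>\<psi> y\<bar> \<le> \<bar>C\<bar> * \<bar>\<psi> y\<bar>" by (rule mult_right_mono) simp
      then show "norm (\<psi> y * spectral_density k y) \<le> norm (\<bar>C\<bar> * \<psi> y)" by (simp add: abs_mult mult.commute)
    qed
  qed (use assms in measurable)
qed

lemma spectral_limit_diff:
  assumes "spectral_limit \<psi> l" "spectral_limit \<psi>' l'"
  shows "spectral_limit (\<lambda>y. \<psi> y - \<psi>' y) (l - l')"
  using assms spectral_product_integrable unfolding spectral_limit_def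
  by (auto simp: left_diff_distrib intro!: tendsto_diff)

lemma spectral_limit_sum:
  assumes "\<And>i. i \<in> I \<Longrightarrow> spectral_limit (\<psi> i) (l i)"
  shows "spectral_limit (\<lambda>y. \<Sum>i\<in>I. c i * \<psi> i y) (\<Sum>i\<in>I. c i * l i)"
proof -
  have i: "integrable lborel (\<lambda>y. c i * (\<psi> i y * spectral_density k y))" if "i \<in> I" for i k
    using assms[OF that] spectral_product_integrable by (auto simp: spectral_limit_def)
  have "(LBINT y. (\<Sum>i\<in>I. c i * \<psi> i y) * spectral_density k y)
     = (\<Sum>i\<in>I. c i * (LBINT y. \<psi> i y * spectral_density k y))" for k
    using i by (simp add: sum_distrib_right mult.assoc Bochner_Integration.integral_sum)
  then show ?thesis
    using assms unfolding spectral_limit_def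
    by (auto intro!: tendsto_sum tendsto_mult)
qed

lemma spectral_limit_cos_wave:
  assumes t: "t > 0"
  shows "spectral_limit (cos_wave x t) (- \<kappa> * smoothed x t)"
proof -
  let ?e = "\<lambda>x y. iexp (x \<bullet> y)"
  let ?g = "\<lambda>y. complex_of_real (gauss t (y::'a))"
  have gi: "integrable lborel (\<lambda>y::'a. gauss t y)" by (rule integrable_gaussian[OF t])
  have int: "integrable lborel (cos_wave x t)"
  proof (rule Bochner_Integration.integrable_bound[OF gi])
    show "AE y in lborel. norm (cos_wave x t y) \<le> norm (gauss t y)"
      by (rule AE_I2) (simp add: cos_wave_def abs_mult mult_left_le_one_le)
    show "cos_wave x t \<in> borel_measurable lborel" unfolding cos_wave_def[abs_def] by measurable
  qed
  have I: "integrable lborel (\<lambda>y. ?g y * (?e x y * spectrum k y))" for x k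
  proof -
    obtain C where "\<And>k y. norm (spectrum k y) \<le> C * (1 + \<bar>ln (\<delta> k)\<bar>) / \<delta> k ^ DIM('a)"
      using spectrum_bound by metis
    then show ?thesis
      by (intro integrable_mult_bounded[where B="C * (1 + \<bar>ln (\<delta> k)\<bar>) / \<delta> k ^ DIM('a)"] integrable_of_real gi)
         (auto simp: norm_mult)
  qed
  have E: "(LBINT y. cos_wave x t y * spectral_density k y)
    = (Re (LBINT y. ?g y * (?e x y * spectrum k y)) + Re (LBINT y. ?g y * (?e (- x) y * spectrum k y))) / 2" for k
  proof -
    have "Re (?g y * (?e x y * spectrum k y)) + Re (?g y * (?e (- x) y * spectrum k y)) = 2 * (cos_wave x t y * spectral_density k y)" for y
      by (simp add: cos_wave_def spectral_density_def Re_exp Im_exp algebra_simps)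
    then have "(LBINT y. 2 * (cos_wave x t y * spectral_density k y))
      = (LBINT y. Re (?g y * (?e x y * spectrum k y)) + Re (?g y * (?e (- x) y * spectrum k y)))"
      by (simp only:)
    also have "\<dots> = Re (LBINT y. ?g y * (?e x y * spectrum k y)) + Re (LBINT y. ?g y * (?e (- x) y * spectrum k y))"
      by (simp only: Bochner_Integration.integral_add[OF integrable_Re[OF I] integrable_Re[OF I]] integral_Re[OF I])
    finally show ?thesis by simp
  qed
  have "(\<lambda>k. LINT y|lborel. cos_wave x t y * spectral_density k y) \<longlonglongrightarrow>
     (Re (- complex_of_real (\<kappa> * smoothed x t)) + Re (- complex_of_real (\<kappa> * smoothed (- x) t))) / 2"
    unfolding E by (intro tendsto_intros tendsto_Re spectrum_gauss_limit t) simp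
  then show ?thesis using int smoothed_even[OF t, of x] by (simp add: spectral_limit_def)
qed

definition spectral_measure :: "nat \<Rightarrow> 'a measure" where
  "spectral_measure k = density lborel (\<lambda>y. ennreal (indicator {y. \<delta> k < norm y} y * spectral_density k y))"

lemma spectral_measure_sets [measurable_cong, simp]: "sets (spectral_measure k) = sets borel"
  by (simp add: spectral_measure_def)

lemma cut_density_nonneg: "0 \<le> indicator {y. \<delta> k < norm y} y * spectral_density k y"
  using spectrum_nonneg by (auto simp: indicator_def)

lemma cut_density_measurable [measurable]:
  "(\<lambda>y. indicator {y. \<delta> k < norm y} y * spectral_density k y) \<in> borel_measurable borel"
  by measurable

lemma spectral_measure_sigma_finite: "sigma_finite_measure (spectral_measure k)"
  unfolding spectral_measure_def
  by (subst sigma_finite_measure.sigma_finite_iff_density_finite[OF sigma_finite_lborel]) auto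

lemma spectral_measure_AE: "AE y in spectral_measure k. y \<noteq> 0"
  unfolding spectral_measure_def using \<delta>(1)[of k]
  by (subst AE_density) (auto simp: indicator_def)

lemma spectral_measure_integrable:
  assumes "integrable lborel \<psi>"
  shows "integrable (spectral_measure k) \<psi>"
    and "integral\<^sup>L (spectral_measure k) \<psi> = (LBINT y. indicator {y. \<delta> k < norm y} y * (\<psi> y * spectral_density k y))"
proof -
  have [measurable]: "\<psi> \<in> borel_measurable borel" using assms by (metis borel_measurable_integrable measurable_lborel2)
  have "integrable lborel (\<lambda>y. indicator {y. \<delta> k < norm y} y *\<^sub>R (\<psi> y * spectral_density k y))"
    by (rule integrable_mult_indicator[OF _ spectral_product_integrable[OF assms]]) measurable
  then have "integrable lborel (\<lambda>y. (indicator {y. \<delta> k < norm y} y * spectral_density k y) *\<^sub>R \<psi> y)"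
    by (simp add: mult_ac)
  then show "integrable (spectral_measure k) \<psi>"
    unfolding spectral_measure_def using cut_density_nonneg
    by (subst integrable_density) auto
  show "integral\<^sup>L (spectral_measure k) \<psi> = (LBINT y. indicator {y. \<delta> k < norm y} y * (\<psi> y * spectral_density k y))"
    unfolding spectral_measure_def using cut_density_nonneg
    by (subst integral_density) (auto simp: mult_ac)
qed

text \<open>
  A test function of order \<open>(norm y)\<^sup>2\<close> contributes \<open>O ((\<delta> k)\<^sup>2 (1 + \<bar>ln (\<delta> k)\<bar>))\<close> on the excluded ball, by
  \<open>spectrum_bound\<close>.
\<close>
lemma spectral_measure_limit:
  assumes \<psi>: "spectral_limit \<psi> l" and C: "\<And>y. \<bar>\<psi> y\<bar> \<le> C * (norm y)\<^sup>2"
  shows "(\<lambda>k. integral\<^sup>L (spectral_measure k) \<psi>) \<longlonglongrightarrow> l"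
proof -
  have int: "integrable lborel \<psi>" using \<psi> by (simp add: spectral_limit_def)
  then have [measurable]: "\<psi> \<in> borel_measurable borel" by (metis borel_measurable_integrable measurable_lborel2)
  have C0: "0 \<le> C"
  proof -
    obtain b :: 'a where "b \<in> Basis" by (meson nonempty_Basis ex_in_conv)
    then show ?thesis using C[of b] abs_ge_zero[of "\<psi> b"] by simp
  qed
  obtain D where D: "D \<ge> 0" "\<And>k y. norm (spectrum k y) \<le> D * (1 + \<bar>ln (\<delta> k)\<bar>) / \<delta> k ^ DIM('a)"
    using spectrum_bound by metis
  let ?v = "unit_ball_vol (DIM('a))"
  have v: "?v \<ge> 0" by simp
  let ?r = "\<lambda>k. LINT y|lborel. indicator (cball 0 (\<delta> k)) y * (\<psi> y * spectral_density k y)"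
  have split: "integral\<^sup>L (spectral_measure k) \<psi> = (LBINT y. \<psi> y * spectral_density k y) - ?r k" for k
  proof -
    have i: "integrable lborel (\<lambda>y. indicator (cball 0 (\<delta> k)) y *\<^sub>R (\<psi> y * spectral_density k y))"
      by (rule integrable_mult_indicator[OF _ spectral_product_integrable[OF int]]) auto
    have "integral\<^sup>L (spectral_measure k) \<psi> = (LBINT y. \<psi> y * spectral_density k y - indicator (cball 0 (\<delta> k)) y *\<^sub>R (\<psi> y * spectral_density k y))"
      unfolding spectral_measure_integrable(2)[OF int]
      by (intro Bochner_Integration.integral_cong refl) (auto simp: indicator_def)
    also have "\<dots> = (LBINT y. \<psi> y * spectral_density k y) - (LBINT y. indicator (cball 0 (\<delta> k)) y *\<^sub>R (\<psi> y * spectral_density k y))"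
      by (rule Bochner_Integration.integral_diff[OF spectral_product_integrable[OF int] i])
    finally show ?thesis by simp
  qed
  have r: "\<bar>?r k\<bar> \<le> C * D * ?v * ((\<delta> k)\<^sup>2 * (1 + \<bar>ln (\<delta> k)\<bar>))" for k
  proof -
    let ?K = "C * (\<delta> k)\<^sup>2 * (D * (1 + \<bar>ln (\<delta> k)\<bar>) / \<delta> k ^ DIM('a))"
    have "\<bar>?r k\<bar> \<le> (LBINT y. \<bar>indicator (cball 0 (\<delta> k)) y * (\<psi> y * spectral_density k y)\<bar>)"
      by (rule integral_abs_bound)
    also have "\<dots> \<le> (LBINT y. indicator (cball (0::'a) (\<delta> k)) y *\<^sub>R ?K)"
    proof (rule integral_mono')
      show "integrable lborel (\<lambda>y::'a. indicat_real (cball 0 (\<delta> k)) y *\<^sub>R ?K)"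
        by (intro integrable_scaleR_left integrable_real_indicator) (auto simp: emeasure_lborel_cball_finite[simplified])
      fix y
      have "\<bar>\<psi> y\<bar> * \<bar>spectral_density k y\<bar> \<le> ?K" if "norm y \<le> \<delta> k"
      proof (rule mult_mono)
        have "(norm y)\<^sup>2 \<le> (\<delta> k)\<^sup>2" using that by (intro power_mono) auto
        then show "\<bar>\<psi> y\<bar> \<le> C * (\<delta> k)\<^sup>2" using C0 by (intro order_trans[OF C] mult_left_mono)
        show "\<bar>spectral_density k y\<bar> \<le> D * (1 + \<bar>ln (\<delta> k)\<bar>) / \<delta> k ^ DIM('a)"
          unfolding spectral_density_def by (rule order_trans[OF abs_Re_le_cmod D(2)])
      qed (use C0 in auto)
      then show "\<bar>indicator (cball 0 (\<delta> k)) y * (\<psi> y * spectral_density k y)\<bar> \<le> indicator (cball 0 (\<delta> k)) y *\<^sub>R ?K"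
        by (auto simp: indicator_def abs_mult)
      show "0 \<le> indicator (cball 0 (\<delta> k)) y *\<^sub>R ?K"
        using C0 D(1) \<delta>(1)[of k] by (intro scaleR_nonneg_nonneg mult_nonneg_nonneg divide_nonneg_nonneg) auto
    qed
    also have "\<dots> = measure lborel (cball (0::'a) (\<delta> k)) * ?K"
      by (subst integral_scaleR_left) (auto simp: emeasure_lborel_cball_finite[simplified])
    also have "measure lborel (cball (0::'a) (\<delta> k)) = ?v * \<delta> k ^ DIM('a)"
      using \<delta>(1)[of k] by (intro content_cball) auto
    also have "?v * \<delta> k ^ DIM('a) * ?K = C * D * ?v * ((\<delta> k)\<^sup>2 * (1 + \<bar>ln (\<delta> k)\<bar>))"
      using \<delta>(1)[of k] by (simp add: field_simps)
    finally show ?thesis .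
  qed
  have "((\<lambda>d::real. d\<^sup>2 * (1 + \<bar>ln d\<bar>)) \<longlongrightarrow> 0) (at_right 0)" by real_asymp
  moreover have "filterlim \<delta> (at_right 0) sequentially"
    unfolding filterlim_at using \<delta>(3) less_imp_neq[OF \<delta>(1)] \<delta>(1) by (auto intro!: always_eventually)
  ultimately have "(\<lambda>k. (\<delta> k)\<^sup>2 * (1 + \<bar>ln (\<delta> k)\<bar>)) \<longlonglongrightarrow> 0" by (rule filterlim_compose)
  then have "(\<lambda>k. C * D * ?v * ((\<delta> k)\<^sup>2 * (1 + \<bar>ln (\<delta> k)\<bar>))) \<longlonglongrightarrow> 0" by (rule tendsto_mult_right_zero)
  then have "?r \<longlonglongrightarrow> 0" by (rule Lim_null_comparison[rotated]) (use r in auto)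
  then have "(\<lambda>k. (LBINT y. \<psi> y * spectral_density k y) - ?r k) \<longlonglongrightarrow> l - 0"
    using \<psi> by (intro tendsto_diff) (auto simp: spectral_limit_def)
  then show ?thesis unfolding split by simp
qed

text \<open>
  The cutoff weights the directions. It vanishes to fourth order at the origin, and that leaves a factor
  \<open>(norm y)\<^sup>2\<close> to spare over the majorant: enough to gain \<open>exp (- 2 * v)\<close> from a wave of frequency \<open>exp v\<close> (see
  \<open>wave_packet_bound\<close>). Both functions are combinations of centred Gaussians.
\<close>
definition cutoff :: "'a \<Rightarrow> real" where
  "cutoff y = (1 - std_gauss y)\<^sup>2 * std_gauss y"

definition majorant :: "'a \<Rightarrow> real" where
  "majorant y = (1 - std_gauss y) * exp (- (norm y)\<^sup>2 / 4)"

text \<open>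
  The basic test function \<open>(1 - cos (x \<bullet> y)) std_gauss y\<close>, dilated by \<open>exp v\<close>, times the cutoff.
\<close>
definition wave_packet :: "'a \<Rightarrow> real \<Rightarrow> 'a \<Rightarrow> real" where
  "wave_packet x v y = (1 - cos (exp v * (x \<bullet> y))) * exp (- (exp v * norm y)\<^sup>2 / 2) * cutoff y"

definition cutoff_coeff :: "nat \<Rightarrow> real" where
  "cutoff_coeff j = (if j = 2 then -2 else 1)"

lemma cutoff_sum: "cutoff y = (\<Sum>j\<in>{1,2,3}. cutoff_coeff j * gauss (real j) y)"
proof -
  let ?E = "std_gauss y"
  have "gauss (real j) y = ?E ^ j" for j
    by (simp add: exp_of_nat_mult[symmetric])
  then show ?thesis
    by (simp add: cutoff_def cutoff_coeff_def power2_eq_square power3_eq_cube algebra_simps)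
qed

lemma cutoff_bounds:
  "0 \<le> cutoff y" "cutoff y \<le> (norm y)\<^sup>2 / 2" "cutoff y \<le> majorant y" "cutoff y \<le> (norm y)\<^sup>2 / 2 * majorant y"
  "0 \<le> majorant y" "majorant y \<le> (norm y)\<^sup>2 / 2"
  "(norm y)\<^sup>2 * cutoff y \<le> 4 * majorant y"
proof -
  let ?q = "1 - exp (- ((norm y)\<^sup>2 / 2))"
  have q: "0 \<le> ?q" "?q \<le> (norm y)\<^sup>2 / 2" "?q \<le> 1" by (rule one_minus_exp_bounds, simp)+
  have h: "cutoff y = ?q\<^sup>2 * exp (- ((norm y)\<^sup>2 / 2))" and m: "majorant y = ?q * exp (- ((norm y)\<^sup>2 / 4))"
    by (simp_all add: cutoff_def majorant_def)
  have e: "exp (- ((norm y)\<^sup>2 / 2)) = exp (- ((norm y)\<^sup>2 / 4)) * exp (- ((norm y)\<^sup>2 / 4))"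
    by (simp flip: exp_add)
  have e1: "exp (- ((norm y)\<^sup>2 / 2)) \<le> exp (- ((norm y)\<^sup>2 / 4))" "exp (- ((norm y)\<^sup>2 / 2)) \<le> 1" "exp (- ((norm y)\<^sup>2 / 4)) \<le> 1"
    by auto
  have q2: "?q\<^sup>2 \<le> ?q" unfolding power2_eq_square using q by (intro mult_left_le) auto
  show "0 \<le> cutoff y" unfolding h by simp
  show m0: "0 \<le> majorant y" unfolding m using q by (intro mult_nonneg_nonneg) auto
  show hm: "cutoff y \<le> majorant y" unfolding h m using q2 e1 q by (intro mult_mono) auto
  have "majorant y \<le> ?q * 1" unfolding m using q e1 by (intro mult_left_mono) auto
  then show mq: "majorant y \<le> (norm y)\<^sup>2 / 2" using q by simp
  show "cutoff y \<le> (norm y)\<^sup>2 / 2" using hm mq by simp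
  have "cutoff y = ?q * (?q * exp (- ((norm y)\<^sup>2 / 2)))" unfolding h power2_eq_square by simp
  also have "\<dots> \<le> (norm y)\<^sup>2 / 2 * (?q * exp (- ((norm y)\<^sup>2 / 4)))"
    using q e1 by (intro mult_mono mult_left_mono) auto
  finally show "cutoff y \<le> (norm y)\<^sup>2 / 2 * majorant y" unfolding m .
  have "(norm y)\<^sup>2 / 4 * exp (- ((norm y)\<^sup>2 / 4)) \<le> 1" by (rule mult_exp_minus_le_one) simp
  then have r: "(norm y)\<^sup>2 * exp (- ((norm y)\<^sup>2 / 4)) \<le> 4" by simp
  have "(norm y)\<^sup>2 * cutoff y = ?q\<^sup>2 * exp (- ((norm y)\<^sup>2 / 4)) * ((norm y)\<^sup>2 * exp (- ((norm y)\<^sup>2 / 4)))"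
    unfolding h e by (simp only: mult_ac)
  also have "\<dots> \<le> ?q * exp (- ((norm y)\<^sup>2 / 4)) * 4"
    using q q2 r by (intro mult_mono) auto
  finally show "(norm y)\<^sup>2 * cutoff y \<le> 4 * majorant y" unfolding m by simp
qed

lemma wave_packet_bound:
  "0 \<le> wave_packet x v y" "wave_packet x v y \<le> (2 * (norm x)\<^sup>2 + 2) * exp (- 2 * \<bar>v\<bar>) * majorant y"
  "wave_packet x v y \<le> (norm y)\<^sup>2"
proof -
  let ?c = "1 - cos (exp v * (x \<bullet> y))" and ?e = "exp (- (exp v * norm y)\<^sup>2 / 2)"
  have c: "0 \<le> ?c" "?c \<le> 2" "?c \<le> (exp v * (x \<bullet> y))\<^sup>2 / 2" by (rule one_minus_cos_bounds)+
  have e: "0 \<le> ?e" "?e \<le> 1" by auto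
  show "0 \<le> wave_packet x v y"
    unfolding wave_packet_def using c e cutoff_bounds(1) by (intro mult_nonneg_nonneg) auto
  have "wave_packet x v y \<le> 2 * 1 * ((norm y)\<^sup>2 / 2)"
    unfolding wave_packet_def using c e cutoff_bounds[of y] by (intro mult_mono mult_nonneg_nonneg) auto
  then show "wave_packet x v y \<le> (norm y)\<^sup>2" by simp
  show "wave_packet x v y \<le> (2 * (norm x)\<^sup>2 + 2) * exp (- 2 * \<bar>v\<bar>) * majorant y"
  proof (cases "v \<le> 0")
    case True
    have "(exp v * (x \<bullet> y))\<^sup>2 \<le> exp (2 * v) * ((norm x)\<^sup>2 * (norm y)\<^sup>2)"
      using Cauchy_Schwarz_ineq[of x y] by (simp add: power_mult_distrib exp_double power2_norm_eq_inner)
    then have "?c \<le> exp (2 * v) * ((norm x)\<^sup>2 * (norm y)\<^sup>2) / 2" using c(3) by simp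
    then have "wave_packet x v y \<le> exp (2 * v) * ((norm x)\<^sup>2 * (norm y)\<^sup>2) / 2 * 1 * cutoff y"
      unfolding wave_packet_def using c e cutoff_bounds(1) by (intro mult_mono mult_right_mono mult_nonneg_nonneg) auto
    also have "\<dots> = exp (2 * v) * (norm x)\<^sup>2 / 2 * ((norm y)\<^sup>2 * cutoff y)" by simp
    also have "\<dots> \<le> exp (2 * v) * (norm x)\<^sup>2 / 2 * (4 * majorant y)"
      using cutoff_bounds(7) by (intro mult_left_mono) auto
    also have "\<dots> = 2 * (norm x)\<^sup>2 * exp (2 * v) * majorant y" by simp
    also have "\<dots> \<le> (2 * (norm x)\<^sup>2 + 2) * exp (2 * v) * majorant y"
      using cutoff_bounds(5) by (intro mult_right_mono) auto
    finally show ?thesis using True by simp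
  next
    case False
    let ?s = "(exp v * norm y)\<^sup>2 / 2"
    have "?s * exp (- ?s) \<le> 1" by (rule mult_exp_minus_le_one) simp
    moreover have s: "?s = exp (2 * v) * ((norm y)\<^sup>2 / 2)" by (simp add: power_mult_distrib exp_double)
    ultimately have "exp (2 * v) * ((norm y)\<^sup>2 / 2 * ?e) \<le> 1" by (simp add: mult.assoc)
    then have es: "(norm y)\<^sup>2 / 2 * ?e \<le> exp (- 2 * v)"
      by (simp add: exp_minus field_simps)
    have "wave_packet x v y \<le> 2 * ?e * ((norm y)\<^sup>2 / 2 * majorant y)"
      unfolding wave_packet_def using c e cutoff_bounds[of y] by (intro mult_mono mult_nonneg_nonneg) auto
    also have "\<dots> = 2 * ((norm y)\<^sup>2 / 2 * ?e) * majorant y" by (simp only: mult_ac)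
    also have "\<dots> \<le> 2 * exp (- 2 * v) * majorant y"
      using es cutoff_bounds(5) by (intro mult_right_mono mult_left_mono) auto
    also have "\<dots> \<le> (2 * (norm x)\<^sup>2 + 2) * exp (- 2 * v) * majorant y"
      using cutoff_bounds(5) by (intro mult_right_mono) auto
    finally show ?thesis using False by simp
  qed
qed

definition increment :: "'a \<Rightarrow> real" where
  "increment x = smoothed x 1 - smoothed 0 1"

lemma smoothed_increment: "t > 0 \<Longrightarrow> smoothed x t - smoothed 0 t = increment (x /\<^sub>R sqrt t)"
  by (simp add: smoothed_scale[of t] increment_def)

lemma spectral_limit_gauss: "t > 0 \<Longrightarrow> spectral_limit (\<lambda>y. gauss t y) (- \<kappa> * smoothed 0 t)"
  using spectral_limit_cos_wave[of t 0] by (simp add: cos_wave_def[abs_def])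

lemma cutoff_limit:
  "integrable (spectral_measure k) cutoff"
  "(\<lambda>k. integral\<^sup>L (spectral_measure k) cutoff) \<longlonglongrightarrow> \<kappa> * (\<Sum>j\<in>{1,2,3}. cutoff_coeff j * - ln (sqrt (real j)))"
proof -
  have s: "spectral_limit (\<lambda>y. \<Sum>j\<in>{1,2,3}. cutoff_coeff j * gauss (real j) y)
     (\<Sum>j\<in>{1,2,3}. cutoff_coeff j * (- \<kappa> * smoothed 0 (real j)))"
    by (intro spectral_limit_sum spectral_limit_gauss) auto
  have e: "(\<Sum>j\<in>{1,2,3}. cutoff_coeff j * (- \<kappa> * smoothed 0 (real j))) = \<kappa> * (\<Sum>j\<in>{1,2,3}. cutoff_coeff j * - ln (sqrt (real j)))"
    using smoothed_scale[of 2 0] smoothed_scale[of 3 0] by (simp add: cutoff_coeff_def algebra_simps)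
  have l: "spectral_limit cutoff (\<kappa> * (\<Sum>j\<in>{1,2,3}. cutoff_coeff j * - ln (sqrt (real j))))"
    using s unfolding e cutoff_sum[symmetric] .
  then show "integrable (spectral_measure k) cutoff"
    by (intro spectral_measure_integrable) (simp add: spectral_limit_def)
  show "(\<lambda>k. integral\<^sup>L (spectral_measure k) cutoff) \<longlonglongrightarrow> \<kappa> * (\<Sum>j\<in>{1,2,3}. cutoff_coeff j * - ln (sqrt (real j)))"
    by (rule spectral_measure_limit[OF l, of "1/2"]) (use cutoff_bounds in simp)
qed

lemma majorant_integrable: "integrable (spectral_measure k) majorant"
  and majorant_bounded: "\<exists>C. \<forall>k. integral\<^sup>L (spectral_measure k) majorant \<le> C"
proof -
  have "spectral_limit (\<lambda>y. gauss (1/2) y - gauss (3/2) y) (- \<kappa> * smoothed 0 (1/2) - - \<kappa> * smoothed 0 (3/2))"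
    by (intro spectral_limit_diff spectral_limit_gauss) auto
  also have "(\<lambda>y::'a. gauss (1/2) y - gauss (3/2) y) = majorant"
    by (simp add: majorant_def fun_eq_iff left_diff_distrib exp_add[symmetric])
  finally have l: "spectral_limit majorant (- \<kappa> * smoothed 0 (1/2) - - \<kappa> * smoothed 0 (3/2))" .
  then show "integrable (spectral_measure k) majorant"
    by (intro spectral_measure_integrable) (simp add: spectral_limit_def)
  have "(\<lambda>k. integral\<^sup>L (spectral_measure k) majorant) \<longlonglongrightarrow> (- \<kappa> * smoothed 0 (1/2) - - \<kappa> * smoothed 0 (3/2))"
    by (rule spectral_measure_limit[OF l, of "1/2"]) (use cutoff_bounds in simp)
  then have "Bseq (\<lambda>k. integral\<^sup>L (spectral_measure k) majorant)" by (intro convergent_imp_Bseq convergentI)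
  then show "\<exists>C. \<forall>k. integral\<^sup>L (spectral_measure k) majorant \<le> C"
    by (metis Bseq_def abs_le_D1 real_norm_def)
qed

text \<open>
  The packet is a combination of \<open>(1 - cos (exp v (x \<bullet> y))) gauss t y\<close> with \<open>t = exp (2 * v) + j\<close>. Homogeneity
  (\<open>smoothed_scale\<close>) turns the limit of each term into an increment at \<open>x / sqrt (1 + j exp (- 2 * v))\<close>, and the
  index \<open>j\<close> acts as the translation of \<open>v\<close> by \<open>- ln (sqrt j)\<close>: the form that \<open>frullani\<close> accepts.
\<close>
lemma wave_packet_limit:
  "integrable (spectral_measure k) (wave_packet x v)"
  "(\<lambda>k. integral\<^sup>L (spectral_measure k) (wave_packet x v)) \<longlonglongrightarrow>
     \<kappa> * (\<Sum>j\<in>{1,2,3}. cutoff_coeff j * increment (x /\<^sub>R sqrt (1 + exp (- 2 * (v + - ln (sqrt (real j)))))))"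
proof -
  let ?t = "\<lambda>j. exp (2 * v) + real j"
  have t: "?t j > 0" for j by (simp add: add_pos_nonneg)
  have eq: "wave_packet x v y = (\<Sum>j\<in>{1,2,3}. cutoff_coeff j * (gauss (?t j) y - cos_wave (exp v *\<^sub>R x) (?t j) y))" for y
  proof -
    have "gauss (?t j) y = exp (- (exp v * norm y)\<^sup>2 / 2) * gauss (real j) y" for j
      unfolding exp_double exp_add[symmetric] by (simp add: power_mult_distrib algebra_simps add_divide_distrib diff_divide_distrib)
    then have "gauss (?t j) y - cos_wave (exp v *\<^sub>R x) (?t j) y
      = (1 - cos (exp v * (x \<bullet> y))) * exp (- (exp v * norm y)\<^sup>2 / 2) * gauss (real j) y" for j
      unfolding cos_wave_def by (simp only: inner_scaleR_left) (simp only: algebra_simps)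
    then show ?thesis unfolding wave_packet_def cutoff_sum sum_distrib_left by (simp only: mult_ac)
  qed
  have lim_eq: "- \<kappa> * smoothed 0 (?t j) - - \<kappa> * smoothed (exp v *\<^sub>R x) (?t j) = \<kappa> * increment (x /\<^sub>R sqrt (1 + exp (- 2 * (v + - ln (sqrt (real j))))))"
    if "j \<in> {1,2,3}" for j
  proof -
    have j: "real j > 0" using that by auto
    have "exp (- 2 * (v + - ln (sqrt (real j)))) = exp (- 2 * v) * real j"
    proof -
      have "- 2 * (v + - ln (sqrt (real j))) = - 2 * v + ln (real j)" using j by (simp add: ln_sqrt)
      then show ?thesis by (simp only: exp_add exp_ln[OF j])
    qed
    then have "?t j = exp (2 * v) * (1 + exp (- 2 * (v + - ln (sqrt (real j)))))"
      by (simp add: distrib_left exp_minus)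
    then have "sqrt (?t j) = exp v * sqrt (1 + exp (- 2 * (v + - ln (sqrt (real j)))))"
      by (simp add: real_sqrt_mult exp_double)
    then have "(exp v *\<^sub>R x) /\<^sub>R sqrt (?t j) = x /\<^sub>R sqrt (1 + exp (- 2 * (v + - ln (sqrt (real j)))))"
      by simp
    moreover have "- \<kappa> * smoothed 0 (?t j) - - \<kappa> * smoothed (exp v *\<^sub>R x) (?t j) = \<kappa> * (smoothed (exp v *\<^sub>R x) (?t j) - smoothed 0 (?t j))"
      by (simp add: algebra_simps)
    ultimately show ?thesis by (simp only: smoothed_increment[OF t])
  qed
  have "spectral_limit (\<lambda>y. \<Sum>j\<in>{1,2,3}. cutoff_coeff j * (gauss (?t j) y - cos_wave (exp v *\<^sub>R x) (?t j) y))
    (\<Sum>j\<in>{1,2,3}. cutoff_coeff j * (- \<kappa> * smoothed 0 (?t j) - - \<kappa> * smoothed (exp v *\<^sub>R x) (?t j)))"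
    by (intro spectral_limit_sum spectral_limit_diff spectral_limit_gauss spectral_limit_cos_wave t)
  also have "(\<Sum>j\<in>{1,2,3}. cutoff_coeff j * (- \<kappa> * smoothed 0 (?t j) - - \<kappa> * smoothed (exp v *\<^sub>R x) (?t j)))
    = (\<Sum>j\<in>{1,2,3}. cutoff_coeff j * (\<kappa> * increment (x /\<^sub>R sqrt (1 + exp (- 2 * (v + - ln (sqrt (real j))))))))"
    by (intro sum.cong refl) (simp only: lim_eq)
  also have "\<dots> = \<kappa> * (\<Sum>j\<in>{1,2,3}. cutoff_coeff j * increment (x /\<^sub>R sqrt (1 + exp (- 2 * (v + - ln (sqrt (real j)))))))"
    by (simp only: sum_distrib_left mult.left_commute)
  finally have l: "spectral_limit (wave_packet x v) (\<kappa> * (\<Sum>j\<in>{1,2,3}. cutoff_coeff j * increment (x /\<^sub>R sqrt (1 + exp (- 2 * (v + - ln (sqrt (real j))))))))"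
    unfolding eq[symmetric] .
  then show "integrable (spectral_measure k) (wave_packet x v)"
    by (intro spectral_measure_integrable) (simp add: spectral_limit_def)
  show "(\<lambda>k. integral\<^sup>L (spectral_measure k) (wave_packet x v)) \<longlonglongrightarrow>
     \<kappa> * (\<Sum>j\<in>{1,2,3}. cutoff_coeff j * increment (x /\<^sub>R sqrt (1 + exp (- 2 * (v + - ln (sqrt (real j)))))))"
    by (rule spectral_measure_limit[OF l, of 1]) (use wave_packet_bound in simp)
qed

end

section \<open>The measure on the sphere\<close>
lemma log_kernel_zero: "log_kernel 0 = 0"
  by (simp add: log_kernel_def cos_gauss_def)

context negative_log
begin

text \<open>The limit of the masses of the cutoff, in units of \<open>\<kappa>\<close>; it equals \<open>2 ln (sqrt 2) - ln (sqrt 3)\<close>.\<close>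
definition total_mass :: real where
  "total_mass = (\<Sum>j\<in>{1,2,3}. cutoff_coeff j * - ln (sqrt (real j)))"

lemma total_mass_pos: "total_mass > 0"
proof -
  have "ln 3 < ln (2 * 2 :: real)" by simp
  also have "ln (2 * 2 :: real) = 2 * ln 2" by (subst ln_mult) auto
  finally show ?thesis by (simp add: total_mass_def cutoff_coeff_def ln_sqrt)
qed

lemma increment_zero: "increment 0 = 0" by (simp add: increment_def)

lemma increment_continuous: "isCont increment x"
  unfolding increment_def[abs_def] by (intro continuous_intros smoothed_continuous)

lemma wave_packet_measurable [measurable]:
  "(\<lambda>(y, v). wave_packet x v y) \<in> borel_measurable (borel \<Otimes>\<^sub>M borel)"
  unfolding wave_packet_def cutoff_def by measurable

text \<open>
  Integrated over all dilations, the limits in \<open>wave_packet_limit\<close> form a Frullani integral of \<open>increment\<close>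
  along the segment from \<open>0\<close> to \<open>x\<close>. Its integrand is nonnegative as a limit of integrals of
  nonnegative packets.
\<close>
lemma wave_packet_integral_limit:
  "(\<lambda>k. LINT v|lborel. integral\<^sup>L (spectral_measure k) (wave_packet x v)) \<longlonglongrightarrow> \<kappa> * (increment x * total_mass)"
proof -
  let ?p = "\<lambda>v. increment (x /\<^sub>R sqrt (1 + exp (- 2 * v)))"
  let ?S = "\<lambda>v. \<Sum>j\<in>{1,2,3}. cutoff_coeff j * ?p (v + - ln (sqrt (real j)))"
  have J0: "0 \<le> integral\<^sup>L (spectral_measure k) (wave_packet x v)" for k v
    by (intro Bochner_Integration.integral_nonneg wave_packet_bound(1))
  have Snn: "0 \<le> ?S v" for v
  proof -
    have "0 \<le> \<kappa> * ?S v"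
      by (rule LIMSEQ_le_const[OF wave_packet_limit(2)]) (use J0 in blast)
    then show ?thesis using \<kappa>_pos by (simp add: zero_le_mult_iff)
  qed
  have pc: "isCont ?p v" for v
    by (rule isCont_o2[OF _ increment_continuous]) (intro continuous_intros; simp add: add_nonneg_eq_0_iff)
  have tends: "(?p \<longlongrightarrow> increment (c *\<^sub>R x)) F" if "((\<lambda>v. inverse (sqrt (1 + exp (- 2 * v)))) \<longlongrightarrow> c) F" for c F
    by (rule isCont_tendsto_compose[OF increment_continuous]) (intro tendsto_intros that)
  have "((\<lambda>v::real. inverse (sqrt (1 + exp (- 2 * v)))) \<longlongrightarrow> 0) at_bot" by real_asymp
  from tends[OF this] have bot: "(?p \<longlongrightarrow> 0) at_bot" by (simp add: increment_zero)
  have "((\<lambda>v::real. inverse (sqrt (1 + exp (- 2 * v)))) \<longlongrightarrow> 1) at_top" by real_asymp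
  from tends[OF this] have top: "(?p \<longlongrightarrow> increment x) at_top" by simp
  have c0: "sum cutoff_coeff {1,2,3} = 0" by (simp add: cutoff_coeff_def)
  have fr: "(LBINT v. ?S v) = increment x * total_mass"
    using frullani(2)[OF pc bot top c0, of "\<lambda>j. - ln (sqrt (real j))"] Snn
    by (simp only: total_mass_def diff_zero)
  have Si: "integrable lborel ?S"
    using frullani(1)[OF pc bot top c0, of "\<lambda>j. - ln (sqrt (real j))"] Snn by simp
  obtain C where C: "\<And>k. integral\<^sup>L (spectral_measure k) majorant \<le> C" using majorant_bounded by blast
  have "(\<lambda>k. LINT v|lborel. integral\<^sup>L (spectral_measure k) (wave_packet x v)) \<longlonglongrightarrow> (LBINT v. \<kappa> * ?S v)"
  proof (rule integral_dominated_convergence[where w="\<lambda>v. (2 * (norm x)\<^sup>2 + 2) * \<bar>C\<bar> * (1 / (1 + v\<^sup>2))"])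
    show "integrable lborel (\<lambda>v. (2 * (norm x)\<^sup>2 + 2) * \<bar>C\<bar> * (1 / (1 + v\<^sup>2)))"
      by (intro integrable_mult_right integrable_inverse_square)
    show "AE v in lborel. (\<lambda>k. integral\<^sup>L (spectral_measure k) (wave_packet x v)) \<longlonglongrightarrow> \<kappa> * ?S v"
      by (rule AE_I2) (rule wave_packet_limit(2))
    show "AE v in lborel. norm (integral\<^sup>L (spectral_measure k) (wave_packet x v)) \<le> (2 * (norm x)\<^sup>2 + 2) * \<bar>C\<bar> * (1 / (1 + v\<^sup>2))" for k
    proof (rule AE_I2)
      fix v
      let ?K = "(2 * (norm x)\<^sup>2 + 2) * exp (- 2 * \<bar>v\<bar>)"
      have "integral\<^sup>L (spectral_measure k) (wave_packet x v) \<le> (LINT y|spectral_measure k. ?K * majorant y)"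
        by (intro integral_mono wave_packet_limit(1) integrable_mult_right majorant_integrable wave_packet_bound(2))
      also have "\<dots> = ?K * integral\<^sup>L (spectral_measure k) majorant" by simp
      also have "\<dots> \<le> ?K * \<bar>C\<bar>" using C[of k] by (intro mult_left_mono) auto
      also have "\<dots> = (2 * (norm x)\<^sup>2 + 2) * \<bar>C\<bar> * exp (- 2 * \<bar>v\<bar>)" by simp
      also have "\<dots> \<le> (2 * (norm x)\<^sup>2 + 2) * \<bar>C\<bar> * (1 / (1 + v\<^sup>2))"
        by (intro mult_left_mono exp_abs_le_inverse_square) auto
      finally show "norm (integral\<^sup>L (spectral_measure k) (wave_packet x v)) \<le> (2 * (norm x)\<^sup>2 + 2) * \<bar>C\<bar> * (1 / (1 + v\<^sup>2))"
        using J0 by simp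
    qed
    interpret sigma_finite_measure "spectral_measure k" for k by (rule spectral_measure_sigma_finite)
    show "(\<lambda>v. integral\<^sup>L (spectral_measure k) (wave_packet x v)) \<in> borel_measurable lborel" for k
    proof (rule borel_measurable_lebesgue_integral)
      have "(\<lambda>p. (\<lambda>(y, v). wave_packet x v y) (snd p, fst p)) \<in> borel_measurable (borel \<Otimes>\<^sub>M borel)"
        by measurable
      then show "(\<lambda>(v, y). wave_packet x v y) \<in> borel_measurable (lborel \<Otimes>\<^sub>M spectral_measure k)"
        by (simp add: case_prod_beta' cong: measurable_cong_sets sets_pair_measure_cong)
    qed
    show "(\<lambda>v. \<kappa> * ?S v) \<in> borel_measurable lborel" using Si by (intro borel_measurable_times borel_measurable_integrable) auto
  qed
  then show ?thesis by (simp only: integral_mult_right_zero fr)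
qed

text \<open>
  For fixed \<open>y\<close>, integrating over all dilations removes the dependence on \<open>norm y\<close> (\<open>log_kernel_radial\<close>), so only the
  direction of \<open>y\<close> remains.
\<close>
lemma wave_packet_Fubini:
  "(LBINT v. integral\<^sup>L (spectral_measure k) (wave_packet x v))
    = (LINT y|spectral_measure k. cutoff y * log_kernel (x \<bullet> sgn y))"
proof -
  interpret sigma_finite_measure "spectral_measure k" by (rule spectral_measure_sigma_finite)
  interpret pair_sigma_finite "spectral_measure k" lborel ..
  have m: "(\<lambda>(y, v). wave_packet x v y) \<in> borel_measurable (spectral_measure k \<Otimes>\<^sub>M (lborel :: real measure))"
    using wave_packet_measurable[of x] by (simp cong: measurable_cong_sets sets_pair_measure_cong)
  let ?K = "2 * (norm x)\<^sup>2 + 2" and ?I = "LBINT v. 1 / (1 + v\<^sup>2 :: real)"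
  have b: "wave_packet x v y \<le> ?K * majorant y * (1 / (1 + v\<^sup>2))" for v y
  proof -
    have "wave_packet x v y \<le> ?K * majorant y * exp (- 2 * \<bar>v\<bar>)"
      using wave_packet_bound(2)[of x v y] by (simp only: mult_ac)
    also have "\<dots> \<le> ?K * majorant y * (1 / (1 + v\<^sup>2))"
      using cutoff_bounds(5)[of y] by (intro mult_left_mono exp_abs_le_inverse_square) auto
    finally show ?thesis .
  qed
  have iv: "integrable lborel (\<lambda>v. ?K * majorant y * (1 / (1 + v\<^sup>2 :: real)))" for y
    by (intro integrable_mult_right integrable_inverse_square)
  have iy: "integrable lborel (\<lambda>v. wave_packet x v y)" for y
  proof (rule Bochner_Integration.integrable_bound[OF iv])
    show "AE v in lborel. norm (wave_packet x v y) \<le> norm (?K * majorant y * (1 / (1 + v\<^sup>2)))"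
      by (rule AE_I2, simp only: real_norm_def abs_of_nonneg[OF wave_packet_bound(1)], rule order_trans[OF b abs_ge_self])
    show "(\<lambda>v. wave_packet x v y) \<in> borel_measurable lborel" unfolding wave_packet_def by measurable
  qed
  have F: "integrable (spectral_measure k \<Otimes>\<^sub>M lborel) (\<lambda>(y, v). wave_packet x v y)"
  proof (rule Fubini_integrable[OF m])
    show "AE y in spectral_measure k. integrable lborel (\<lambda>v. case (y, v) of (y, v) \<Rightarrow> wave_packet x v y)"
      using iy by simp
    show "integrable (spectral_measure k) (\<lambda>y. LINT v|lborel. norm (case (y, v) of (y, v) \<Rightarrow> wave_packet x v y))"
    proof (rule Bochner_Integration.integrable_bound)
      show "integrable (spectral_measure k) (\<lambda>y. ?K * ?I * majorant y)"
        by (intro integrable_mult_right majorant_integrable)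
      show "AE y in spectral_measure k. norm (LBINT v. norm (case (y, v) of (y, v) \<Rightarrow> wave_packet x v y)) \<le> norm (?K * ?I * majorant y)"
      proof (rule AE_I2)
        fix y
        have "(LBINT v. wave_packet x v y) \<le> (LBINT v. ?K * majorant y * (1 / (1 + v\<^sup>2)))"
          by (intro integral_mono iy iv b)
        also have "\<dots> = ?K * ?I * majorant y"
          by (subst integral_mult_right_zero) (simp only: mult_ac)
        finally have "(LBINT v. wave_packet x v y) \<le> ?K * ?I * majorant y" .
        moreover have "0 \<le> (LBINT v. wave_packet x v y)"
          by (intro Bochner_Integration.integral_nonneg wave_packet_bound(1))
        ultimately show "norm (LBINT v. norm (case (y, v) of (y, v) \<Rightarrow> wave_packet x v y)) \<le> norm (?K * ?I * majorant y)"
          using wave_packet_bound(1) by simp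
      qed
      show "(\<lambda>y. LINT v|lborel. norm (case (y, v) of (y, v) \<Rightarrow> wave_packet x v y)) \<in> borel_measurable (spectral_measure k)"
        using m by measurable
    qed
  qed
  have "(LBINT v. integral\<^sup>L (spectral_measure k) (wave_packet x v)) = (LINT y|spectral_measure k. LINT v|lborel. wave_packet x v y)"
    using Fubini_integral[OF F] by simp
  also have "\<dots> = (LINT y|spectral_measure k. cutoff y * log_kernel (x \<bullet> sgn y))"
  proof (rule integral_cong_AE)
    show "AE y in spectral_measure k. (LBINT v. wave_packet x v y) = cutoff y * log_kernel (x \<bullet> sgn y)"
      using spectral_measure_AE
    proof eventually_elim
      case (elim y)
      then have r: "norm y > 0" and e: "norm y * (x \<bullet> sgn y) = x \<bullet> y" by (simp_all add: sgn_div_norm)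
      have "(LBINT v. wave_packet x v y) = (LBINT v. (1 - cos (exp v * (x \<bullet> y))) * exp (- (exp v * norm y)\<^sup>2 / 2)) * cutoff y"
        unfolding wave_packet_def by (rule integral_mult_left_zero)
      also have "\<dots> = log_kernel (x \<bullet> sgn y) * cutoff y"
        unfolding log_kernel_radial[OF r, of "x \<bullet> sgn y", unfolded e] ..
      finally show ?case by (simp only: mult.commute)
    qed
    show "(\<lambda>y. LINT v|lborel. wave_packet x v y) \<in> borel_measurable (spectral_measure k)"
      using integrable_fst'[OF F] by simp
    have [measurable]: "log_kernel \<in> borel_measurable borel"
      by (intro borel_measurable_continuous_onI continuous_at_imp_continuous_on ballI log_kernel_continuous)
    show "(\<lambda>y. cutoff y * log_kernel (x \<bullet> sgn y)) \<in> borel_measurable (spectral_measure k)"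
      unfolding cutoff_def sgn_div_norm by measurable
  qed
  finally show ?thesis .
qed

text \<open>
  The spectral measures, weighted by the normalised cutoff and projected to the sphere, are
  probability measures for large \<open>k\<close>. By \<open>wave_packet_Fubini\<close> their integrals of \<open>log_kernel (x \<bullet> \<xi>)\<close> are
  those of \<open>wave_packet_integral_limit\<close> divided by the mass, and the constants cancel in the limit. The
  normalisation to total mass \<open>1\<close> comes for free; it reflects the coefficient \<open>1\<close> of \<open>ln c\<close> in
  \<open>f (c x) = ln c + f x\<close>.
\<close>
theorem spectral_representation:
  obtains \<mu> :: "'a measure" where "prob_space \<mu>" "sets \<mu> = sets borel" "AE \<xi> in \<mu>. norm \<xi> = 1"
    "\<And>x. (LINT \<xi>|\<mu>. log_kernel (x \<bullet> \<xi>)) = increment x"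
proof -
  have [measurable]: "log_kernel \<in> borel_measurable borel"
    by (intro borel_measurable_continuous_onI continuous_at_imp_continuous_on ballI log_kernel_continuous)
  have [measurable]: "sgn \<in> borel_measurable (borel :: 'a measure)" "cutoff \<in> borel_measurable borel"
    unfolding sgn_div_norm[abs_def] cutoff_def[abs_def] by measurable
  define m where "m k = integral\<^sup>L (spectral_measure k) cutoff" for k
  have m: "m \<longlonglongrightarrow> \<kappa> * total_mass"
    unfolding m_def total_mass_def by (rule cutoff_limit(2))
  have pos: "\<kappa> * total_mass > 0" using \<kappa>_pos total_mass_pos by simp
  obtain k0 where k0: "\<And>k. k \<ge> k0 \<Longrightarrow> m k > 0"
    using order_tendstoD(1)[OF m pos] by (auto simp: eventually_sequentially)
  define D where "D k = density (spectral_measure k) (\<lambda>y. ennreal (cutoff y / m k))" for k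
  define P where "P k = distr (D k) borel sgn" for k
  have Dint: "integral\<^sup>L (P k) g = (LINT y|spectral_measure k. (cutoff y / m k) *\<^sub>R g (sgn y))"
    if k: "m k > 0" and [measurable]: "g \<in> borel_measurable borel" for k and g :: "'a \<Rightarrow> real"
    unfolding P_def D_def using k cutoff_bounds(1)
    by (subst integral_distr, measurable) (subst integral_density; auto)
  have prob: "prob_space (P k)" if "k \<ge> k0" for k
  proof -
    have mk: "m k > 0" by (rule k0[OF that])
    have "emeasure (D k) (space (D k)) = (\<integral>\<^sup>+ y. ennreal (cutoff y / m k) \<partial>spectral_measure k)"
      unfolding D_def by (subst emeasure_density) (auto intro!: nn_integral_cong simp: spectral_measure_def)
    also have "\<dots> = ennreal (LINT y|spectral_measure k. cutoff y / m k)"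
      using cutoff_limit(1) cutoff_bounds(1) mk by (intro nn_integral_eq_integral) auto
    also have "(LINT y|spectral_measure k. cutoff y / m k) = 1" using mk by (simp add: m_def)
    finally have "prob_space (D k)" by (intro prob_spaceI) simp
    then show ?thesis unfolding P_def by (rule prob_space.prob_space_distr) (simp add: D_def)
  qed
  have sph: "AE \<xi> in P k. \<xi> \<in> sphere 0 1" for k
  proof -
    have "AE y in spectral_measure k. 0 < ennreal (cutoff y / m k) \<longrightarrow> sgn y \<in> sphere 0 1"
      using spectral_measure_AE[of k] by eventually_elim (simp add: norm_sgn)
    then have "AE y in D k. sgn y \<in> sphere 0 1"
      unfolding D_def by (subst AE_density) auto
    then show ?thesis unfolding P_def by (subst AE_distr_iff) (auto simp: D_def)
  qed
  obtain r \<mu> where r: "strict_mono (r :: nat \<Rightarrow> nat)" and \<mu>: "prob_space \<mu>" "sets \<mu> = sets borel" "AE \<xi> in \<mu>. \<xi> \<in> sphere 0 1"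
    and w: "\<And>g :: 'a \<Rightarrow> real. continuous_on UNIV g \<Longrightarrow> (\<lambda>k. integral\<^sup>L (P (k0 + r k)) g) \<longlonglongrightarrow> integral\<^sup>L \<mu> g"
    using weak_compactness[of "\<lambda>k. P (k0 + k)" "sphere 0 1"] prob sph by (auto simp: P_def)
  have "(LINT \<xi>|\<mu>. log_kernel (x \<bullet> \<xi>)) = increment x" for x
  proof -
    let ?g = "\<lambda>\<xi>. log_kernel (x \<bullet> \<xi>)"
    have "continuous_on UNIV ?g"
      by (intro continuous_at_imp_continuous_on ballI isCont_o2[OF _ log_kernel_continuous]) (intro continuous_intros)
    then have a: "(\<lambda>k. integral\<^sup>L (P (k0 + r k)) ?g) \<longlonglongrightarrow> integral\<^sup>L \<mu> ?g" by (rule w)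
    have e: "integral\<^sup>L (P k) ?g = (LBINT v. integral\<^sup>L (spectral_measure k) (wave_packet x v)) / m k" if "k \<ge> k0" for k
    proof -
      have "integral\<^sup>L (P k) ?g = (LINT y|spectral_measure k. (cutoff y * log_kernel (x \<bullet> sgn y)) / m k)"
        by (subst Dint[OF k0[OF that]]) auto
      then show ?thesis unfolding wave_packet_Fubini by simp
    qed
    have "(\<lambda>k. (LBINT v. integral\<^sup>L (spectral_measure k) (wave_packet x v)) / m k) \<longlonglongrightarrow> \<kappa> * (increment x * total_mass) / (\<kappa> * total_mass)"
      using pos by (intro tendsto_divide wave_packet_integral_limit m) auto
    moreover have "\<kappa> * (increment x * total_mass) / (\<kappa> * total_mass) = increment x"
      using \<kappa>_pos total_mass_pos by simp
    moreover have "filterlim (\<lambda>k. k0 + r k) sequentially sequentially"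
      using filterlim_subseq[OF r] by (rule filterlim_at_top_mono) (auto intro: always_eventually)
    ultimately have "(\<lambda>k. (LBINT v. integral\<^sup>L (spectral_measure (k0 + r k)) (wave_packet x v)) / m (k0 + r k)) \<longlonglongrightarrow> increment x"
      using filterlim_compose by fastforce
    then have "(\<lambda>k. integral\<^sup>L (P (k0 + r k)) ?g) \<longlonglongrightarrow> increment x" by (simp add: e)
    then show ?thesis using a by (rule LIMSEQ_unique[rotated])
  qed
  then show ?thesis using that[of \<mu>] \<mu> by simp
qed

end

section \<open>Recovering the logarithm from its Gaussian averages\<close>
lemma homogeneous_log_ln_abs: "homogeneous_log (\<lambda>u::real. ln \<bar>u\<bar>) 0"
proof
  show "(\<lambda>u::real. ln \<bar>u\<bar>) \<in> borel_measurable borel" by measurable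
qed (auto simp: abs_mult ln_mult intro!: continuous_intros)

interpretation real_log: homogeneous_log "\<lambda>u::real. ln \<bar>u\<bar>" 0
  by (rule homogeneous_log_ln_abs)

text \<open>The first half of the theorem, applied to the point mass at \<open>1\<close>.\<close>
lemma negative_log_ln_abs: "negative_log (\<lambda>u::real. ln \<bar>u\<bar>) 0"
proof (intro negative_log.intro homogeneous_log_ln_abs negative_log_axioms.intro)
  show "negative_outside_origin (fourier_distr (regular_distr (\<lambda>u::real. ln \<bar>u\<bar>)))"
    unfolding negative_outside_origin_def
  proof (intro allI impI)
    fix \<phi> :: "real \<Rightarrow> complex"
    assume \<phi>: "schwartz \<phi> \<and> (\<forall>x. \<phi> x \<in> \<real>\<^sub>\<ge>\<^sub>0) \<and> compact (closure {x. \<phi> x \<noteq> 0}) \<and> 0 \<notin> closure {x. \<phi> x \<noteq> 0}"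
    then have "\<phi> 0 = 0" using closure_subset[of "{x. \<phi> x \<noteq> 0}"] by auto
    interpret r: prob_space "return borel (1::real)" by (rule prob_space_return) simp
    show "fourier_distr (regular_distr (\<lambda>u::real. ln \<bar>u\<bar>)) \<phi> \<in> \<real>\<^sub>\<le>\<^sub>0"
      unfolding fourier_distr_def regular_distr_def
    proof (rule real_log.fourier_nonpos_of_log_integral[where \<mu>="return borel 1" and C=0])
      show "finite_measure (return borel (1::real))" by (rule r.finite_measure_axioms)
      fix x :: real
      show "integrable (return borel 1) (\<lambda>\<xi>. ln \<bar>x \<bullet> \<xi>\<bar>)"
        by (rule r.integrable_const_bound[of _ "\<bar>ln \<bar>x\<bar>\<bar>"]) (simp_all add: AE_return)
      show "ln \<bar>x\<bar> = (LINT \<xi>|return borel 1. ln \<bar>x \<bullet> \<xi>\<bar>) + 0"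
        by (subst integral_return) auto
    qed (use \<phi> \<open>\<phi> 0 = 0\<close> in \<open>auto simp: AE_return\<close>)
  qed
qed

interpretation real_log: negative_log "\<lambda>u::real. ln \<bar>u\<bar>" 0
  by (rule negative_log_ln_abs)

text \<open>
  On the line every unit vector is \<open>1\<close> or \<open>-1\<close>, and the kernel is even, so \<open>spectral_representation\<close> determines
  it whatever the measure is.
\<close>
lemma log_kernel_eq_increment: "real_log.increment x = log_kernel x"
proof -
  obtain \<mu> :: "real measure" where \<mu>: "prob_space \<mu>" "sets \<mu> = sets borel" "AE \<xi> in \<mu>. norm \<xi> = 1"
    "\<And>x. (LINT \<xi>|\<mu>. log_kernel (x \<bullet> \<xi>)) = real_log.increment x"
    using real_log.spectral_representation by blast
  interpret prob_space \<mu> by (rule \<mu>)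
  note \<mu>(2)[measurable_cong]
  have [measurable]: "log_kernel \<in> borel_measurable borel"
    by (intro borel_measurable_continuous_onI continuous_at_imp_continuous_on ballI log_kernel_continuous)
  have "(LINT \<xi>|\<mu>. log_kernel (x \<bullet> \<xi>)) = (LINT \<xi>|\<mu>. log_kernel x)"
  proof (rule integral_cong_AE)
    show "AE \<xi> in \<mu>. log_kernel (x \<bullet> \<xi>) = log_kernel x"
      using \<mu>(3)
    proof eventually_elim
      case (elim \<xi>)
      then have "\<bar>x \<bullet> \<xi>\<bar> = \<bar>x\<bar>" by (simp add: abs_mult)
      then show ?case using log_kernel_even by metis
    qed
  qed measurable
  then show ?thesis using \<mu>(4)[of x] by (simp add: prob_space)
qed

abbreviation ln_smoothed :: "real \<Rightarrow> real \<Rightarrow> real" where "ln_smoothed \<equiv> real_log.smoothed"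

lemma ln_smoothed_eq: "t > 0 \<Longrightarrow> ln_smoothed b t = ln (sqrt t) + ln_smoothed 0 1 + log_kernel (b / sqrt t)"
  using real_log.smoothed_scale[of t b] log_kernel_eq_increment[of "b / sqrt t"]
  by (simp add: real_log.increment_def divide_inverse mult.commute)

lemma ln_smoothed_upper:
  obtains c where "c \<ge> 0" "\<And>b t. 0 < t \<Longrightarrow> t \<le> 1 \<Longrightarrow> ln_smoothed b t \<le> \<bar>b\<bar> + c"
proof
  let ?S = "sqrt (2 * pi)"
  let ?I = "(LBINT z. exp (- z\<^sup>2 / 2) * \<bar>z::real\<bar>)"
  have gi: "integrable lborel (\<lambda>z::real. exp (- z\<^sup>2 / 2))"
    using integrable_gaussian[of 1, where 'a=real] by simp
  have ai: "integrable lborel (\<lambda>z::real. exp (- z\<^sup>2 / 2) * \<bar>z\<bar>)"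
    using integrable_mult_right[OF integrable_std_normal_moment_abs[of 1], of ?S]
    by (simp add: std_normal_density_def)
  have gt: "(LBINT z. exp (- z\<^sup>2 / 2)) = ?S"
    using gaussian_total[where 'a=real] by simp
  have "0 \<le> ?I" by (intro Bochner_Integration.integral_nonneg) auto
  then show "0 \<le> ?I / ?S" by simp
  fix b t :: real assume t: "0 < t" "t \<le> 1"
  have "(LBINT z. std_gauss z * ln \<bar>b + sqrt t *\<^sub>R z\<bar>) \<le> (LBINT z. \<bar>b\<bar> * exp (- z\<^sup>2 / 2) + exp (- z\<^sup>2 / 2) * \<bar>z\<bar>)"
  proof (rule integral_mono[OF real_log.gauss_f_integrable[OF t(1)]])
    show "integrable lborel (\<lambda>z::real. \<bar>b\<bar> * exp (- z\<^sup>2 / 2) + exp (- z\<^sup>2 / 2) * \<bar>z\<bar>)"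
      using gi ai by simp
    fix z :: real
    have "ln \<bar>b + sqrt t * z\<bar> \<le> \<bar>b + sqrt t * z\<bar>"
      by (cases "b + sqrt t * z = 0") (auto intro: ln_bound)
    also have "\<dots> \<le> \<bar>b\<bar> + sqrt t * \<bar>z\<bar>" using t abs_triangle_ineq[of b "sqrt t * z"] by (simp add: abs_mult)
    also have "\<dots> \<le> \<bar>b\<bar> + 1 * \<bar>z\<bar>" using t by (intro add_left_mono mult_right_mono) auto
    finally have "exp (- z\<^sup>2 / 2) * ln \<bar>b + sqrt t * z\<bar> \<le> exp (- z\<^sup>2 / 2) * (\<bar>b\<bar> + 1 * \<bar>z\<bar>)"
      by (rule mult_left_mono) simp
    then show "std_gauss z * ln \<bar>b + sqrt t *\<^sub>R z\<bar> \<le> \<bar>b\<bar> * exp (- z\<^sup>2 / 2) + exp (- z\<^sup>2 / 2) * \<bar>z\<bar>"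
      by (simp add: algebra_simps)
  qed
  also have "\<dots> = \<bar>b\<bar> * (LBINT z. exp (- z\<^sup>2 / 2)) + ?I"
    by (subst Bochner_Integration.integral_add) (use gi ai in auto)
  also have "\<dots> = \<bar>b\<bar> * ?S + ?I" by (simp only: gt)
  finally have "(LBINT z. std_gauss z * ln \<bar>b + sqrt t *\<^sub>R z\<bar>) / ?S \<le> (\<bar>b\<bar> * ?S + ?I) / ?S"
    by (rule divide_right_mono) simp
  also have "\<dots> = \<bar>b\<bar> + ?I / ?S" by (simp add: add_divide_distrib)
  finally show "ln_smoothed b t \<le> \<bar>b\<bar> + ?I / ?S"
    by (simp add: real_log.smoothed_def)
qed

text \<open>
  By scaling only \<open>b = 1\<close> matters. For small variance the average is close to \<open>ln 1 = 0\<close>; for large variance it is at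
  least a constant because the kernel is nonnegative.
\<close>
lemma ln_smoothed_lower:
  obtains c where "\<And>b t. b \<noteq> 0 \<Longrightarrow> 0 < t \<Longrightarrow> ln \<bar>b\<bar> - c \<le> ln_smoothed b t"
proof -
  have "((\<lambda>t. ln_smoothed 1 t) \<longlongrightarrow> 0) (at_right 0)"
    using real_log.smoothed_tendsto[of 1] by simp
  then have "eventually (\<lambda>t. - 1 < ln_smoothed 1 t) (at_right 0)"
    by (rule order_tendstoD) simp
  then obtain t0 where t0: "t0 > 0" "\<And>t. 0 < t \<Longrightarrow> t < t0 \<Longrightarrow> - 1 < ln_smoothed 1 t"
    unfolding eventually_at_right_field by auto
  define c where "c = max 1 (- ln_smoothed 0 1 - ln (sqrt t0))"
  show ?thesis
  proof (rule that[of c])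
    fix b t :: real assume b: "b \<noteq> 0" and t: "0 < t"
    define s where "s = t / b\<^sup>2"
    have s: "s > 0" using b t by (simp add: s_def)
    have st: "sqrt t = \<bar>b\<bar> * sqrt s" using b by (simp add: s_def real_sqrt_divide)
    have "\<bar>b / sqrt t\<bar> = 1 / sqrt s" using b s by (simp add: st abs_mult)
    then have "log_kernel (b / sqrt t) = log_kernel (1 / sqrt s)"
      using log_kernel_even[of "b / sqrt t"] by (simp only:)
    then have eq: "ln_smoothed b t = ln \<bar>b\<bar> + ln_smoothed 1 s"
      using b s by (simp add: ln_smoothed_eq[OF t] ln_smoothed_eq[OF s] st ln_mult)
    have "- c \<le> ln_smoothed 1 s"
    proof (cases "s < t0")
      case True
      then show ?thesis using t0(2)[OF s] by (simp add: c_def)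
    next
      case False
      then have "ln (sqrt t0) \<le> ln (sqrt s)" using t0 s by (intro ln_mono) auto
      then have "ln (sqrt t0) + ln_smoothed 0 1 \<le> ln_smoothed 1 s"
        using log_kernel_nonneg[of "1 / sqrt s"] by (simp add: ln_smoothed_eq[OF s])
      then show ?thesis by (simp add: c_def max_def)
    qed
    then show "ln \<bar>b\<bar> - c \<le> ln_smoothed b t" unfolding eq by simp
  qed
qed

lemma ln_smoothed_measurable [measurable]: "(\<lambda>b. ln_smoothed b t) \<in> borel_measurable borel"
  unfolding real_log.smoothed_def by measurable

context negative_log
begin

text \<open>
  At every scale \<open>t\<close> the averages satisfy \<open>smoothed x t = \<integral> ln_smoothed (x \<bullet> \<xi>) t d\<mu> + C\<close>. As \<open>t \<rightarrow> 0\<close> the left side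
  tends to \<open>f x\<close>. On the right, Fatou's lemma with the bound \<open>ln_smoothed_upper\<close> shows that \<open>ln \<bar>x \<bullet> \<xi>\<bar>\<close> is
  integrable and that \<open>x \<bullet> \<xi> = 0\<close> only on a null set, where the averages tend to \<open>- \<infinity>\<close>; then
  \<open>ln_smoothed_lower\<close> permits dominated convergence.
\<close>
theorem log_integral_representation:
  obtains \<mu> :: "'a measure" and C :: real where "prob_space \<mu>" "sets \<mu> = sets borel" "AE \<xi> in \<mu>. norm \<xi> = 1"
    "\<And>x. x \<noteq> 0 \<Longrightarrow> AE \<xi> in \<mu>. x \<bullet> \<xi> \<noteq> 0"
    "\<And>x. x \<noteq> 0 \<Longrightarrow> integrable \<mu> (\<lambda>\<xi>. ln \<bar>x \<bullet> \<xi>\<bar>)"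
    "\<And>x. x \<noteq> 0 \<Longrightarrow> f x = (LINT \<xi>|\<mu>. ln \<bar>x \<bullet> \<xi>\<bar>) + C"
proof -
  obtain \<mu> :: "'a measure" where \<mu>: "prob_space \<mu>" "sets \<mu> = sets borel" "AE \<xi> in \<mu>. norm \<xi> = 1"
    and rep: "\<And>x. (LINT \<xi>|\<mu>. log_kernel (x \<bullet> \<xi>)) = increment x"
    using spectral_representation by blast
  interpret prob_space \<mu> by (rule \<mu>)
  note \<mu>(2)[measurable_cong]
  have [measurable]: "log_kernel \<in> borel_measurable borel"
    by (intro borel_measurable_continuous_onI continuous_at_imp_continuous_on ballI log_kernel_continuous)
  obtain c1 where c1: "c1 \<ge> 0" "\<And>b t. 0 < t \<Longrightarrow> t \<le> 1 \<Longrightarrow> ln_smoothed b t \<le> \<bar>b\<bar> + c1"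
    by (rule ln_smoothed_upper) blast
  obtain c2 where c2: "\<And>b t. b \<noteq> 0 \<Longrightarrow> 0 < t \<Longrightarrow> ln \<bar>b\<bar> - c2 \<le> ln_smoothed b t"
    by (rule ln_smoothed_lower) blast
  have cs: "AE \<xi> in \<mu>. \<bar>x \<bullet> \<xi>\<bar> \<le> norm x" for x
    using \<mu>(3)
  proof eventually_elim
    case (elim \<xi>)
    then show ?case using Cauchy_Schwarz_ineq2[of x \<xi>] by simp
  qed
  define C where "C = smoothed 0 1 - ln_smoothed 0 1"
  have ui: "integrable \<mu> (\<lambda>\<xi>. ln_smoothed (x \<bullet> \<xi>) t)"
    and uv: "(LINT \<xi>|\<mu>. ln_smoothed (x \<bullet> \<xi>) t) = smoothed x t - C"
    if t: "0 < t" "t \<le> 1" for x t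
  proof -
    have ki: "integrable \<mu> (\<lambda>\<xi>. log_kernel ((x /\<^sub>R sqrt t) \<bullet> \<xi>))"
    proof (rule integrable_const_bound)
      show "AE \<xi> in \<mu>. norm (log_kernel ((x /\<^sub>R sqrt t) \<bullet> \<xi>)) \<le> norm x + c1 - ln (sqrt t) - ln_smoothed 0 1"
        using cs[of x]
      proof eventually_elim
        case (elim \<xi>)
        have "log_kernel ((x \<bullet> \<xi>) / sqrt t) \<le> norm x + c1 - ln (sqrt t) - ln_smoothed 0 1"
          using c1(2)[OF t, of "x \<bullet> \<xi>"] elim unfolding ln_smoothed_eq[OF t(1)] by linarith
        moreover have "(x /\<^sub>R sqrt t) \<bullet> \<xi> = (x \<bullet> \<xi>) / sqrt t" by (simp add: divide_inverse mult.commute)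
        ultimately show ?case using log_kernel_nonneg by simp
      qed
    qed measurable
    have e: "ln_smoothed (x \<bullet> \<xi>) t = ln (sqrt t) + ln_smoothed 0 1 + log_kernel ((x /\<^sub>R sqrt t) \<bullet> \<xi>)" for \<xi>
      by (simp add: ln_smoothed_eq[OF t(1)] divide_inverse mult.commute)
    show "integrable \<mu> (\<lambda>\<xi>. ln_smoothed (x \<bullet> \<xi>) t)"
      unfolding e using ki by simp
    have "(LINT \<xi>|\<mu>. ln_smoothed (x \<bullet> \<xi>) t) = ln (sqrt t) + ln_smoothed 0 1 + increment (x /\<^sub>R sqrt t)"
      unfolding e rep[symmetric] using ki by (subst Bochner_Integration.integral_add) (auto simp: prob_space)
    then show "(LINT \<xi>|\<mu>. ln_smoothed (x \<bullet> \<xi>) t) = smoothed x t - C"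
      by (simp add: C_def smoothed_scale[OF t(1)] increment_def)
  qed
  define h where "h k = inverse (real (Suc k))" for k
  have h: "0 < h k" "h k \<le> 1" for k by (auto simp: h_def divide_simps)
  have h0: "h \<longlonglongrightarrow> 0" unfolding h_def by (rule LIMSEQ_inverse_real_of_nat)
  have hr: "filterlim h (at_right 0) sequentially"
    unfolding filterlim_at using h0 less_imp_neq[OF h(1)] h(1) by (auto intro!: always_eventually)
  have main: "(AE \<xi> in \<mu>. x \<bullet> \<xi> \<noteq> 0) \<and> integrable \<mu> (\<lambda>\<xi>. ln \<bar>x \<bullet> \<xi>\<bar>) \<and> f x = (LINT \<xi>|\<mu>. ln \<bar>x \<bullet> \<xi>\<bar>) + C"
    if x: "x \<noteq> 0" for x
  proof -
    define u where "u k \<xi> = ln_smoothed (x \<bullet> \<xi>) (h k)" for k \<xi>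
    define c where "c = norm x + c1"
    have [measurable]: "u k \<in> borel_measurable \<mu>" for k unfolding u_def[abs_def] by measurable
    have ub: "AE \<xi> in \<mu>. \<forall>k. u k \<xi> \<le> c"
      using cs[of x]
    proof eventually_elim
      case (elim \<xi>)
      have "u k \<xi> \<le> c" for k
        using c1(2)[OF h(1)[of k] h(2)[of k], of "x \<bullet> \<xi>"] elim by (simp add: u_def c_def)
      then show ?case ..
    qed
    have lim: "(\<lambda>k. u k \<xi>) \<longlonglongrightarrow> ln \<bar>x \<bullet> \<xi>\<bar>" if "x \<bullet> \<xi> \<noteq> 0" for \<xi>
      unfolding u_def by (rule filterlim_compose[OF real_log.smoothed_tendsto[OF that] hr])
    have ilim: "(\<lambda>k. integral\<^sup>L \<mu> (u k)) \<longlonglongrightarrow> f x - C"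
      unfolding u_def uv[OF h] by (intro tendsto_diff tendsto_const filterlim_compose[OF smoothed_tendsto[OF x] hr])
    have nn: "(\<integral>\<^sup>+ \<xi>. ennreal (c - u k \<xi>) \<partial>\<mu>) = ennreal (c - integral\<^sup>L \<mu> (u k))" for k
    proof -
      have "(\<integral>\<^sup>+ \<xi>. ennreal (c - u k \<xi>) \<partial>\<mu>) = ennreal (LINT \<xi>|\<mu>. c - u k \<xi>)"
        using ui[OF h, of x k] ub by (intro nn_integral_eq_integral) (auto simp: u_def elim!: eventually_mono)
      also have "(LINT \<xi>|\<mu>. c - u k \<xi>) = c - integral\<^sup>L \<mu> (u k)"
        using ui[OF h, of x k] by (simp add: u_def[abs_def] prob_space)
      finally show ?thesis .
    qed
    have "(\<integral>\<^sup>+ \<xi>. liminf (\<lambda>k. ennreal (c - u k \<xi>)) \<partial>\<mu>) \<le> liminf (\<lambda>k. \<integral>\<^sup>+ \<xi>. ennreal (c - u k \<xi>) \<partial>\<mu>)"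
      by (rule nn_integral_liminf) measurable
    also have "\<dots> = ennreal (c - (f x - C))"
      unfolding nn by (rule lim_imp_Liminf) (auto intro!: tendsto_intros ilim)
    finally have fatou: "(\<integral>\<^sup>+ \<xi>. liminf (\<lambda>k. ennreal (c - u k \<xi>)) \<partial>\<mu>) < \<infinity>"
      by (rule le_less_trans) simp
    then have fin: "AE \<xi> in \<mu>. liminf (\<lambda>k. ennreal (c - u k \<xi>)) \<noteq> \<infinity>"
      by (intro nn_integral_PInf_AE) auto
    have zero: "liminf (\<lambda>k. ennreal (c - u k \<xi>)) = \<infinity>" if "x \<bullet> \<xi> = 0" for \<xi>
    proof -
      have "filterlim (\<lambda>k. c - (ln (sqrt (h k)) + ln_smoothed 0 1)) at_top sequentially"
      proof -
        have "filterlim (\<lambda>t. c - (ln (sqrt t) + e)) at_top (at_right 0)" for e :: real by real_asymp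
        then show ?thesis by (rule filterlim_compose[OF _ hr])
      qed
      moreover have "u k \<xi> = ln (sqrt (h k)) + ln_smoothed 0 1" for k
        unfolding u_def that ln_smoothed_eq[OF h(1), of 0] by (simp add: log_kernel_zero)
      ultimately have "filterlim (\<lambda>k. c - u k \<xi>) at_top sequentially" by simp
      then have "(\<lambda>k. ennreal (c - u k \<xi>)) \<longlonglongrightarrow> \<infinity>" by (simp add: ennreal_tendsto_top_eq_at_top)
      then show ?thesis by (rule lim_imp_Liminf[rotated]) simp
    qed
    have nz: "AE \<xi> in \<mu>. x \<bullet> \<xi> \<noteq> 0"
      using fin by eventually_elim (use zero in blast)
    have ll: "liminf (\<lambda>k. ennreal (c - u k \<xi>)) = ennreal (c - ln \<bar>x \<bullet> \<xi>\<bar>)" if "x \<bullet> \<xi> \<noteq> 0" for \<xi>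
      by (rule lim_imp_Liminf) (auto intro!: tendsto_intros lim that)
    have lb: "AE \<xi> in \<mu>. ln \<bar>x \<bullet> \<xi>\<bar> \<le> c"
      using nz ub
    proof eventually_elim
      case (elim \<xi>)
      show ?case by (rule LIMSEQ_le_const2[OF lim[OF elim(1)]]) (use elim(2) in blast)
    qed
    have "integrable \<mu> (\<lambda>\<xi>. c - ln \<bar>x \<bullet> \<xi>\<bar>)"
    proof (rule integrableI_nonneg)
      show "AE \<xi> in \<mu>. 0 \<le> c - ln \<bar>x \<bullet> \<xi>\<bar>" using lb by eventually_elim simp
      have "(\<integral>\<^sup>+ \<xi>. ennreal (c - ln \<bar>x \<bullet> \<xi>\<bar>) \<partial>\<mu>) = (\<integral>\<^sup>+ \<xi>. liminf (\<lambda>k. ennreal (c - u k \<xi>)) \<partial>\<mu>)"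
        using nz by (intro nn_integral_cong_AE) (auto elim!: eventually_mono simp: ll)
      then show "(\<integral>\<^sup>+ \<xi>. ennreal (c - ln \<bar>x \<bullet> \<xi>\<bar>) \<partial>\<mu>) < \<infinity>" using fatou by simp
    qed measurable
    from Bochner_Integration.integrable_diff[OF integrable_const[of c] this]
    have li: "integrable \<mu> (\<lambda>\<xi>. ln \<bar>x \<bullet> \<xi>\<bar>)" by simp
    have "(\<lambda>k. integral\<^sup>L \<mu> (u k)) \<longlonglongrightarrow> (LINT \<xi>|\<mu>. ln \<bar>x \<bullet> \<xi>\<bar>)"
    proof (rule integral_dominated_convergence[where w="\<lambda>\<xi>. \<bar>ln \<bar>x \<bullet> \<xi>\<bar>\<bar> + (\<bar>c\<bar> + \<bar>c2\<bar>)"])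
      show "integrable \<mu> (\<lambda>\<xi>. \<bar>ln \<bar>x \<bullet> \<xi>\<bar>\<bar> + (\<bar>c\<bar> + \<bar>c2\<bar>))" using li by simp
      show "AE \<xi> in \<mu>. (\<lambda>k. u k \<xi>) \<longlonglongrightarrow> ln \<bar>x \<bullet> \<xi>\<bar>" using nz by eventually_elim (rule lim)
      show "AE \<xi> in \<mu>. norm (u k \<xi>) \<le> \<bar>ln \<bar>x \<bullet> \<xi>\<bar>\<bar> + (\<bar>c\<bar> + \<bar>c2\<bar>)" for k
        using nz ub
      proof eventually_elim
        case (elim \<xi>)
        then have "u k \<xi> \<le> c" "ln \<bar>x \<bullet> \<xi>\<bar> - c2 \<le> u k \<xi>" using c2[OF elim(1) h(1)[of k]] by (auto simp: u_def)
        then show ?case by (simp add: abs_le_iff) linarith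
      qed
    qed measurable
    then have "f x - C = (LINT \<xi>|\<mu>. ln \<bar>x \<bullet> \<xi>\<bar>)" using ilim by (rule LIMSEQ_unique[rotated])
    then show ?thesis using nz li by simp
  qed
  show ?thesis
    by (rule that[OF \<mu>]) (use main in blast)+
qed

end

section \<open>The characterization of embeddings in \<open>L\<^sub>0\<close>\<close>
theorem theorem3p1:
  fixes K :: "(real ^ 'n) set"
  assumes "symmetric_star_body K"
  shows "embeds_in_L0 K \<longleftrightarrow>
    negative_outside_origin (fourier_distr (regular_distr (\<lambda>x. ln (minkowski_functional K x))))"
proof -
  let ?f = "\<lambda>x. ln (minkowski_functional K x)"
  obtain B where B: "homogeneous_log ?f B" by (rule homogeneous_log_minkowski[OF assms])
  interpret homogeneous_log ?f B by (rule B)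
  have ext_f: "ext_ln (minkowski_functional K x) = ereal (?f x)" if "x \<noteq> 0" for x
    using minkowski_pos[OF assms that] by (simp add: ext_ln_def)
  let ?S = "sphere (0 :: real ^ 'n) 1"
  have S: "?S \<in> sets borel" by simp
  show ?thesis
  proof
    assume "embeds_in_L0 K"
    then obtain \<mu> C where \<mu>: "sets \<mu> = sets (restrict_space borel ?S)" "finite_measure \<mu>"
      and rep: "\<And>x. ext_ln (minkowski_functional K x) = ext_integral \<mu> (\<lambda>\<xi>. ext_ln \<bar>x \<bullet> \<xi>\<bar>) + ereal C"
      unfolding embeds_in_L0_def by blast
    interpret \<mu>: finite_measure \<mu> by fact
    have space: "space \<mu> = ?S" using sets_eq_imp_space_eq[OF \<mu>(1)] by (simp add: space_restrict_space)
    have id: "(\<lambda>\<xi>. \<xi>) \<in> measurable \<mu> borel"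
      using measurable_ident_sets[OF \<mu>(1)] by (rule measurable_compose) (simp add: measurable_restrict_space1)
    have inner: "(\<lambda>\<xi>. x \<bullet> \<xi>) \<in> borel_measurable \<mu>" for x
      by (rule measurable_compose[OF id]) simp
    define \<nu> where "\<nu> = distr \<mu> borel (\<lambda>\<xi>. \<xi>)"
    have pt: "(AE \<xi> in \<mu>. x \<bullet> \<xi> \<noteq> 0) \<and> integrable \<mu> (\<lambda>\<xi>. ln \<bar>x \<bullet> \<xi>\<bar>) \<and> (LINT \<xi>|\<mu>. ln \<bar>x \<bullet> \<xi>\<bar>) = ?f x - C"
      if "x \<noteq> 0" for x
    proof -
      have fin: "ext_integral \<mu> (\<lambda>\<xi>. ext_ln \<bar>x \<bullet> \<xi>\<bar>) = ereal (?f x - C)"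
        using rep[of x] ext_f[OF that] by (cases "ext_integral \<mu> (\<lambda>\<xi>. ext_ln \<bar>x \<bullet> \<xi>\<bar>)") auto
      have bd: "AE \<xi> in \<mu>. \<bar>x \<bullet> \<xi>\<bar> \<le> norm x"
      proof (rule AE_I2)
        fix \<xi> assume "\<xi> \<in> space \<mu>"
        then show "\<bar>x \<bullet> \<xi>\<bar> \<le> norm x" using Cauchy_Schwarz_ineq2[of x \<xi>] by (simp add: space)
      qed
      from ext_integral_ext_ln_finite[OF \<mu>(2) inner bd fin] show ?thesis by blast
    qed
    show "negative_outside_origin (fourier_distr (regular_distr ?f))"
      unfolding negative_outside_origin_def
    proof (intro allI impI)
      fix \<phi> :: "real ^ 'n \<Rightarrow> complex"
      assume \<phi>: "schwartz \<phi> \<and> (\<forall>x. \<phi> x \<in> \<real>\<^sub>\<ge>\<^sub>0) \<and> compact (closure {x. \<phi> x \<noteq> 0}) \<and> 0 \<notin> closure {x. \<phi> x \<noteq> 0}"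
      then have "\<phi> 0 = 0" using closure_subset[of "{x. \<phi> x \<noteq> 0}"] by auto
      show "fourier_distr (regular_distr ?f) \<phi> \<in> \<real>\<^sub>\<le>\<^sub>0"
        unfolding fourier_distr_def regular_distr_def
      proof (rule fourier_nonpos_of_log_integral[where \<mu>=\<nu> and C=C])
        show "finite_measure \<nu>" unfolding \<nu>_def by (rule \<mu>.finite_measure_distr[OF id])
        show "sets \<nu> = sets borel" by (simp add: \<nu>_def)
        show "AE \<xi> in \<nu>. norm \<xi> = 1" unfolding \<nu>_def by (subst AE_distr_iff[OF id]) (auto simp: space)
        fix x :: "real ^ 'n" assume x: "x \<noteq> 0"
        show "AE \<xi> in \<nu>. x \<bullet> \<xi> \<noteq> 0" unfolding \<nu>_def using pt[OF x] by (subst AE_distr_iff[OF id]) auto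
        show "integrable \<nu> (\<lambda>\<xi>. ln \<bar>x \<bullet> \<xi>\<bar>)" unfolding \<nu>_def using pt[OF x] by (subst integrable_distr_eq[OF id]) auto
        show "?f x = (LINT \<xi>|\<nu>. ln \<bar>x \<bullet> \<xi>\<bar>) + C" unfolding \<nu>_def using pt[OF x] by (subst integral_distr[OF id]) auto
      qed (use \<phi> \<open>\<phi> 0 = 0\<close> in auto)
    qed
  next
    assume "negative_outside_origin (fourier_distr (regular_distr ?f))"
    then interpret negative_log ?f B by unfold_locales
    obtain \<nu> :: "(real ^ 'n) measure" and C where \<nu>: "prob_space \<nu>" "sets \<nu> = sets borel" "AE \<xi> in \<nu>. norm \<xi> = 1"
      and nz: "\<And>x. x \<noteq> 0 \<Longrightarrow> AE \<xi> in \<nu>. x \<bullet> \<xi> \<noteq> 0"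
      and int: "\<And>x. x \<noteq> 0 \<Longrightarrow> integrable \<nu> (\<lambda>\<xi>. ln \<bar>x \<bullet> \<xi>\<bar>)"
      and rep: "\<And>x. x \<noteq> 0 \<Longrightarrow> ?f x = (LINT \<xi>|\<nu>. ln \<bar>x \<bullet> \<xi>\<bar>) + C"
      by (rule log_integral_representation) blast
    interpret \<nu>: prob_space \<nu> by fact
    define \<mu> where "\<mu> = restrict_space \<nu> ?S"
    have Sn: "?S \<inter> space \<nu> \<in> sets \<nu>" using S \<nu>(2) sets_eq_imp_space_eq[OF \<nu>(2)] by simp
    have \<mu>s: "sets \<mu> = sets (restrict_space borel ?S)"
      unfolding \<mu>_def by (rule sets_restrict_space_cong[OF \<nu>(2)])
    have \<mu>f: "finite_measure \<mu>" unfolding \<mu>_def by (rule finite_measure_restrict_space) (use S \<nu>(2) \<nu>.finite_measure_axioms in auto)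
    have ext: "ext_integral \<mu> g = ext_integral \<nu> g" for g
      unfolding ext_integral_def \<mu>_def nn_integral_restrict_space[OF Sn]
      using \<nu>(3) by (intro arg_cong2[where f="(-)"] arg_cong[where f=enn2ereal] nn_integral_cong_AE) (auto elim!: eventually_mono)
    have "ext_ln (minkowski_functional K x) = ext_integral \<mu> (\<lambda>\<xi>. ext_ln \<bar>x \<bullet> \<xi>\<bar>) + ereal C" for x
    proof (cases "x = 0")
      case True
      have "ext_integral \<nu> (\<lambda>\<xi>. ext_ln \<bar>x \<bullet> \<xi>\<bar>) = - \<infinity>"
        unfolding ext_integral_def using True by (simp add: ext_ln_def \<nu>.emeasure_space_1 e2ennreal_neg zero_ennreal.rep_eq)
      then show ?thesis unfolding ext using True minkowski_zero[OF assms] by (simp add: ext_ln_def zero_ennreal.rep_eq)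
    next
      case False
      have "(\<lambda>\<xi>. x \<bullet> \<xi>) \<in> borel_measurable \<nu>" using \<nu>(2) by (simp cong: measurable_cong_sets)
      from ext_integral_ext_ln[OF this nz[OF False] int[OF False]] show ?thesis
        unfolding ext ext_f[OF False] rep[OF False] by simp
    qed
    then show "embeds_in_L0 K" unfolding embeds_in_L0_def using \<mu>s \<mu>f by blast
  qed
qed

end
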